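(* Let $\omega\in\hat{\mathcal D}$ and $1\le p\le q<\infty$. There is $\gamma_0>0$, depending only on $\omega,p,q$, such that for each fixed $\gamma>\gamma_0$ the following holds: if $u:\mathbb D\to\mathbb C$ is a measurable function, $\varphi$ is an analytic self-map of $\mathbb D$, $\mu$ is a positive Borel measure on $\mathbb D$, and $uC_\varphi:A_\omega^p\to L_\mu^q$ is bounded, then $$\|uC_\varphi\|_{e,A_\omega^p\to L^q_\mu}^q\approx\limsup_{|a|\to1}\int_{\mathbb D}|F_{a,p,\gamma}(\varphi(z))|^q\,|u(z)|^q\,d\mu(z).$$
   Context: $\mathbb D$ is the open unit disk in $\mathbb C$, $H(\mathbb D)$ is the set of analytic functions on $\mathbb D$, and $dA(z)=\frac1\pi dx\,dy$. A weight is a positive radial function $\omega$ on $\mathbb D$, $\omega(z)=\omega(|z|)$, integrable on $(0,1)$; put $\hat\omega(r)=\int_r^1\omega(s)\,ds$. We write $\omega\in\hat{\mathcal D}$ if there is $C>0$ with $\hat\omega(r)<C\hat\omega(\frac{1+r}2)$ for all $0<r<1$. $A_\omega^p$ is the space of $f\in H(\mathbb D)$ with $\|f\|_{A_\omega^p}^p=\int_{\mathbb D}|f|^p\omega\,dA<\infty$. $L^q_\mu$ is the space of measurable $f$ with $\|f\|_{L^q_\mu}^q=\int_{\mathbb D}|f|^q\,d\mu<\infty$. The weighted composition operator is $(uC_\varphi f)(z)=u(z)f(\varphi(z))$. The essential norm of a linear operator $T:Y\to Z$ between Banach spaces is $\|T\|_{e,Y\to Z}=\inf\{\|T-K\|_{Y\to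 Z}:K\text{ is compact from }Y\text{ to }Z\}$. For $a\in\mathbb D\setminus\{0\}$, let $I_a=\{e^{i\theta}:|\arg(ae^{-i\theta})|\le\frac{1-|a|}2\}$ and $S(a)=\{re^{it}:e^{it}\in I_a,\ |a|\le r<1\}$ (Carleson square). Put $\omega(S(a))=\int_{S(a)}\omega\,dA$ and $$F_{a,p,\gamma}(z)=\left(\frac{1-|a|^2}{1-\bar az}\right)^{\frac{\gamma+1}p}\frac1{\omega(S(a))^{1/p}},\qquad z\in\mathbb D.$$ $A\approx B$ means $C^{-1}B\le A\le CB$ for a constant $C>0$; here $C$ depends only on $\omega,p,q,\gamma$ and not on $u,\varphi,\mu$. *)

theory Defs
  imports "HOL-Complex_Analysis.Complex_Analysis"
begin

abbreviation unit_disk :: "complex set" where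
  "unit_disk \<equiv> ball 0 1"

definition disk_area :: "complex measure" where
  "disk_area = density (lebesgue_on unit_disk) (\<lambda>_. ennreal (1 / pi))"

section \<open>Radial weights\<close>

text \<open>Functions on the disk are total functions on \<^typ>\<open>complex\<close> whose values outside the disk
  are irrelevant. Integrability is with respect to \<^const>\<open>lebesgue\<close>, so weights
  need not be Borel measurable.\<close>

definition radial_weight :: "(complex \<Rightarrow> real) \<Rightarrow> bool" where
  "radial_weight \<omega> \<longleftrightarrow>
     (\<forall>z\<in>unit_disk. 0 < \<omega> z \<and> \<omega> z = \<omega> (of_real (cmod z))) \<and>
     set_integrable lebesgue {0<..<1} (\<lambda>s::real. \<omega> (of_real s))"

definition weight_hat :: "(complex \<Rightarrow> real) \<Rightarrow> real \<Rightarrow> real" where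
  "weight_hat \<omega> r = (LINT s:{r<..<1}|lebesgue. \<omega> (of_real s))"

definition D_hat :: "(complex \<Rightarrow> real) set" where
  "D_hat = {\<omega>. radial_weight \<omega> \<and>
     (\<exists>C>0. \<forall>r. 0 < r \<and> r < 1 \<longrightarrow> weight_hat \<omega> r < C * weight_hat \<omega> ((1 + r) / 2))}"

section \<open>The function spaces\<close>

definition bergman_space :: "(complex \<Rightarrow> real) \<Rightarrow> real \<Rightarrow> (complex \<Rightarrow> complex) set" where
  "bergman_space \<omega> p =
     {f. f holomorphic_on unit_disk \<and> integrable disk_area (\<lambda>z. cmod (f z) powr p * \<omega> z)}"

definition bergman_norm :: "(complex \<Rightarrow> real) \<Rightarrow> real \<Rightarrow> (complex \<Rightarrow> complex) \<Rightarrow> real" where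
  "bergman_norm \<omega> p f = (LINT z|disk_area. cmod (f z) powr p * \<omega> z) powr (1 / p)"

definition Lq_space :: "complex measure \<Rightarrow> real \<Rightarrow> (complex \<Rightarrow> complex) set" where
  "Lq_space \<mu> q = {f \<in> borel_measurable \<mu>. integrable \<mu> (\<lambda>z. cmod (f z) powr q)}"

definition Lq_norm :: "complex measure \<Rightarrow> real \<Rightarrow> (complex \<Rightarrow> complex) \<Rightarrow> real" where
  "Lq_norm \<mu> q f = (LINT z|\<mu>. cmod (f z) powr q) powr (1 / q)"

section \<open>Operators between spaces of functions\<close>

text \<open>A space is given by a carrier \<open>Y\<close> of representing functions and a function \<open>nY\<close> that is a
  seminorm on \<open>Y\<close>; two functions represent the same element if the seminorm of their
  difference vanishes (equality on the disk for \<open>bergman_space\<close>, equality almost everywhere for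
  \<open>Lq_space\<close>). Accordingly, operators are required to be well-defined and linear only up to
  this identification.\<close>

definition linear_op ::
  "('a \<Rightarrow> complex) set \<Rightarrow> (('a \<Rightarrow> complex) \<Rightarrow> real) \<Rightarrow>
   ('b \<Rightarrow> complex) set \<Rightarrow> (('b \<Rightarrow> complex) \<Rightarrow> real) \<Rightarrow>
   (('a \<Rightarrow> complex) \<Rightarrow> ('b \<Rightarrow> complex)) \<Rightarrow> bool" where
  "linear_op Y nY Z nZ T \<longleftrightarrow>
     (\<forall>f\<in>Y. T f \<in> Z) \<and>
     (\<forall>f\<in>Y. \<forall>g\<in>Y. nY (\<lambda>x. f x - g x) = 0 \<longrightarrow> nZ (\<lambda>x. T f x - T g x) = 0) \<and>
     (\<forall>f\<in>Y. \<forall>g\<in>Y. nZ (\<lambda>x. T (\<lambda>y. f y + g y) x - (T f x + T g x)) = 0) \<and>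
     (\<forall>c. \<forall>f\<in>Y. nZ (\<lambda>x. T (\<lambda>y. c * f y) x - c * T f x) = 0)"

definition bounded_op ::
  "('a \<Rightarrow> complex) set \<Rightarrow> (('a \<Rightarrow> complex) \<Rightarrow> real) \<Rightarrow>
   ('b \<Rightarrow> complex) set \<Rightarrow> (('b \<Rightarrow> complex) \<Rightarrow> real) \<Rightarrow>
   (('a \<Rightarrow> complex) \<Rightarrow> ('b \<Rightarrow> complex)) \<Rightarrow> bool" where
  "bounded_op Y nY Z nZ T \<longleftrightarrow>
     linear_op Y nY Z nZ T \<and> (\<exists>B. \<forall>f\<in>Y. nZ (T f) \<le> B * nY f)"

definition compact_op ::
  "('a \<Rightarrow> complex) set \<Rightarrow> (('a \<Rightarrow> complex) \<Rightarrow> real) \<Rightarrow>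
   ('b \<Rightarrow> complex) set \<Rightarrow> (('b \<Rightarrow> complex) \<Rightarrow> real) \<Rightarrow>
   (('a \<Rightarrow> complex) \<Rightarrow> ('b \<Rightarrow> complex)) \<Rightarrow> bool" where
  "compact_op Y nY Z nZ K \<longleftrightarrow>
     linear_op Y nY Z nZ K \<and>
     (\<forall>f B. (\<forall>n::nat. f n \<in> Y \<and> nY (f n) \<le> B) \<longrightarrow>
        (\<exists>s g. strict_mono (s :: nat \<Rightarrow> nat) \<and> g \<in> Z \<and>
           (\<lambda>n. nZ (\<lambda>x. K (f (s n)) x - g x)) \<longlonglongrightarrow> 0))"

text \<open>The supremum is a real number, hence meaningful only for bounded operators; in
  \<open>ess_norm\<close> below this is the case whenever \<open>T\<close> is bounded, since compact operators are
  bounded.\<close>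

definition op_norm ::
  "('a \<Rightarrow> complex) set \<Rightarrow> (('a \<Rightarrow> complex) \<Rightarrow> real) \<Rightarrow>
   (('b \<Rightarrow> complex) \<Rightarrow> real) \<Rightarrow> (('a \<Rightarrow> complex) \<Rightarrow> ('b \<Rightarrow> complex)) \<Rightarrow> real" where
  "op_norm Y nY nZ T = (SUP f\<in>{f \<in> Y. nY f \<le> 1}. nZ (T f))"

definition ess_norm ::
  "('a \<Rightarrow> complex) set \<Rightarrow> (('a \<Rightarrow> complex) \<Rightarrow> real) \<Rightarrow>
   ('b \<Rightarrow> complex) set \<Rightarrow> (('b \<Rightarrow> complex) \<Rightarrow> real) \<Rightarrow>
   (('a \<Rightarrow> complex) \<Rightarrow> ('b \<Rightarrow> complex)) \<Rightarrow> real" where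
  "ess_norm Y nY Z nZ T =
     (INF K\<in>{K. compact_op Y nY Z nZ K}. op_norm Y nY nZ (\<lambda>f x. T f x - K f x))"

definition weighted_comp ::
  "(complex \<Rightarrow> complex) \<Rightarrow> (complex \<Rightarrow> complex) \<Rightarrow> (complex \<Rightarrow> complex) \<Rightarrow> (complex \<Rightarrow> complex)" where
  "weighted_comp u \<phi> f = (\<lambda>z. u z * f (\<phi> z))"

section \<open>Carleson squares and test functions\<close>

definition carleson_arc :: "complex \<Rightarrow> complex set" where
  "carleson_arc a = {cis \<theta> | \<theta>. \<bar>Arg (a * cis (- \<theta>))\<bar> \<le> (1 - cmod a) / 2}"

definition carleson_square :: "complex \<Rightarrow> complex set" where
  "carleson_square a =
     {of_real r * cis t | r t. cis t \<in> carleson_arc a \<and> cmod a \<le> r \<and> r < 1}"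

definition weight_square :: "(complex \<Rightarrow> real) \<Rightarrow> complex \<Rightarrow> real" where
  "weight_square \<omega> a = (LINT z:carleson_square a|disk_area. \<omega> z)"

text \<open>The complex power is the principal branch; its base has positive real part for
  \<open>a\<close>, \<open>z\<close> in the disk.\<close>

definition test_fun ::
  "(complex \<Rightarrow> real) \<Rightarrow> complex \<Rightarrow> real \<Rightarrow> real \<Rightarrow> complex \<Rightarrow> complex" where
  "test_fun \<omega> a p \<gamma> z =
     (of_real (1 - (cmod a)\<^sup>2) / (1 - cnj a * z)) powr of_real ((\<gamma> + 1) / p)
     * of_real (1 / weight_square \<omega> a powr (1 / p))"

end

theory Submission
  imports Defs "HOL-Computational_Algebra.Fundamental_Theorem_Algebra"
begin

text \<open>Write \<open>T = uC\<^sub>\<phi>\<close>, let \<open>\<nu>\<close> be the image under \<open>\<phi>\<close> of the measure \<open>\<bar>u\<bar>\<^sup>q d\<mu>\<close>, so that the \<open>q\<close>-th power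
of the norm of \<open>T f\<close> is \<open>\<integral>\<bar>f\<bar>\<^sup>q d\<nu>\<close>, and let \<open>F\<^sub>a\<close> be the test functions. They are bounded in
the Bergman space and tend to \<open>0\<close> pointwise as \<open>\<bar>a\<bar> \<rightarrow> 1\<close>, once \<open>\<gamma>\<close> exceeds the growth exponent of
the weight.

The lower bound for the essential norm (\<open>compact_difference_lower_bound\<close>). Let \<open>K\<close> be compact
and \<open>\<bar>a\<^sub>n\<bar> \<rightarrow> 1\<close>. For \<open>p = 1\<close> it need not happen that \<open>K F\<^bsub>a\<^sub>n\<^esub> \<rightarrow> 0\<close>, but along a subsequence
\<open>K F\<^bsub>a\<^sub>n\<^esub>\<close> converges, so that \<open>T - K\<close> and \<open>T\<close> almost agree on the differences \<open>F\<^bsub>a\<^sub>n\<^esub> - F\<^bsub>a\<^sub>m\<^esub>\<close>.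
Since \<open>T F\<^bsub>a\<^sub>m\<^esub> \<rightarrow> 0\<close> pointwise, Fatou's lemma, with \<open>n\<close> fixed and \<open>m \<rightarrow> \<infinity>\<close>, bounds the norm of
\<open>T F\<^bsub>a\<^sub>n\<^esub>\<close> by that of \<open>T - K\<close>, up to constants.

The upper bound (\<open>ess_norm_upper_bound\<close>). For \<open>r < 1\<close> the operator \<open>f \<mapsto> 1\<^bsub>{\<bar>\<phi>\<bar> \<le> r}\<^esub> T f\<close> is compact
by Montel's theorem (\<open>cutoff_compact\<close>). What remains of \<open>T\<close> is the embedding of the Bergman space
into \<open>L\<^sup>q\<close> of the restriction of \<open>\<nu>\<close> to \<open>r < \<bar>w\<bar> < 1\<close>. As \<open>F\<^sub>a\<close> is large on the disk of radius
\<open>1 - \<bar>a\<bar>\<close> about \<open>a / \<bar>a\<bar>\<close>, a bound for \<open>\<integral>\<bar>F\<^sub>a\<bar>\<^sup>q d\<nu>\<close> with \<open>\<bar>a\<bar>\<close> near \<open>1\<close> is a Carleson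
condition on small disks centred on the unit circle; a covering argument extends it to all such
disks (\<open>carleson_small_to_all\<close>), and the Carleson embedding theorem applies.

The embedding (\<open>carleson_embedding\<close>) uses of the weight only that \<open>\<omega> dA\<close> is invariant under rotations
and that its tails are doubling; this is the locale \<open>radial_doubling\<close>. It follows that the
traces on the unit disk of disks centred on the unit circle have doubling mass. The weight may be
concentrated on thin annuli, so that averages with respect to it over disks about \<open>w\<close> need not
control \<open>f(w)\<close>;
instead \<open>f(w)\<close> is controlled by means over all circles \<open>\<bar>z\<bar> = s\<close> with \<open>s\<close> between
\<open>(1 + \<bar>w\<bar>) / 2\<close> and \<open>1\<close>, by Cauchy's formula applied to a branch of a power of \<open>f\<close>
(\<open>holomorphic_circle_majorization\<close>). A kernel of fast decay enters at no cost, so a large value of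
\<open>\<bar>f\<bar>\<^bsup>p/2\<^esup>\<close> at \<open>w\<close> forces a large average of it over some disk centred on the circle and containing
\<open>w\<close> (\<open>large_value_gives_heavy_ball\<close>). Vitali's covering lemma then gives a weak type estimate,
and since \<open>\<bar>f\<bar>\<^bsup>p/2\<^esup>\<close> is square integrable, truncation at half the level and integration over the
levels give the strong one, for all \<open>1 \<le> p \<le> q\<close>.\<close>

section \<open>Lebesgue measure on the disk: rotations and radii\<close>

text \<open>Carries the invariance of Lebesgue measure under orthogonal maps of the real plane over to the
  complex plane.\<close>

lemma distr_lborel_real2_complex:
  "distr (lborel :: (real^2) measure) borel (\<lambda>x. Complex (x$1) (x$2)) = lborel"
proof (rule lborel_eqI[symmetric])
  fix l u :: complex
  assume le: "\<And>b. b \<in> Basis \<Longrightarrow> l \<bullet> b \<le> u \<bullet> b"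
  have m: "(\<lambda>x::real^2. Complex (x$1) (x$2)) \<in> borel_measurable borel"
    by (intro borel_measurable_continuous_onI) (auto simp: Complex_eq intro!: continuous_intros)
  have pre: "(\<lambda>x::real^2. Complex (x$1) (x$2)) -` box l u = box (vector [Re l, Im l]) (vector [Re u, Im u])"
    by (auto simp: box_def Basis_vec_def inner_axis Basis_complex_def axis_eq_axis forall_2)
  have le': "Re l \<le> Re u" "Im l \<le> Im u"
    using le[of 1] le[of \<i>] by (auto simp: Basis_complex_def)
  have "emeasure (lborel :: (real^2) measure) (box (vector [Re l, Im l]) (vector [Re u, Im u]))
      = ennreal (\<Prod>b\<in>Basis. (vector [Re u, Im u] - vector [Re l, Im l] :: real^2) \<bullet> b)"
  proof (rule emeasure_lborel_box)
    have "vector [Re l, Im l] $ i \<le> (vector [Re u, Im u] :: real^2) $ i" for i :: 2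
      using le' exhaust_2[of i] by auto
    then show "vector [Re l, Im l] \<bullet> b \<le> (vector [Re u, Im u] :: real^2) \<bullet> b" if "b \<in> Basis" for b
      using that by (auto simp: Basis_vec_def inner_axis)
  qed
  also have "(\<Prod>b\<in>Basis. (vector [Re u, Im u] - vector [Re l, Im l] :: real^2) \<bullet> b) = (\<Prod>b\<in>Basis. (u - l) \<bullet> b)"
  proof -
    have B: "(Basis :: (real^2) set) = {axis 1 1, axis 2 1}"
      by (auto simp: Basis_vec_def exhaust_2) (metis exhaust_2)
    have "axis 1 1 \<noteq> (axis 2 1 :: real^2)" by (simp add: axis_eq_axis)
    then show ?thesis unfolding B by (simp add: inner_axis Basis_complex_def)
  qed
  finally show "emeasure (distr (lborel :: (real^2) measure) borel (\<lambda>x. Complex (x$1) (x$2))) (box l u)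
      = ennreal (\<Prod>b\<in>Basis. (u - l) \<bullet> b)"
    using m by (subst emeasure_distr) (auto simp: pre)
qed simp

lemma distr_lborel_orthogonal:
  fixes R :: "real^2 \<Rightarrow> real^2"
  assumes R: "orthogonal_transformation R"
  shows "distr lborel borel R = lborel"
proof (rule lborel_eqI[symmetric])
  fix l u :: "real^2"
  assume le: "\<And>b. b \<in> Basis \<Longrightarrow> l \<bullet> b \<le> u \<bullet> b"
  have inv: "orthogonal_transformation (inv R)" "bij R"
    using R orthogonal_transformation_inv orthogonal_transformation_bij by blast+
  have m: "R \<in> borel_measurable borel"
    by (intro borel_measurable_continuous_onI linear_continuous_on orthogonal_transformation_linear
        linear_conv_bounded_linear[THEN iffD1] R)
  have pre: "R -` box l u = inv R ` box l u"
    using inv(2) by (simp add: bij_vimage_eq_inv_image)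
  have lm: "inv R ` box l u \<in> lmeasurable"
    by (rule measurable_orthogonal_image[OF inv(1)]) simp
  have me: "measure lebesgue (inv R ` box l u) = measure lebesgue (box l u)"
    by (rule measure_orthogonal_image[OF inv(1)]) simp
  have bs: "R -` box l u \<in> sets borel" using measurable_sets[OF m, of "box l u"] by simp
  have "emeasure (distr lborel borel R) (box l u) = emeasure lborel (R -` box l u)"
    using m by (subst emeasure_distr) auto
  also have "\<dots> = emeasure lebesgue (R -` box l u)" using bs by simp
  also have "\<dots> = emeasure lebesgue (box l u)"
    using lm me unfolding pre by (simp add: emeasure_eq_measure2)
  also have "\<dots> = (\<Prod>b\<in>Basis. (u - l) \<bullet> b)" using emeasure_lborel_box[OF le] by simp
  finally show "emeasure (distr lborel borel R) (box l u) = ennreal (\<Prod>b\<in>Basis. (u - l) \<bullet> b)" .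
qed simp

lemma distr_lborel_rotation:
  "distr lborel borel (\<lambda>z. cis t * z) = (lborel :: complex measure)"
proof -
  define J where "J = (\<lambda>x::real^2. Complex (x$1) (x$2))"
  define R where "R = (\<lambda>x::real^2. vector [cos t * x$1 - sin t * x$2, sin t * x$1 + cos t * x$2] :: real^2)"
  have J: "J \<in> borel_measurable borel"
    unfolding J_def by (intro borel_measurable_continuous_onI) (auto simp: Complex_eq intro!: continuous_intros)
  have lin: "linear R"
    by (rule linearI) (auto simp: R_def vec_eq_iff forall_2 algebra_simps)
  have orth: "orthogonal_transformation R"
    unfolding orthogonal_transformation_def
  proof (intro conjI allI lin)
    fix v w :: "real^2"
    have "R v \<bullet> R w = ((cos t)^2 + (sin t)^2) * (v$1 * w$1 + v$2 * w$2)"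
      by (simp add: R_def inner_vec_def sum_2 power2_eq_square algebra_simps
          del: sin_cos_squared_add2 sin_cos_squared_add3)
    then show "R v \<bullet> R w = v \<bullet> w" by (simp add: inner_vec_def sum_2)
  qed
  have R: "R \<in> borel_measurable borel"
    by (intro borel_measurable_continuous_onI linear_continuous_on
        linear_conv_bounded_linear[THEN iffD1] lin)
  have JR: "(\<lambda>z. cis t * z) \<circ> J = J \<circ> R"
    by (auto simp: J_def R_def complex_eq_iff fun_eq_iff)
  have "distr lborel borel (\<lambda>z. cis t * z) = distr (distr lborel borel J) borel (\<lambda>z. cis t * z)"
    using distr_lborel_real2_complex by (simp add: J_def)
  also have "\<dots> = distr lborel borel ((\<lambda>z. cis t * z) \<circ> J)"
    by (subst distr_distr) (use J in \<open>auto\<close>)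
  also have "\<dots> = distr (distr lborel borel R) borel J"
    unfolding JR by (subst distr_distr) (use J R in \<open>auto\<close>)
  also have "\<dots> = lborel"
    using distr_lborel_real2_complex distr_lborel_orthogonal[OF orth] by (simp add: J_def)
  finally show ?thesis .
qed

text \<open>Finite measures on the line that agree on all rays are equal, and the annulus \<open>x < \<bar>z\<bar> < 1\<close> has area
  \<open>\<pi> - \<pi> x\<^sup>2\<close>. Together with rotation invariance this replaces integration in polar coordinates.\<close>

lemma distr_cmod_disk:
  "distr (restrict_space lborel unit_disk) borel cmod
     = density lborel (\<lambda>s. ennreal (2 * pi * s) * indicator {0..1} s)"
proof (rule measure_eqI_lessThan)
  have cm: "cmod \<in> borel_measurable (restrict_space lborel unit_disk)"
    by (rule measurable_restrict_space1) simp
  have fin: "emeasure (distr (restrict_space lborel unit_disk) borel cmod) {x<..} = 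
     (if x < 0 then ennreal pi else if x \<le> 1 then ennreal (pi - pi * x^2) else 0)" for x
  proof -
    have *: "emeasure (distr (restrict_space lborel unit_disk) borel cmod) {x<..}
        = emeasure lborel ({z. x < cmod z} \<inter> unit_disk)"
      by (subst emeasure_distr[OF cm])
         (auto simp: emeasure_restrict_space space_restrict_space intro!: arg_cong[where f="emeasure lborel"])
    have eb: "emeasure lborel (ball (0::complex) r) = ennreal (pi * r^2)" if "r \<ge> 0" for r
      using that by (subst emeasure_ball) (auto simp: unit_ball_vol_2)
    have ec: "emeasure lborel (cball (0::complex) r) = ennreal (pi * r^2)" if "r \<ge> 0" for r
      using that by (subst emeasure_cball) (auto simp: unit_ball_vol_2)
    consider "x < 0" | "x \<ge> 0" "x \<le> 1" | "x > 1" by linarith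
    then show ?thesis
    proof cases
      case 1
      then have "{z. x < cmod z} \<inter> unit_disk = unit_disk"
        by auto (meson less_le_trans norm_ge_zero)
      then show ?thesis using 1 * eb[of 1] by simp
    next
      case 2
      have "{z. x < cmod z} \<inter> unit_disk = unit_disk - cball 0 x"
        by auto
      show ?thesis
      proof (cases "x = 1")
        case True
        then have "{z. x < cmod z} \<inter> unit_disk = {}" by auto
        then show ?thesis using True * by simp
      next
        case False
        then have "x < 1" using 2 by simp
        have "emeasure lborel (unit_disk - cball (0::complex) x) = emeasure lborel unit_disk - emeasure lborel (cball (0::complex) x)"
          by (rule emeasure_Diff) (use \<open>x < 1\<close> 2 ec in auto)
        also have "\<dots> = ennreal (pi - pi * x^2)"
          using eb[of 1] ec[of x] 2 by (simp add: ennreal_minus)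
        finally show ?thesis using 2 * \<open>{z. x < cmod z} \<inter> unit_disk = unit_disk - cball 0 x\<close> by simp
      qed
    next
      case 3
      then have "{z. x < cmod z} \<inter> unit_disk = {}" by auto
      then show ?thesis using 3 * by simp
    qed
  qed
  show "emeasure (distr (restrict_space lborel unit_disk) borel cmod) {x<..} < \<infinity>" for x
    by (simp add: fin)
  show "emeasure (distr (restrict_space lborel unit_disk) borel cmod) {x<..}
      = emeasure (density lborel (\<lambda>s. ennreal (2 * pi * s) * indicator {0..1} s)) {x<..}" for x
  proof -
    have FTC: "(\<integral>\<^sup>+ s. ennreal (2 * pi * s) * indicator {a..1} s \<partial>lborel) = ennreal (pi - pi * a^2)"
      if "0 \<le> a" "a \<le> 1" for a :: real
    proof -
      have "((\<lambda>s. pi * s\<^sup>2) has_real_derivative 2 * pi * x) (at x)" for x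
        by (auto intro!: derivative_eq_intros)
      then show ?thesis
        using nn_integral_FTC_Icc[of "\<lambda>s. 2 * pi * s" a 1 "\<lambda>s. pi * s^2"] that by auto
    qed
    have "emeasure (density lborel (\<lambda>s. ennreal (2 * pi * s) * indicator {0..1} s)) {x<..}
       = (\<integral>\<^sup>+ s. ennreal (2 * pi * s) * indicator {0..1} s * indicator {x<..} s \<partial>lborel)"
      by (subst emeasure_density) auto
    also have "\<dots> = (if x < 0 then ennreal pi else if x \<le> 1 then ennreal (pi - pi * x^2) else 0)"
    proof -
      consider "x < 0" | "x \<ge> 0" "x \<le> 1" | "x > 1" by linarith
      then show ?thesis
      proof cases
        case 1
        have "(\<integral>\<^sup>+ s. ennreal (2 * pi * s) * indicator {0..1} s * indicator {x<..} s \<partial>lborel)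
           = (\<integral>\<^sup>+ s. ennreal (2 * pi * s) * indicator {0..1} s \<partial>lborel)"
          by (intro nn_integral_cong) (use 1 in \<open>auto simp: indicator_def\<close>)
        then show ?thesis using FTC[of 0] 1 by simp
      next
        case 2
        have "AE s in lborel. s \<noteq> x" by (rule AE_lborel_singleton)
        then have "(\<integral>\<^sup>+ s. ennreal (2 * pi * s) * indicator {0..1} s * indicator {x<..} s \<partial>lborel)
           = (\<integral>\<^sup>+ s. ennreal (2 * pi * s) * indicator {x..1} s \<partial>lborel)"
          by (intro nn_integral_cong_AE) (use 2 in \<open>auto simp: indicator_def elim!: eventually_mono\<close>)
        then show ?thesis using FTC[of x] 2 by simp
      next
        case 3
        have "(\<integral>\<^sup>+ s. ennreal (2 * pi * s) * indicator {0..1} s * indicator {x<..} s \<partial>lborel)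
           = (\<integral>\<^sup>+ s. 0 \<partial>(lborel::real measure))"
          by (intro nn_integral_cong) (use 3 in \<open>auto simp: indicator_def\<close>)
        then show ?thesis using 3 by simp
      qed
    qed
    finally show ?thesis by (simp add: fin)
  qed
qed auto

section \<open>Majorization of powers by means over circles\<close>

text \<open>Cauchy's formula, with the denominator estimated by \<open>s - \<bar>w\<bar>\<close>: this loses only a constant
  when \<open>s - \<bar>w\<bar>\<close> is comparable to \<open>1 - \<bar>w\<bar>\<close>, as it will be. The circle is
  run through from an arbitrary starting point \<open>z\<close>, so that the bound can later be integrated in \<open>z\<close>.\<close>

lemma cauchy_circle_bound:
  fixes G :: "complex \<Rightarrow> complex"
  assumes cont: "continuous_on (cball 0 s) G" and holo: "G holomorphic_on ball 0 s"
    and w: "cmod w < s" and z: "cmod z = s"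
  shows "ennreal (cmod (G w)) \<le> ennreal (s / (s - cmod w)) *
     (\<integral>\<^sup>+ t. ennreal (cmod (G (z * cis (2 * pi * t)))) * indicator {0..1} t \<partial>lborel)"
proof -
  have s: "s > 0" using w norm_ge_zero[of w] by linarith
  define e where "e = z / of_real s"
  have e: "cmod e = 1" "e \<noteq> 0" and ze: "z = of_real s * e"
    using s z by (auto simp: e_def norm_divide)
  define H where "H = (\<lambda>\<xi>. G (e * \<xi>))"
  define w' where "w' = w / e"
  have w': "cmod w' = cmod w" using e by (simp add: w'_def norm_divide)
  have Hw: "H w' = G w" using e by (simp add: H_def w'_def)
  have contH: "continuous_on (cball 0 s) H"
    unfolding H_def
    by (rule continuous_on_compose2[OF cont]) (auto intro!: continuous_intros simp: norm_mult e)
  have holoH: "H holomorphic_on ball 0 s"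
    unfolding H_def
    by (rule holomorphic_on_compose_gen[OF _ holo, unfolded o_def]) (auto intro!: holomorphic_intros simp: norm_mult e)
  have hci: "((\<lambda>u. H u / (u - w')) has_contour_integral (2 * of_real pi * \<i> * H w')) (circlepath 0 s)"
    by (rule Cauchy_integral_circlepath[OF contH holoH]) (simp add: w' w)
  define F where "F = (\<lambda>t::real. H (circlepath 0 s t) / (circlepath 0 s t - w') * (2 * pi * \<i> * s * exp (2 * of_real pi * \<i> * t)))"
  have F: "(F has_integral (2 * of_real pi * \<i> * G w)) {0..1}"
    using hci unfolding has_contour_integral_def Hw
    by (rule has_integral_cong[THEN iffD1, rotated]) (simp add: F_def vector_derivative_circlepath01)
  define g where "g = (\<lambda>t::real. cmod (G (z * cis (2 * pi * t))))"
  have cp: "circlepath 0 s t = of_real s * cis (2 * pi * t)" for t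
    by (simp add: circlepath cis_conv_exp mult_ac)
  have contg: "continuous_on UNIV g"
    unfolding g_def
    by (intro continuous_intros continuous_on_compose2[OF cont]) (auto simp: norm_mult z)
  have gI: "g integrable_on {0..1}"
    by (intro integrable_continuous_real continuous_on_subset[OF contg]) auto
  define c where "c = s / (s - cmod w)"
  have c: "c > 0" using s w by (simp add: c_def)
  have bound: "cmod (F t) \<le> 2 * pi * c * g t" if "t \<in> {0..1}" for t
  proof -
    have "cmod (F t) = g t / cmod (of_real s * cis (2 * pi * t) - w') * (2 * pi * s)"
      using s by (simp add: F_def cp H_def g_def ze norm_mult norm_divide mult_ac)
    also have "\<dots> \<le> g t / (s - cmod w) * (2 * pi * s)"
    proof -
      have "s - cmod w \<le> cmod (of_real s * cis (2 * pi * t) - w')"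
        using norm_triangle_ineq2[of "of_real s * cis (2 * pi * t)" w'] s w' by (simp add: norm_mult)
      then show ?thesis using s w by (intro mult_right_mono divide_left_mono mult_pos_pos) (auto simp: g_def)
    qed
    finally show ?thesis by (simp add: c_def mult_ac)
  qed
  have "2 * pi * cmod (G w) = cmod (integral {0..1} F)"
    using integral_unique[OF F] by (simp add: norm_mult)
  also have "\<dots> \<le> integral {0..1} (\<lambda>t. 2 * pi * c * g t)"
    by (rule integral_norm_bound_integral)
       (use F gI bound in \<open>auto intro: has_integral_integrable integrable_on_mult_right\<close>)
  also have "\<dots> = 2 * pi * (c * integral {0..1} g)" by simp
  finally have le: "cmod (G w) \<le> c * integral {0..1} g" by simp
  have "g \<in> borel_measurable borel" using contg by (rule borel_measurable_continuous_onI)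
  moreover have "((\<lambda>t. indicator {0..1} t * g t) has_integral integral {0..1} g) UNIV"
  proof -
    have "(\<lambda>t. indicator {0..1} t * g t) = (\<lambda>t. if t \<in> {0..1} then g t else 0)"
      by (auto simp: indicator_def)
    then show ?thesis using integrable_integral[OF gI] by (simp only: has_integral_restrict_UNIV)
  qed
  moreover have "0 \<le> g t" for t by (simp add: g_def)
  ultimately have "(\<integral>\<^sup>+ t. ennreal (indicator {0..1} t * g t) \<partial>lborel) = ennreal (integral {0..1} g)"
    by (intro nn_integral_has_integral_lborel) auto
  moreover have "(\<integral>\<^sup>+ t. ennreal (g t) * indicator {0..1} t \<partial>lborel) = (\<integral>\<^sup>+ t. ennreal (indicator {0..1} t * g t) \<partial>lborel)"
    by (intro nn_integral_cong) (auto simp: indicator_def)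
  ultimately have "(\<integral>\<^sup>+ t. ennreal (g t) * indicator {0..1} t \<partial>lborel) = ennreal (integral {0..1} g)" by simp
  then show ?thesis using ennreal_leI[OF le] c
    unfolding c_def[symmetric] g_def by (simp add: ennreal_mult')
qed

text \<open>The principal branch is continuous on the closed right half-plane even at \<open>0\<close>, since \<open>\<alpha> > 0\<close>; this
  admits factors that vanish on the circle.\<close>

lemma continuous_on_powr_right_half_plane:
  assumes "0 < \<alpha>" "\<And>x. x \<in> A \<Longrightarrow> 0 \<le> Re (g x)" "continuous_on A g"
  shows "continuous_on A (\<lambda>x. g x powr of_real \<alpha> :: complex)"
proof -
  have *: "continuous_on {z. 0 \<le> Re z} (\<lambda>z. z powr of_real \<alpha> :: complex)"
    unfolding continuous_on_eq_continuous_within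
  proof safe
    fix z :: complex assume z: "0 \<le> Re z"
    show "continuous (at z within {z. 0 \<le> Re z}) (\<lambda>z. z powr of_real \<alpha>)"
    proof (cases "z = 0")
      case True
      have "((\<lambda>z. cmod z powr \<alpha>) \<longlongrightarrow> 0) (at 0 within {z. 0 \<le> Re z})"
        using assms(1) by (intro tendsto_zero_powrI[OF tendsto_norm_zero[OF tendsto_ident_at] tendsto_const]) auto
      then have "((\<lambda>z. z powr of_real \<alpha>) \<longlongrightarrow> 0) (at 0 within {z. 0 \<le> Re z})"
        by (subst tendsto_norm_zero_iff[symmetric]) (simp add: norm_powr_real_powr')
      then show ?thesis using True by (simp add: continuous_within)
    next
      case False
      then have "z \<notin> \<real>\<^sub>\<le>\<^sub>0" using z by (auto simp: complex_nonpos_Reals_iff complex_eq_iff)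
      then have "(\<lambda>z. z powr of_real \<alpha>) field_differentiable at z"
        using has_field_derivative_powr field_differentiable_def by blast
      then show ?thesis
        using field_differentiable_imp_continuous_at continuous_at_imp_continuous_at_within by blast
    qed
  qed
  show ?thesis
    by (rule continuous_on_compose2[OF * assms(3)]) (use assms(2) in auto)
qed

text \<open>A zero outside the open disk is kept: the factor, normalized to \<open>1 - \<xi> / a\<close>, takes values in the
  right half-plane. A zero inside is reflected in the circle, which keeps the modulus on the circle, increases
  it inside, and leads to the right half-plane again. In both cases the principal power is holomorphic.\<close>

lemma linear_factor_majorant:
  fixes a :: complex
  assumes "0 < \<alpha>" "0 < s"
  shows "\<exists>G. continuous_on (cball 0 s) G \<and> G holomorphic_on ball 0 s \<and>
     (\<forall>\<xi>\<in>cball 0 s. cmod (\<xi> - a) powr \<alpha> \<le> cmod (G \<xi>)) \<and>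
     (\<forall>\<xi>\<in>sphere 0 s. cmod (\<xi> - a) powr \<alpha> = cmod (G \<xi>))"
proof (cases "cmod a \<ge> s")
  case True
  then have a: "a \<noteq> 0" using assms by auto
  have le: "Re (\<xi> / a) \<le> cmod \<xi> / cmod a" for \<xi> using complex_Re_le_cmod[of "\<xi> / a"] by (simp add: norm_divide)
  have pos: "0 \<le> Re (1 - \<xi> / a)" if "cmod \<xi> \<le> s" for \<xi>
  proof -
    have "cmod \<xi> / cmod a \<le> 1" using that True a by (simp add: divide_simps)
    then show ?thesis using le[of \<xi>] by simp
  qed
  have pos': "0 < Re (1 - \<xi> / a)" if "cmod \<xi> < s" for \<xi>
  proof -
    have "cmod \<xi> / cmod a < 1" using that True a by (simp add: divide_simps)
    then show ?thesis using le[of \<xi>] by simp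
  qed
  define G where "G = (\<lambda>\<xi>. of_real (cmod a powr \<alpha>) * (1 - \<xi> / a) powr of_real \<alpha>)"
  have "cmod (G \<xi>) = cmod (\<xi> - a) powr \<alpha>" for \<xi>
  proof -
    have "cmod (G \<xi>) = (cmod a * cmod (1 - \<xi> / a)) powr \<alpha>"
      by (simp add: G_def norm_mult norm_powr_real_powr' powr_mult)
    also have "cmod a * cmod (1 - \<xi> / a) = cmod (\<xi> - a)"
      using a by (simp add: norm_mult[symmetric] right_diff_distrib norm_minus_commute)
    finally show ?thesis .
  qed
  moreover have "continuous_on (cball 0 s) G"
    unfolding G_def
    by (intro continuous_on_mult continuous_on_const continuous_on_powr_right_half_plane assms(1))
       (use pos a in \<open>auto intro!: continuous_intros\<close>)
  moreover have "G holomorphic_on ball 0 s"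
    unfolding G_def
    by (intro holomorphic_intros) (use pos' a in \<open>auto simp: complex_nonpos_Reals_iff, force\<close>)
  ultimately show ?thesis by (intro exI[of _ G]) auto
next
  case False
  then have as: "cmod a < s" by simp
  have pos: "0 < Re (of_real s - cnj a * \<xi> / of_real s)" if "cmod \<xi> \<le> s" for \<xi>
  proof -
    have "Re (cnj a * \<xi> / of_real s) \<le> cmod (cnj a * \<xi> / of_real s)" by (rule complex_Re_le_cmod)
    also have "\<dots> = cmod a * (cmod \<xi> / s)" using assms by (simp add: norm_mult norm_divide)
    also have "\<dots> \<le> cmod a * 1" using that assms by (intro mult_left_mono) auto
    finally show ?thesis using as by simp
  qed
  define G where "G = (\<lambda>\<xi>. (of_real s - cnj a * \<xi> / of_real s) powr of_real \<alpha> :: complex)"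
  have sq: "(cmod (of_real s - cnj a * \<xi> / of_real s))\<^sup>2 = (cmod (\<xi> - a))\<^sup>2 + (s\<^sup>2 - (cmod \<xi>)\<^sup>2) * (s\<^sup>2 - (cmod a)\<^sup>2) / s\<^sup>2" for \<xi>
  proof -
    have diff: "(cmod (x - y))\<^sup>2 = (cmod x)\<^sup>2 + (cmod y)\<^sup>2 - 2 * (x \<bullet> y)" for x y :: complex
      unfolding power2_norm_eq_inner by (simp add: inner_diff inner_commute)
    have "of_real s \<bullet> (cnj a * \<xi> / of_real s) = \<xi> \<bullet> a"
      using assms(2) by (simp add: inner_complex_def algebra_simps add_divide_distrib)
    moreover have "(cmod (cnj a * \<xi> / of_real s))\<^sup>2 = (cmod a)\<^sup>2 * (cmod \<xi>)\<^sup>2 / s\<^sup>2"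
      using assms(2) by (simp add: norm_mult norm_divide power_mult_distrib power_divide)
    moreover have "(s\<^sup>2 - (cmod \<xi>)\<^sup>2) * (s\<^sup>2 - (cmod a)\<^sup>2) / s\<^sup>2
        = s\<^sup>2 - (cmod \<xi>)\<^sup>2 - (cmod a)\<^sup>2 + (cmod a)\<^sup>2 * (cmod \<xi>)\<^sup>2 / s\<^sup>2"
    proof -
      have "s\<^sup>2 \<noteq> 0" using assms(2) by simp
      then show ?thesis by (simp add: divide_simps) (simp add: algebra_simps)
    qed
    ultimately show ?thesis using assms(2) unfolding diff by simp
  qed
  have ge: "cmod (\<xi> - a) \<le> cmod (of_real s - cnj a * \<xi> / of_real s)" if "cmod \<xi> \<le> s" for \<xi>
  proof (rule power2_le_imp_le)
    have "0 \<le> (s\<^sup>2 - (cmod \<xi>)\<^sup>2) * (s\<^sup>2 - (cmod a)\<^sup>2) / s\<^sup>2"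
      using that as by (intro divide_nonneg_nonneg mult_nonneg_nonneg) (auto intro!: power_mono)
    then show "(cmod (\<xi> - a))\<^sup>2 \<le> (cmod (of_real s - cnj a * \<xi> / of_real s))\<^sup>2" using sq[of \<xi>] by linarith
  qed simp
  have eq: "cmod (\<xi> - a) = cmod (of_real s - cnj a * \<xi> / of_real s)" if "cmod \<xi> = s" for \<xi>
    by (rule power2_eq_imp_eq) (use sq[of \<xi>] that in auto)
  have nG: "cmod (G \<xi>) = cmod (of_real s - cnj a * \<xi> / of_real s) powr \<alpha>" for \<xi>
    by (simp add: G_def norm_powr_real_powr')
  have "continuous_on (cball 0 s) G"
    unfolding G_def
  proof (rule continuous_on_powr_right_half_plane[OF assms(1)])
    show "0 \<le> Re (of_real s - cnj a * \<xi> / of_real s)" if "\<xi> \<in> cball 0 s" for \<xi>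
      using pos[of \<xi>] that by simp
    show "continuous_on (cball 0 s) (\<lambda>\<xi>. of_real s - cnj a * \<xi> / of_real s)"
      using assms(2) by (intro continuous_intros) simp
  qed
  moreover have "G holomorphic_on ball 0 s"
    unfolding G_def
  proof (intro holomorphic_intros)
    fix \<xi> :: complex assume "\<xi> \<in> ball 0 s"
    then show "of_real s - cnj a * \<xi> / of_real s \<notin> \<real>\<^sub>\<le>\<^sub>0"
      using pos[of \<xi>] unfolding complex_nonpos_Reals_iff by (metis dist_0_norm less_imp_le mem_ball not_le)
    show "of_real s \<noteq> (0::complex)" using assms(2) by simp
  qed
  moreover have "\<forall>\<xi>\<in>cball 0 s. cmod (\<xi> - a) powr \<alpha> \<le> cmod (G \<xi>)"
    unfolding nG using ge assms(1) by (intro ballI powr_mono2) auto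
  moreover have "\<forall>\<xi>\<in>sphere 0 s. cmod (\<xi> - a) powr \<alpha> = cmod (G \<xi>)"
    unfolding nG using eq by (metis dist_0_norm mem_sphere)
  ultimately show ?thesis by blast
qed

text \<open>Stands in for the subharmonicity of \<open>\<bar>P\<bar>\<^sup>\<alpha>\<close>: the outer part of \<open>P\<close> has a holomorphic \<open>\<alpha>\<close>-th power.
  Exponents \<open>\<alpha> < 1\<close>, which occur below when \<open>p < 2\<close>, are out of reach of Cauchy's formula for \<open>P\<close> itself.\<close>

lemma poly_majorant:
  fixes P :: "complex poly"
  assumes "0 < \<alpha>" "0 < s"
  shows "\<exists>G. continuous_on (cball 0 s) G \<and> G holomorphic_on ball 0 s \<and>
     (\<forall>\<xi>\<in>cball 0 s. cmod (poly P \<xi>) powr \<alpha> \<le> cmod (G \<xi>)) \<and>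
     (\<forall>\<xi>\<in>sphere 0 s. cmod (poly P \<xi>) powr \<alpha> = cmod (G \<xi>))"
proof (cases "P = 0")
  case True
  then show ?thesis by (intro exI[of _ "\<lambda>_. 0"]) auto
next
  case False
  have prod: "\<exists>G. continuous_on (cball 0 s) G \<and> G holomorphic_on ball 0 s \<and>
     (\<forall>\<xi>\<in>cball 0 s. cmod (poly (\<Prod>x\<in>#A. [:-x, 1:]) \<xi>) powr \<alpha> \<le> cmod (G \<xi>)) \<and>
     (\<forall>\<xi>\<in>sphere 0 s. cmod (poly (\<Prod>x\<in>#A. [:-x, 1:]) \<xi>) powr \<alpha> = cmod (G \<xi>))" for A :: "complex multiset"
  proof (induction A)
    case empty
    show ?case by (intro exI[of _ "\<lambda>_. 1"]) auto
  next
    case (add a A)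
    then obtain G where G: "continuous_on (cball 0 s) G" "G holomorphic_on ball 0 s"
     "\<And>\<xi>. \<xi>\<in>cball 0 s \<Longrightarrow> cmod (poly (\<Prod>x\<in>#A. [:-x, 1:]) \<xi>) powr \<alpha> \<le> cmod (G \<xi>)"
     "\<And>\<xi>. \<xi>\<in>sphere 0 s \<Longrightarrow> cmod (poly (\<Prod>x\<in>#A. [:-x, 1:]) \<xi>) powr \<alpha> = cmod (G \<xi>)" by blast
    obtain G' where G': "continuous_on (cball 0 s) G'" "G' holomorphic_on ball 0 s"
     "\<And>\<xi>. \<xi>\<in>cball 0 s \<Longrightarrow> cmod (\<xi> - a) powr \<alpha> \<le> cmod (G' \<xi>)"
     "\<And>\<xi>. \<xi>\<in>sphere 0 s \<Longrightarrow> cmod (\<xi> - a) powr \<alpha> = cmod (G' \<xi>)"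
      using linear_factor_majorant[OF assms] by blast
    have ev: "cmod (poly (\<Prod>x\<in>#add_mset a A. [:-x, 1:]) \<xi>) powr \<alpha>
        = cmod (\<xi> - a) powr \<alpha> * cmod (poly (\<Prod>x\<in>#A. [:-x, 1:]) \<xi>) powr \<alpha>" for \<xi>
    proof -
      have "poly (\<Prod>x\<in>#add_mset a A. [:-x, 1:]) \<xi> = (\<xi> - a) * poly (\<Prod>x\<in>#A. [:-x, 1:]) \<xi>"
        by (simp add: algebra_simps)
      then show ?thesis by (simp only: norm_mult powr_mult norm_ge_zero)
    qed
    show ?case
    proof (intro exI[of _ "\<lambda>\<xi>. G' \<xi> * G \<xi>"] conjI ballI)
      show "continuous_on (cball 0 s) (\<lambda>\<xi>. G' \<xi> * G \<xi>)" "(\<lambda>\<xi>. G' \<xi> * G \<xi>) holomorphic_on ball 0 s"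
        using G G' by (auto intro!: continuous_intros holomorphic_intros)
    next
      fix \<xi> :: complex assume "\<xi> \<in> cball 0 s"
      then show "cmod (poly (\<Prod>x\<in>#add_mset a A. [:-x, 1:]) \<xi>) powr \<alpha> \<le> cmod (G' \<xi> * G \<xi>)"
        unfolding ev norm_mult by (intro mult_mono G(3) G'(3)) auto
    next
      fix \<xi> :: complex assume "\<xi> \<in> sphere 0 s"
      then show "cmod (poly (\<Prod>x\<in>#add_mset a A. [:-x, 1:]) \<xi>) powr \<alpha> = cmod (G' \<xi> * G \<xi>)"
        unfolding ev norm_mult by (simp only: G(4) G'(4))
    qed
  qed
  obtain A where A: "P = smult (lead_coeff P) (\<Prod>x\<in>#A. [:-x, 1:])"
    using alg_closed_imp_factorization[OF False] by blast
  from prod[of A] obtain G where G: "continuous_on (cball 0 s) G" "G holomorphic_on ball 0 s"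
     "\<And>\<xi>. \<xi>\<in>cball 0 s \<Longrightarrow> cmod (poly (\<Prod>x\<in>#A. [:-x, 1:]) \<xi>) powr \<alpha> \<le> cmod (G \<xi>)"
     "\<And>\<xi>. \<xi>\<in>sphere 0 s \<Longrightarrow> cmod (poly (\<Prod>x\<in>#A. [:-x, 1:]) \<xi>) powr \<alpha> = cmod (G \<xi>)" by blast
  have ev: "cmod (poly P \<xi>) powr \<alpha> = cmod (lead_coeff P) powr \<alpha> * cmod (poly (\<Prod>x\<in>#A. [:-x, 1:]) \<xi>) powr \<alpha>" for \<xi>
    by (subst A) (simp add: norm_mult powr_mult)
  show ?thesis
    by (intro exI[of _ "\<lambda>\<xi>. of_real (cmod (lead_coeff P) powr \<alpha>) * G \<xi>"])
       (use G in \<open>auto simp: ev norm_mult intro!: continuous_intros holomorphic_intros mult_left_mono\<close>)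
qed

text \<open>The function \<open>\<xi> \<mapsto> (1 - \<bar>w\<bar>\<^sup>2) / (1 - cnj w \<xi>)\<close> is holomorphic with value \<open>1\<close> at \<open>w\<close>, so its powers may be
  multiplied to the majorant without changing the left-hand side; they make the right-hand side decay away from
  \<open>w\<close> at any prescribed rate.\<close>

lemma poly_circle_majorization:
  fixes P :: "complex poly"
  assumes "0 < \<alpha>" and z: "cmod z < 1" and w: "cmod w < cmod z"
  shows "ennreal (cmod (poly P w) powr \<alpha>) \<le> ennreal (cmod z / (cmod z - cmod w)) *
     (\<integral>\<^sup>+ t. ennreal (cmod (poly P (z * cis (2 * pi * t))) powr \<alpha> *
        ((1 - (cmod w)\<^sup>2) / cmod (1 - cnj w * (z * cis (2 * pi * t)))) ^ N) * indicator {0..1} t \<partial>lborel)"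
proof -
  have s: "0 < cmod z" using w by (meson le_less_trans norm_ge_zero)
  obtain G where G: "continuous_on (cball 0 (cmod z)) G" "G holomorphic_on ball 0 (cmod z)"
     "\<And>\<xi>. \<xi>\<in>cball 0 (cmod z) \<Longrightarrow> cmod (poly P \<xi>) powr \<alpha> \<le> cmod (G \<xi>)"
     "\<And>\<xi>. \<xi>\<in>sphere 0 (cmod z) \<Longrightarrow> cmod (poly P \<xi>) powr \<alpha> = cmod (G \<xi>)"
    using poly_majorant[OF assms(1) s] by blast
  have w1: "cmod w < 1" using w z by simp
  have nz: "1 - cnj w * \<xi> \<noteq> 0" if "cmod \<xi> \<le> cmod z" for \<xi>
  proof
    assume "1 - cnj w * \<xi> = 0"
    then have "cmod (cnj w * \<xi>) = 1" by (metis eq_iff_diff_eq_0 norm_one)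
    moreover have "cmod (cnj w * \<xi>) \<le> cmod w * 1" unfolding norm_mult
      by (intro mult_mono) (use that z in auto)
    ultimately show False using w1 by simp
  qed
  define k where "k = (\<lambda>\<xi>. of_real (1 - (cmod w)\<^sup>2) / (1 - cnj w * \<xi>))"
  have kw: "k w = 1"
  proof -
    have "cnj w * w = of_real ((cmod w)\<^sup>2)" by (metis complex_norm_square mult.commute of_real_power)
    then show ?thesis using nz[of w] w unfolding k_def by simp
  qed
  have nk: "cmod (k \<xi>) = (1 - (cmod w)\<^sup>2) / cmod (1 - cnj w * \<xi>)" for \<xi>
  proof -
    have "(cmod w)\<^sup>2 \<le> 1" using w1 by (simp add: abs_square_le_1)
    then show ?thesis unfolding k_def norm_divide norm_of_real by simp
  qed
  have le: "ennreal (cmod (G w * k w ^ N)) \<le> ennreal (cmod z / (cmod z - cmod w)) *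
     (\<integral>\<^sup>+ t. ennreal (cmod (G (z * cis (2 * pi * t)) * k (z * cis (2 * pi * t)) ^ N)) * indicator {0..1} t \<partial>lborel)"
    by (rule cauchy_circle_bound[OF _ _ w refl])
       (use G nz in \<open>auto simp: k_def intro!: continuous_intros holomorphic_intros\<close>)
  have eq: "cmod (G (z * cis (2 * pi * t)) * k (z * cis (2 * pi * t)) ^ N) =
     cmod (poly P (z * cis (2 * pi * t))) powr \<alpha> *
        ((1 - (cmod w)\<^sup>2) / cmod (1 - cnj w * (z * cis (2 * pi * t)))) ^ N" for t
    by (subst G(4)) (auto simp: norm_mult norm_power nk)
  have "ennreal (cmod (G w)) \<le> ennreal (cmod z / (cmod z - cmod w)) *
     (\<integral>\<^sup>+ t. ennreal (cmod (poly P (z * cis (2 * pi * t))) powr \<alpha> *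
        ((1 - (cmod w)\<^sup>2) / cmod (1 - cnj w * (z * cis (2 * pi * t)))) ^ N) * indicator {0..1} t \<partial>lborel)"
    using le unfolding eq kw by simp
  moreover have "ennreal (cmod (poly P w) powr \<alpha>) \<le> ennreal (cmod (G w))"
    using G(3)[of w] w by (intro ennreal_leI) auto
  ultimately show ?thesis by (rule order_trans[rotated])
qed

lemma holomorphic_circle_majorization:
  fixes f :: "complex \<Rightarrow> complex"
  assumes f: "f holomorphic_on unit_disk" and \<alpha>: "0 < \<alpha>" and z: "cmod z < 1" and w: "cmod w < cmod z"
  shows "ennreal (cmod (f w) powr \<alpha>) \<le> ennreal (cmod z / (cmod z - cmod w)) *
     (\<integral>\<^sup>+ t. ennreal (cmod (f (z * cis (2 * pi * t))) powr \<alpha> *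
        ((1 - (cmod w)\<^sup>2) / cmod (1 - cnj w * (z * cis (2 * pi * t)))) ^ N) * indicator {0..1} t \<partial>lborel)"
proof -
  define c where "c = (\<lambda>k. (deriv ^^ k) f 0 / fact k)"
  define P where "P = (\<lambda>n. \<Sum>k<n. monom (c k) k)"
  have Pe: "poly (P n) \<xi> = (\<Sum>k<n. c k * \<xi> ^ k)" for n \<xi>
    by (simp add: P_def poly_sum poly_monom)
  have sums: "(\<lambda>k. c k * \<xi> ^ k) sums f \<xi>" if "cmod \<xi> < 1" for \<xi>
    using holomorphic_power_series[OF f, of \<xi>] that by (simp add: c_def)
  have lim: "(\<lambda>n. poly (P n) \<xi>) \<longlonglongrightarrow> f \<xi>" if "cmod \<xi> < 1" for \<xi>
    using sums[OF that] unfolding sums_def Pe .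
  have summ: "summable (\<lambda>k. cmod (c k) * cmod z ^ k)"
  proof -
    define r where "r = (1 + cmod z) / 2"
    have "0 \<le> cmod z" by simp
    then have r: "cmod z < r" "r < 1" "0 < r" using z unfolding r_def by (simp_all add: add_pos_nonneg)
    have "cmod (of_real r) < 1" using r by simp
    from sums[OF this] have "summable (\<lambda>k. c k * of_real r ^ k)" by (rule sums_summable)
    moreover have "norm z < norm (of_real r :: complex)" using r by simp
    ultimately have "summable (\<lambda>k. norm (c k * z ^ k))" by (rule powser_insidea)
    then show ?thesis by (simp add: norm_mult norm_power)
  qed
  define B where "B = (\<Sum>k. cmod (c k) * cmod z ^ k)"
  have B: "cmod (poly (P n) \<xi>) \<le> B" if "cmod \<xi> = cmod z" for n \<xi>
  proof -
    have "cmod (poly (P n) \<xi>) \<le> (\<Sum>k<n. cmod (c k * \<xi> ^ k))" unfolding Pe by (rule norm_sum)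
    also have "\<dots> = (\<Sum>k<n. cmod (c k) * cmod z ^ k)" by (simp add: norm_mult norm_power that)
    also have "\<dots> \<le> B" unfolding B_def by (rule sum_le_suminf[OF summ]) auto
    finally show ?thesis .
  qed
  have w1: "cmod w < 1" using w z by simp
  define K where "K = (\<lambda>t. ((1 - (cmod w)\<^sup>2) / cmod (1 - cnj w * (z * cis (2 * pi * t)))) ^ N)"
  have den: "1 - cmod w \<le> cmod (1 - cnj w * (z * cis (2 * pi * t)))" for t
  proof -
    have "cmod (cnj w * (z * cis (2 * pi * t))) \<le> cmod w * 1"
      unfolding norm_mult by (intro mult_mono) (use z in auto)
    then show ?thesis using norm_triangle_ineq2[of 1 "cnj w * (z * cis (2 * pi * t))"] by simp
  qed
  have num: "0 \<le> 1 - (cmod w)\<^sup>2" using w1 by (simp add: abs_square_le_1)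
  have K0: "0 \<le> K t" for t unfolding K_def using num by simp
  have KB: "K t \<le> ((1 - (cmod w)\<^sup>2) / (1 - cmod w)) ^ N" for t
    unfolding K_def by (intro power_mono divide_left_mono den num) (use num w1 den[of t] in \<open>auto intro!: mult_pos_pos\<close>)
  have K_meas: "K \<in> borel_measurable borel"
  proof -
    have "continuous_on UNIV K" unfolding K_def
    proof (intro continuous_intros)
      show "\<forall>t\<in>UNIV. cmod (1 - cnj w * (z * cis (2 * pi * t))) \<noteq> 0"
        using den w1 by (metis diff_gt_0_iff_gt less_le_not_le)
    qed
    then show ?thesis by (rule borel_measurable_continuous_onI)
  qed
  define C where "C = B powr \<alpha> * ((1 - (cmod w)\<^sup>2) / (1 - cmod w)) ^ N"
  have fz_meas: "(\<lambda>t. f (z * cis (2 * pi * t))) \<in> borel_measurable borel"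
  proof (intro borel_measurable_continuous_onI continuous_on_compose2[OF holomorphic_on_imp_continuous_on[OF f]])
  qed (use z in \<open>auto intro!: continuous_intros simp: norm_mult\<close>)
  have lim_int: "(\<lambda>n. \<integral>\<^sup>+ t. ennreal (cmod (poly (P n) (z * cis (2 * pi * t))) powr \<alpha> * K t) * indicator {0..1} t \<partial>lborel)
     \<longlonglongrightarrow> (\<integral>\<^sup>+ t. ennreal (cmod (f (z * cis (2 * pi * t))) powr \<alpha> * K t) * indicator {0..1} t \<partial>lborel)"
  proof (rule nn_integral_dominated_convergence[where w = "\<lambda>t. ennreal C * indicator {0..1} t"])
    show "(\<lambda>t. ennreal (cmod (poly (P n) (z * cis (2 * pi * t))) powr \<alpha> * K t) * indicator {0..1} t) \<in> borel_measurable lborel" for n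
    proof -
      have [measurable]: "(\<lambda>t. poly (P n) (z * cis (2 * pi * t))) \<in> borel_measurable borel"
        by (intro borel_measurable_continuous_onI continuous_intros)
      show ?thesis using K_meas by measurable
    qed
    show "(\<lambda>t. ennreal (cmod (f (z * cis (2 * pi * t))) powr \<alpha> * K t) * indicator {0..1} t) \<in> borel_measurable lborel"
      using K_meas fz_meas by measurable
    show "(\<lambda>t::real. ennreal C * indicator {0..1} t) \<in> borel_measurable lborel" by simp
    show "(\<integral>\<^sup>+ t. ennreal C * indicator {0..1} (t::real) \<partial>lborel) < \<infinity>"
      by (simp add: nn_integral_cmult_indicator ennreal_mult_less_top)
    show "AE t in lborel. ennreal (cmod (poly (P n) (z * cis (2 * pi * t))) powr \<alpha> * K t) * indicator {0..1} t \<le> ennreal C * indicator {0..1} t" for n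
      by (intro AE_I2 mult_right_mono ennreal_leI) (use K0 KB B \<alpha> in \<open>auto simp: C_def norm_mult intro!: mult_mono powr_mono2\<close>)
    show "AE t in lborel. (\<lambda>n. ennreal (cmod (poly (P n) (z * cis (2 * pi * t))) powr \<alpha> * K t) * indicator {0..1} t)
        \<longlonglongrightarrow> ennreal (cmod (f (z * cis (2 * pi * t))) powr \<alpha> * K t) * indicator {0..1} t"
    proof (intro AE_I2)
      fix t :: real
      have "(\<lambda>n. cmod (poly (P n) (z * cis (2 * pi * t))) powr \<alpha> * K t) \<longlonglongrightarrow> cmod (f (z * cis (2 * pi * t))) powr \<alpha> * K t"
        using \<alpha> by (intro tendsto_intros tendsto_powr2 lim) (auto simp: norm_mult z)
      then show "(\<lambda>n. ennreal (cmod (poly (P n) (z * cis (2 * pi * t))) powr \<alpha> * K t) * indicator {0..1} t)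
        \<longlonglongrightarrow> ennreal (cmod (f (z * cis (2 * pi * t))) powr \<alpha> * K t) * indicator {0..1} t"
        by (cases "t \<in> {0..1}") (auto intro!: tendsto_ennrealI)
    qed
  qed
  have "(\<lambda>n. ennreal (cmod (poly (P n) w) powr \<alpha>)) \<longlonglongrightarrow> ennreal (cmod (f w) powr \<alpha>)"
    using \<alpha> w1 by (intro tendsto_ennrealI tendsto_powr2 tendsto_intros lim) auto
  moreover have "(\<lambda>n. ennreal (cmod z / (cmod z - cmod w)) * (\<integral>\<^sup>+ t. ennreal (cmod (poly (P n) (z * cis (2 * pi * t))) powr \<alpha> * K t) * indicator {0..1} t \<partial>lborel))
     \<longlonglongrightarrow> ennreal (cmod z / (cmod z - cmod w)) * (\<integral>\<^sup>+ t. ennreal (cmod (f (z * cis (2 * pi * t))) powr \<alpha> * K t) * indicator {0..1} t \<partial>lborel)"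
    by (rule ennreal_tendsto_cmult[OF _ lim_int]) simp
  ultimately have "ennreal (cmod (f w) powr \<alpha>) \<le> ennreal (cmod z / (cmod z - cmod w)) * (\<integral>\<^sup>+ t. ennreal (cmod (f (z * cis (2 * pi * t))) powr \<alpha> * K t) * indicator {0..1} t \<partial>lborel)"
    by (rule LIMSEQ_le) (use poly_circle_majorization[OF \<alpha> z w] in \<open>auto simp: K_def\<close>)
  then show ?thesis by (simp add: K_def)
qed

section \<open>Rotation invariant measures with doubling tails\<close>

abbreviation disk_borel :: "complex measure" where
  "disk_borel \<equiv> restrict_space borel unit_disk"

text \<open>From \<open>\<bar>1 - s e\<^sup>i\<^sup>x\<bar>\<^sup>2 = (1 - s)\<^sup>2 + 2 s (1 - cos x)\<close> and \<open>1 - cos x = 2 sin\<^sup>2 (x / 2)\<close>, where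
  \<open>sin y \<ge> y - y\<^sup>3 / 6 \<ge> y / 4\<close> on \<open>[0, 2)\<close>.\<close>

lemma norm_one_minus_polar_ge:
  assumes "\<bar>x\<bar> \<le> pi" "1 / 4 \<le> s"
  shows "\<bar>x\<bar> / 8 \<le> cmod (1 - of_real s * cis x)"
proof -
  define y where "y = \<bar>x\<bar> / 2"
  have y: "0 \<le> y" "y < 2" using assms pi_half_less_two by (auto simp: y_def)
  have "\<bar>sin y - (\<Sum>m<3. sin_coeff m * y ^ m)\<bar> \<le> inverse (fact 3) * \<bar>y\<bar> ^ 3"
    by (rule Maclaurin_sin_bound)
  then have "\<bar>sin y - y\<bar> \<le> y ^ 3 / 6"
    using y by (simp add: eval_nat_numeral sin_coeff_def fact_reduce)
  then have "y - y ^ 3 / 6 \<le> sin y" by linarith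
  moreover have "y ^ 3 \<le> 4 * y"
  proof -
    have "y ^ 3 = y\<^sup>2 * y" by (simp add: eval_nat_numeral)
    also have "\<dots> \<le> 2\<^sup>2 * y" using y by (intro mult_right_mono power_mono) auto
    finally show ?thesis by simp
  qed
  ultimately have s1: "y / 4 \<le> sin y" using y by linarith
  have cos: "1 - cos x = 2 * (sin y)\<^sup>2"
  proof -
    have "cos x = cos (2 * y)" by (simp add: y_def)
    then show ?thesis by (simp add: cos_double_sin)
  qed
  have "(y / 4)\<^sup>2 \<le> (sin y)\<^sup>2" using s1 y by (intro power_mono) auto
  then have "\<bar>x\<bar>\<^sup>2 / 32 \<le> 1 - cos x" unfolding cos y_def by (simp add: power2_eq_square)
  then have c: "\<bar>x\<bar>\<^sup>2 / 64 \<le> (1/4) * (2 * (1 - cos x))" by simp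
  have "0 \<le> 1 - cos x" by simp
  then have c': "\<bar>x\<bar>\<^sup>2 / 64 \<le> s * (2 * (1 - cos x))"
    using order_trans[OF c mult_right_mono[OF assms(2)]] by simp
  have "(cmod (1 - of_real s * cis x))\<^sup>2 = (1 - s * cos x)\<^sup>2 + (s * sin x)\<^sup>2"
    by (simp add: cmod_power2)
  also have "\<dots> = 1 - 2 * s * cos x + s\<^sup>2 * ((sin x)\<^sup>2 + (cos x)\<^sup>2)"
    by (simp add: power2_eq_square algebra_simps del: sin_cos_squared_add sin_cos_squared_add2 sin_cos_squared_add3)
  also have "\<dots> = (1 - s)\<^sup>2 + s * (2 * (1 - cos x))"
    by (simp add: power2_eq_square algebra_simps)
  finally have "(\<bar>x\<bar> / 8)\<^sup>2 \<le> (cmod (1 - of_real s * cis x))\<^sup>2"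
    using add_increasing[OF zero_le_power2[of "1 - s"] c'] unfolding power_divide by simp
  then show ?thesis by (rule power2_le_imp_le) simp
qed

lemma norm_one_minus_cis_le: "cmod (1 - cis x) \<le> \<bar>x\<bar>"
proof (rule power2_le_imp_le)
  have "(cmod (1 - cis x))\<^sup>2 = (1 - cos x)\<^sup>2 + (sin x)\<^sup>2" by (simp add: cmod_power2)
  also have "\<dots> = 2 * (1 - cos (2 * (x / 2)))"
    using sin_cos_squared_add[of x] by (simp add: power2_eq_square algebra_simps)
  also have "\<dots> = (2 * \<bar>sin (x / 2)\<bar>)\<^sup>2"
    unfolding cos_double_sin by (simp add: power_mult_distrib)
  also have "\<dots> \<le> (2 * \<bar>x / 2\<bar>)\<^sup>2"
    by (intro power_mono mult_left_mono abs_sin_x_le_abs_x) auto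
  finally show "(cmod (1 - cis x))\<^sup>2 \<le> \<bar>x\<bar>\<^sup>2" by simp
qed simp

text \<open>Here \<open>\<tau>\<close> is minus the argument of \<open>z\<close>, measured in full turns and reduced to \<open>[0, 1]\<close>.\<close>

lemma polar_turn:
  obtains \<tau> :: real where "0 \<le> \<tau>" "\<tau> \<le> 1" "\<And>t. z * cis (2 * pi * t) = of_real (cmod z) * cis (2 * pi * (t - \<tau>))"
proof -
  have "\<exists>\<tau>::real. 0 \<le> \<tau> \<and> \<tau> \<le> 1 \<and> cis (Arg z) = cis (- 2 * pi * \<tau>)"
  proof (cases "Arg z \<le> 0")
    case True
    then show ?thesis using Arg_bounded[of z]
      by (intro exI[of _ "- Arg z / (2 * pi)"]) (auto simp: field_simps)
  next
    case False
    have "cis (- 2 * pi * (1 - Arg z / (2 * pi))) = cis (Arg z - 2 * pi)"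
      by (rule arg_cong[of _ _ cis]) (simp add: field_simps)
    also have "\<dots> = cis (Arg z)" by (simp add: cis_divide[symmetric])
    finally show ?thesis using False Arg_bounded[of z]
      by (intro exI[of _ "1 - Arg z / (2 * pi)"]) (auto simp: field_simps)
  qed
  then obtain \<tau> :: real where \<tau>: "0 \<le> \<tau>" "\<tau> \<le> 1" "cis (Arg z) = cis (- 2 * pi * \<tau>)" by blast
  have "z * cis (2 * pi * t) = of_real (cmod z) * cis (2 * pi * (t - \<tau>))" for t
  proof -
    have "z = of_real (cmod z) * cis (- 2 * pi * \<tau>)"
      using \<tau>(3) rcis_cmod_Arg[of z] by (simp add: rcis_def)
    then have "z * cis (2 * pi * t) = of_real (cmod z) * (cis (- 2 * pi * \<tau>) * cis (2 * pi * t))" 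
      by (metis mult.assoc)
    also have "cis (- 2 * pi * \<tau>) * cis (2 * pi * t) = cis (2 * pi * (t - \<tau>))"
      unfolding cis_mult by (rule arg_cong[of _ _ cis]) (simp add: algebra_simps)
    finally show ?thesis .
  qed
  then show ?thesis using that \<tau> by blast
qed

text \<open>All that the embedding theorem uses of the measure \<open>\<omega> dA\<close>. The tails \<open>{1 - \<delta> \<le> \<bar>z\<bar> < 1}\<close> are
  parametrized by their width \<open>\<delta>\<close>, which turns the condition defining \<^const>\<open>D_hat\<close> into ordinary doubling.\<close>

locale radial_doubling = finite_measure M for M :: "complex measure" +
  fixes Cw :: real
  assumes sets_M: "sets M = sets disk_borel"
    and rotation: "\<And>t. distr M disk_borel (\<lambda>z. cis t * z) = M"
    and tail_pos: "\<And>\<delta>. 0 < \<delta> \<Longrightarrow> \<delta> \<le> 1 \<Longrightarrow> 0 < measure M {z\<in>unit_disk. 1 - \<delta> \<le> cmod z}"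
    and tail_doubling: "\<And>\<delta>. 0 < \<delta> \<Longrightarrow> \<delta> \<le> 1 \<Longrightarrow>
       measure M {z\<in>unit_disk. 1 - \<delta> \<le> cmod z} \<le> Cw * measure M {z\<in>unit_disk. 1 - \<delta> / 2 \<le> cmod z}"
begin

definition tail :: "real \<Rightarrow> real" where
  "tail \<delta> = measure M {z\<in>unit_disk. 1 - \<delta> \<le> cmod z}"

text \<open>By rotation invariance the centre \<open>1\<close> represents all centres on the unit circle.\<close>

definition cap :: "real \<Rightarrow> real" where
  "cap \<delta> = measure M (ball 1 \<delta> \<inter> unit_disk)"

text \<open>The doubling constant of \<open>cap\<close>: \<open>384 = 24 \<cdot> 16\<close> comes from the constants \<open>12\<close> and \<open>1 / 16\<close> in the
  comparison of \<open>cap\<close> with \<open>tail\<close>.\<close>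

definition cap_const :: real where
  "cap_const = 384 * Cw\<^sup>2"

lemma space_M: "space M = unit_disk"
  using sets_eq_imp_space_eq[OF sets_M] by (simp add: space_restrict_space)

lemma borel_Int_disk [measurable]: "A \<in> sets borel \<Longrightarrow> A \<inter> unit_disk \<in> sets M"
  unfolding sets_M sets_restrict_space by auto

lemma tail_set [measurable]: "{z\<in>unit_disk. r \<le> cmod z} \<in> sets M"
proof -
  have "{z. r \<le> cmod z} \<in> sets borel" by measurable
  then have "{z. r \<le> cmod z} \<inter> unit_disk \<in> sets M" by (rule borel_Int_disk)
  moreover have "{z. r \<le> cmod z} \<inter> unit_disk = {z\<in>unit_disk. r \<le> cmod z}" by auto
  ultimately show ?thesis by simp
qed

lemma measurable_M_eq: "measurable M N = measurable disk_borel N"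
  by (rule measurable_cong_sets) (use sets_M in auto)

lemma rotate_measurable [measurable]: "(\<lambda>z. cis t * z) \<in> measurable M disk_borel"
proof (rule measurable_restrict_space2)
  show "(\<lambda>z. cis t * z) \<in> space M \<rightarrow> unit_disk" by (auto simp: space_M norm_mult)
  show "(\<lambda>z. cis t * z) \<in> borel_measurable M"
    unfolding measurable_M_eq by (rule measurable_restrict_space1) simp
qed

lemma nn_integral_rotate:
  assumes "\<Phi> \<in> borel_measurable M"
  shows "(\<integral>\<^sup>+ z. \<Phi> (cis t * z) \<partial>M) = (\<integral>\<^sup>+ z. \<Phi> z \<partial>M)"
proof -
  have "(\<integral>\<^sup>+ z. \<Phi> z \<partial>M) = (\<integral>\<^sup>+ z. \<Phi> z \<partial>(distr M disk_borel (\<lambda>z. cis t * z)))"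
    by (simp add: rotation)
  also have "\<dots> = (\<integral>\<^sup>+ z. \<Phi> (cis t * z) \<partial>M)"
    using assms by (intro nn_integral_distr rotate_measurable) (simp add: measurable_M_eq)
  finally show ?thesis by simp
qed

lemma polar_measurable:
  assumes "\<Phi> \<in> borel_measurable M"
  shows "(\<lambda>(z, t). \<Phi> (z * cis (2 * pi * t))) \<in> borel_measurable (M \<Otimes>\<^sub>M lborel)"
proof -
  have id: "(\<lambda>z. z) \<in> borel_measurable M"
    unfolding measurable_M_eq by (rule measurable_restrict_space1) simp
  have c: "(\<lambda>t. cis (2 * pi * t)) \<in> borel_measurable borel"
    by (intro borel_measurable_continuous_onI continuous_intros)
  have "(\<lambda>p. fst p * cis (2 * pi * snd p)) \<in> borel_measurable (M \<Otimes>\<^sub>M lborel)"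
    using measurable_compose[OF measurable_fst id] measurable_compose[OF measurable_snd, of "\<lambda>t. cis (2 * pi * t)" lborel]  c
    by (intro borel_measurable_times) auto
  then have "(\<lambda>p. fst p * cis (2 * pi * snd p)) \<in> measurable (M \<Otimes>\<^sub>M lborel) disk_borel"
    by (intro measurable_restrict_space2) (auto simp: space_pair_measure space_M norm_mult)
  moreover have "\<Phi> \<in> borel_measurable disk_borel" using assms by (simp add: measurable_M_eq)
  ultimately have "(\<lambda>p. \<Phi> (fst p * cis (2 * pi * snd p))) \<in> borel_measurable (M \<Otimes>\<^sub>M lborel)"
    by (rule measurable_compose)
  then show ?thesis by (simp add: case_prod_beta')
qed

text \<open>Rotation invariance and Fubini, whatever the radial part of \<open>M\<close> is.\<close>

lemma nn_integral_circle_average: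
  assumes [measurable]: "\<Phi> \<in> borel_measurable M"
  shows "(\<integral>\<^sup>+ z. (\<integral>\<^sup>+ t. \<Phi> (z * cis (2 * pi * t)) * indicator {0..1} t \<partial>lborel) \<partial>M) = (\<integral>\<^sup>+ z. \<Phi> z \<partial>M)"
proof -
  interpret P: pair_sigma_finite M "lborel :: real measure" ..
  have [measurable]: "(\<lambda>(z, t). \<Phi> (z * cis (2 * pi * t))) \<in> borel_measurable (M \<Otimes>\<^sub>M lborel)"
    by (rule polar_measurable) fact
  have meas: "(\<lambda>(z, t). \<Phi> (z * cis (2 * pi * t)) * indicator {0..1} t) \<in> borel_measurable (M \<Otimes>\<^sub>M lborel)"
  proof -
    have "(\<lambda>p. (case p of (z, t) \<Rightarrow> \<Phi> (z * cis (2 * pi * t))) * indicator {0..1} (snd p)) \<in> borel_measurable (M \<Otimes>\<^sub>M lborel)"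
      by measurable
    then show ?thesis by (simp add: case_prod_beta')
  qed
  have "(\<integral>\<^sup>+ z. (\<integral>\<^sup>+ t. \<Phi> (z * cis (2 * pi * t)) * indicator {0..1} t \<partial>lborel) \<partial>M)
      = (\<integral>\<^sup>+ t. (\<integral>\<^sup>+ z. \<Phi> (z * cis (2 * pi * t)) * indicator {0..1} t \<partial>M) \<partial>lborel)"
    by (rule P.Fubini'[OF meas, symmetric])
  also have "\<dots> = (\<integral>\<^sup>+ t. (\<integral>\<^sup>+ z. \<Phi> z \<partial>M) * indicator {0..1::real} t \<partial>lborel)"
  proof (intro nn_integral_cong)
    fix t :: real
    have "(\<integral>\<^sup>+ z. \<Phi> (z * cis (2 * pi * t)) \<partial>M) = (\<integral>\<^sup>+ z. \<Phi> z \<partial>M)"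
      using nn_integral_rotate[OF assms, of "2 * pi * t"] by (simp add: mult.commute)
    then show "(\<integral>\<^sup>+ z. \<Phi> (z * cis (2 * pi * t)) * indicator {0..1} t \<partial>M) = (\<integral>\<^sup>+ z. \<Phi> z \<partial>M) * indicator {0..1} t"
      by (cases "t \<in> {0..1}") auto
  qed
  also have "\<dots> = (\<integral>\<^sup>+ z. \<Phi> z \<partial>M)"
    by (simp add: nn_integral_cmult_indicator)
  finally show ?thesis .
qed

lemma measure_ball_eq_cap:
  assumes "cmod \<zeta> = 1"
  shows "measure M (ball \<zeta> \<delta> \<inter> unit_disk) = cap \<delta>"
proof -
  define t where "t = Arg \<zeta>"
  have \<zeta>: "\<zeta> = cis t" using assms rcis_cmod_Arg[of \<zeta>] by (simp add: t_def rcis_def)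
  have "measure M (ball \<zeta> \<delta> \<inter> unit_disk) = measure (distr M disk_borel (\<lambda>z. cis t * z)) (ball \<zeta> \<delta> \<inter> unit_disk)"
    by (simp add: rotation)
  also have "\<dots> = measure M ((\<lambda>z. cis t * z) -` (ball \<zeta> \<delta> \<inter> unit_disk) \<inter> space M)"
    by (rule measure_distr) (use borel_Int_disk[of "ball \<zeta> \<delta>"] in \<open>auto simp: sets_M\<close>)
  also have "(\<lambda>z. cis t * z) -` (ball \<zeta> \<delta> \<inter> unit_disk) \<inter> space M = ball 1 \<delta> \<inter> unit_disk"
  proof -
    have "dist \<zeta> (cis t * z) = dist 1 z" for z
    proof -
      have "\<zeta> - cis t * z = cis t * (1 - z)" by (simp add: \<zeta> algebra_simps)
      then show ?thesis unfolding dist_norm by (simp add: norm_mult)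
    qed
    then show ?thesis by (auto simp: space_M norm_mult)
  qed
  finally show ?thesis by (simp add: cap_def)
qed

lemma emeasure_ball_eq_cap:
  assumes "cmod \<zeta> = 1"
  shows "emeasure M (ball \<zeta> \<delta> \<inter> unit_disk) = ennreal (cap \<delta>)"
  using measure_ball_eq_cap[OF assms] by (simp add: emeasure_eq_measure)

lemma cap_mono: "\<delta> \<le> \<delta>' \<Longrightarrow> cap \<delta> \<le> cap \<delta>'"
  unfolding cap_def by (intro finite_measure_mono) auto

lemma cap_nonneg [simp]: "0 \<le> cap \<delta>" by (simp add: cap_def)

lemma tail_mono: "\<delta> \<le> \<delta>' \<Longrightarrow> tail \<delta> \<le> tail \<delta>'"
  unfolding tail_def by (intro finite_measure_mono tail_set) auto

lemma tail_nonneg [simp]: "0 \<le> tail \<delta>" by (simp add: tail_def)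

lemma Cw_ge_1: "1 \<le> Cw"
proof -
  have "tail 1 \<le> Cw * tail (1/2)" "0 < tail (1/2)" "tail (1/2) \<le> tail 1"
    using tail_doubling[of 1] tail_pos[of "1/2"] tail_mono[of "1/2" 1] by (auto simp: tail_def)
  then have "1 * tail (1/2) \<le> Cw * tail (1/2)" by linarith
  then show ?thesis using \<open>0 < tail (1/2)\<close> by (rule mult_right_le_imp_le)
qed

lemma cap_as_average:
  "ennreal (cap \<delta>) = (\<integral>\<^sup>+ z. emeasure lborel {t\<in>{0..1}. cmod (1 - z * cis (2 * pi * t)) < \<delta>} \<partial>M)"
proof -
  have m: "ball 1 \<delta> \<inter> unit_disk \<in> sets M" by (rule borel_Int_disk) simp
  have "ennreal (cap \<delta>) = (\<integral>\<^sup>+ z. indicator (ball 1 \<delta> \<inter> unit_disk) z \<partial>M)"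
    using m by (simp add: cap_def emeasure_eq_measure)
  also have "\<dots> = (\<integral>\<^sup>+ z. (\<integral>\<^sup>+ t. indicator (ball 1 \<delta> \<inter> unit_disk) (z * cis (2 * pi * t)) * indicator {0..1} t \<partial>lborel) \<partial>M)"
    using m by (intro nn_integral_circle_average[symmetric]) auto
  also have "\<dots> = (\<integral>\<^sup>+ z. emeasure lborel {t\<in>{0..1}. cmod (1 - z * cis (2 * pi * t)) < \<delta>} \<partial>M)"
  proof (intro nn_integral_cong)
    fix z assume z: "z \<in> space M"
    have s: "{t\<in>{0..1}. cmod (1 - z * cis (2 * pi * t)) < \<delta>} \<in> sets borel"
    proof -
      have "continuous_on UNIV (\<lambda>t. cmod (1 - z * cis (2 * pi * t)))" by (intro continuous_intros)
      then have [measurable]: "(\<lambda>t. cmod (1 - z * cis (2 * pi * t))) \<in> borel_measurable borel" by (rule borel_measurable_continuous_onI)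
      show ?thesis by measurable
    qed
    have "(\<integral>\<^sup>+ t. indicator (ball 1 \<delta> \<inter> unit_disk) (z * cis (2 * pi * t)) * indicator {0..1} t \<partial>lborel)
       = (\<integral>\<^sup>+ t. indicator {t\<in>{0..1}. cmod (1 - z * cis (2 * pi * t)) < \<delta>} t \<partial>lborel)"
      by (intro nn_integral_cong) (use z in \<open>auto simp: indicator_def dist_norm norm_mult space_M\<close>)
    then show "(\<integral>\<^sup>+ t. indicator (ball 1 \<delta> \<inter> unit_disk) (z * cis (2 * pi * t)) * indicator {0..1} t \<partial>lborel)
       = emeasure lborel {t\<in>{0..1}. cmod (1 - z * cis (2 * pi * t)) < \<delta>}"
      using s by simp
  qed
  finally show ?thesis .
qed

lemma nn_integral_tail_indicator:
  assumes "0 \<le> c"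
  shows "(\<integral>\<^sup>+ z. ennreal c * indicator {z\<in>unit_disk. 1 - \<delta> \<le> cmod z} z \<partial>M) = ennreal (c * tail \<delta>)"
  unfolding nn_integral_cmult_indicator[OF tail_set]
  by (simp only: emeasure_eq_measure tail_def ennreal_mult[OF assms measure_nonneg])

text \<open>A circle of radius \<open>s \<ge> 1 - \<delta>\<close> meets the disk of radius \<open>\<delta>\<close> about \<open>1\<close> in an arc of at most
  proportional length, and smaller circles do not meet it. The three intervals account for the argument being
  determined only up to full turns.\<close>

lemma cap_upper:
  assumes \<delta>: "0 < \<delta>" "\<delta> \<le> 1"
  shows "cap \<delta> \<le> 12 * \<delta> * tail \<delta>"
proof -
  have bd: "emeasure lborel {t\<in>{0..1}. cmod (1 - z * cis (2 * pi * t)) < \<delta>}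
      \<le> ennreal (12 * \<delta>) * indicator {z\<in>unit_disk. 1 - \<delta> \<le> cmod z} z" if z: "cmod z < 1" for z
  proof (cases "1 - \<delta> \<le> cmod z")
    case False
    have "\<delta> \<le> cmod (1 - z * cis (2 * pi * t))" for t
      using norm_triangle_ineq2[of 1 "z * cis (2 * pi * t)"] False by (simp add: norm_mult)
    then have "{t\<in>{0..1}. cmod (1 - z * cis (2 * pi * t)) < \<delta>} = {}" by (auto simp: not_less)
    then show ?thesis by (simp only: emeasure_empty) simp
  next
    case True
    have "emeasure lborel {t\<in>{0..1}. cmod (1 - z * cis (2 * pi * t)) < \<delta>} \<le> ennreal (12 * \<delta>)"
    proof (cases "\<delta> \<le> 3/4")
      case False
      have "emeasure lborel {t\<in>{0..1}. cmod (1 - z * cis (2 * pi * t)) < \<delta>} \<le> emeasure lborel {0..1::real}"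
        by (intro emeasure_mono) auto
      also have "\<dots> \<le> ennreal (12 * \<delta>)" using False by simp
      finally show ?thesis .
    next
      case d: True
      obtain \<tau> :: real where \<tau>: "0 \<le> \<tau>" "\<tau> \<le> 1"
        "\<And>t. z * cis (2 * pi * t) = of_real (cmod z) * cis (2 * pi * (t - \<tau>))" using polar_turn by blast
      let ?I = "\<lambda>k::real. {\<tau> + k - 2 * \<delta> .. \<tau> + k + 2 * \<delta>}"
      have sub: "{t\<in>{0..1}. cmod (1 - z * cis (2 * pi * t)) < \<delta>} \<subseteq> ?I 0 \<union> ?I 1 \<union> ?I (-1)"
      proof safe
        fix t :: real assume t: "t \<in> {0..1}" "cmod (1 - z * cis (2 * pi * t)) < \<delta>"
          "t \<notin> ?I 1" "t \<notin> ?I (-1)"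
        have key: "\<bar>t - \<tau> - k\<bar> \<le> 2 * \<delta>" if k: "k \<in> \<int>" and small: "\<bar>t - \<tau> - k\<bar> \<le> 1 / 2" for k
        proof -
          obtain m where m: "k = of_int m" using k by (elim Ints_cases)
          have "cis (2 * pi * (t - \<tau>)) = cis (2 * pi * (t - \<tau> - k)) * cis (2 * pi * k)"
            by (simp add: cis_mult algebra_simps)
          also have "cis (2 * pi * k) = 1" using cis_multiple_2pi[of k] k by simp
          finally have e: "cis (2 * pi * (t - \<tau>)) = cis (2 * pi * (t - \<tau> - k))" by simp
          have "\<bar>2 * pi * (t - \<tau> - k)\<bar> \<le> pi" 
            using mult_left_mono[OF small, of "2 * pi"] by (simp add: abs_mult)
          then have "\<bar>2 * pi * (t - \<tau> - k)\<bar> / 8 \<le> cmod (1 - of_real (cmod z) * cis (2 * pi * (t - \<tau> - k)))"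
            by (rule norm_one_minus_polar_ge) (use True d in auto)
          also have "\<dots> < \<delta>" using t(2) \<tau>(3)[of t] e by simp
          finally have "2 * pi * \<bar>t - \<tau> - k\<bar> < 8 * \<delta>" by (simp add: abs_mult)
          moreover have "4 * \<bar>t - \<tau> - k\<bar> \<le> 2 * pi * \<bar>t - \<tau> - k\<bar>"
            using pi_gt3 by (intro mult_right_mono) auto
          ultimately have "4 * \<bar>t - \<tau> - k\<bar> < 8 * \<delta>" by (rule order.strict_trans1[rotated])
          then show ?thesis by simp
        qed
        have "\<bar>t - \<tau>\<bar> \<le> 1/2 \<or> \<bar>t - \<tau> - 1\<bar> \<le> 1/2 \<or> \<bar>t - \<tau> - (-1)\<bar> \<le> 1/2"
        proof -
          have "0 \<le> t" "t \<le> 1" using t(1) by auto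
          then show ?thesis using \<tau>(1,2) unfolding abs_le_iff by linarith
        qed
        then show "t \<in> ?I 0"
          using key[of 0] key[of 1] key[of "-1"] t(3,4) by (auto simp: abs_le_iff)
      qed
      have "emeasure lborel {t\<in>{0..1}. cmod (1 - z * cis (2 * pi * t)) < \<delta>} \<le> emeasure lborel (?I 0 \<union> ?I 1 \<union> ?I (-1))"
        by (intro emeasure_mono sub) auto
      also have "\<dots> \<le> emeasure lborel (?I 0 \<union> ?I 1) + emeasure lborel (?I (-1))"
        by (intro emeasure_subadditive) auto
      also have "\<dots> \<le> (emeasure lborel (?I 0) + emeasure lborel (?I 1)) + emeasure lborel (?I (-1))"
        by (intro add_right_mono emeasure_subadditive) auto
      also have "\<dots> = ennreal (12 * \<delta>)" using \<delta> by (simp add: ennreal_plus[symmetric] del: ennreal_plus)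
      finally show ?thesis .
    qed
    then show ?thesis using True z by simp
  qed
  have "ennreal (cap \<delta>) \<le> (\<integral>\<^sup>+ z. ennreal (12 * \<delta>) * indicator {z\<in>unit_disk. 1 - \<delta> \<le> cmod z} z \<partial>M)"
    unfolding cap_as_average by (intro nn_integral_mono bd) (simp add: space_M)
  also have "\<dots> = ennreal (12 * \<delta> * tail \<delta>)"
    using \<delta> by (intro nn_integral_tail_indicator) simp
  finally show ?thesis using \<delta> by (simp add: ennreal_le_iff)
qed

text \<open>A circle of radius \<open>s \<ge> 1 - \<delta> / 2\<close> meets the disk of radius \<open>\<delta>\<close> about \<open>1\<close> in an arc of at least
  proportional length; one of the two halves of the arc fits into the parameter interval.\<close>

lemma cap_lower:
  assumes \<delta>: "0 < \<delta>" "\<delta> \<le> 1"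
  shows "\<delta> / 16 * tail (\<delta> / 2) \<le> cap \<delta>"
proof -
  have bd: "ennreal (\<delta> / 16) * indicator {z\<in>unit_disk. 1 - \<delta> / 2 \<le> cmod z} z
     \<le> emeasure lborel {t\<in>{0..1}. cmod (1 - z * cis (2 * pi * t)) < \<delta>}" if z: "cmod z < 1" for z
  proof (cases "1 - \<delta> / 2 \<le> cmod z")
    case True
    obtain \<tau> :: real where \<tau>: "0 \<le> \<tau>" "\<tau> \<le> 1"
      "\<And>t. z * cis (2 * pi * t) = of_real (cmod z) * cis (2 * pi * (t - \<tau>))" using polar_turn by blast
    have near: "cmod (1 - z * cis (2 * pi * t)) < \<delta>" if t: "\<bar>t - \<tau>\<bar> < \<delta> / 16" for t
    proof -
      have "cmod (1 - z * cis (2 * pi * t)) = cmod (of_real (1 - cmod z) + of_real (cmod z) * (1 - cis (2 * pi * (t - \<tau>))))"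
        unfolding \<tau>(3) by (simp add: algebra_simps)
      also have "\<dots> \<le> (1 - cmod z) + cmod z * cmod (1 - cis (2 * pi * (t - \<tau>)))"
        by (rule order_trans[OF norm_triangle_ineq]) (use z in \<open>simp add: norm_mult del: of_real_diff\<close>)
      also have "\<dots> \<le> (1 - cmod z) + 1 * \<bar>2 * pi * (t - \<tau>)\<bar>"
      proof (intro add_left_mono mult_mono)
        show "cmod (1 - cis (2 * pi * (t - \<tau>))) \<le> \<bar>2 * pi * (t - \<tau>)\<bar>"
          by (rule norm_one_minus_cis_le)
      qed (use z in auto)
      also have "\<dots> \<le> (1 - cmod z) + 8 * \<bar>t - \<tau>\<bar>"
        using pi_less_4 by (auto simp: abs_mult intro!: mult_right_mono)
      also have "\<dots> < \<delta> / 2 + \<delta> / 2" using t True by (intro add_le_less_mono) auto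
      finally show ?thesis by simp
    qed
    define J where "J = (if \<tau> \<le> 1/2 then {\<tau> ..< \<tau> + \<delta> / 16} else {\<tau> - \<delta> / 16 <.. \<tau>})"
    have "J \<subseteq> {t\<in>{0..1}. cmod (1 - z * cis (2 * pi * t)) < \<delta>}"
      using \<tau>(1,2) \<delta> by (auto simp: J_def intro!: near split: if_splits)
    moreover have "{t\<in>{0..1}. cmod (1 - z * cis (2 * pi * t)) < \<delta>} \<in> sets borel"
    proof -
      have "continuous_on UNIV (\<lambda>t. cmod (1 - z * cis (2 * pi * t)))" by (intro continuous_intros)
      then have [measurable]: "(\<lambda>t. cmod (1 - z * cis (2 * pi * t))) \<in> borel_measurable borel" by (rule borel_measurable_continuous_onI)
      show ?thesis by measurable
    qed
    ultimately have "emeasure lborel J \<le> emeasure lborel {t\<in>{0..1}. cmod (1 - z * cis (2 * pi * t)) < \<delta>}"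
      by (intro emeasure_mono) auto
    moreover have "emeasure lborel J = ennreal (\<delta> / 16)" using \<delta> by (simp add: J_def)
    ultimately show ?thesis using True z by simp
  qed simp
  have "ennreal (\<delta> / 16 * tail (\<delta> / 2)) = (\<integral>\<^sup>+ z. ennreal (\<delta> / 16) * indicator {z\<in>unit_disk. 1 - \<delta> / 2 \<le> cmod z} z \<partial>M)"
    using \<delta> by (intro nn_integral_tail_indicator[symmetric]) simp
  also have "\<dots> \<le> ennreal (cap \<delta>)"
    unfolding cap_as_average by (intro nn_integral_mono bd) (simp add: space_M)
  finally show ?thesis by (simp add: ennreal_le_iff)
qed

lemma tail_double: "0 < \<delta> \<Longrightarrow> \<delta> \<le> 1 \<Longrightarrow> tail \<delta> \<le> Cw * tail (\<delta> / 2)"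
  using tail_doubling by (simp add: tail_def)

lemma cap_pos: "0 < \<delta> \<Longrightarrow> 0 < cap \<delta>"
proof -
  assume \<delta>: "0 < \<delta>"
  define d where "d = min \<delta> 1"
  have d: "0 < d" "d \<le> 1" "d \<le> \<delta>" using \<delta> by (auto simp: d_def)
  have "0 < d / 16 * tail (d / 2)"
    using d tail_pos[of "d / 2"] by (simp add: tail_def)
  also have "\<dots> \<le> cap d" by (rule cap_lower) (use d in auto)
  also have "\<dots> \<le> cap \<delta>" using d by (intro cap_mono)
  finally show ?thesis .
qed

lemma cap_double:
  assumes \<delta>: "0 < \<delta>"
  shows "cap (2 * \<delta>) \<le> cap_const * cap \<delta>"
proof (cases "\<delta> \<le> 1/2")
  case True
  have "cap (2 * \<delta>) \<le> 12 * (2 * \<delta>) * tail (2 * \<delta>)" by (rule cap_upper) (use \<delta> True in auto)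
  also have "\<dots> \<le> 12 * (2 * \<delta>) * (Cw * (Cw * tail (\<delta> / 2)))"
  proof (intro mult_left_mono)
    have "tail (2 * \<delta>) \<le> Cw * tail \<delta>" using tail_double[of "2 * \<delta>"] \<delta> True by simp
    also have "\<dots> \<le> Cw * (Cw * tail (\<delta> / 2))"
      using Cw_ge_1 tail_double[of \<delta>] \<delta> True by (intro mult_left_mono) auto
    finally show "tail (2 * \<delta>) \<le> Cw * (Cw * tail (\<delta> / 2))" .
  qed (use \<delta> in auto)
  also have "\<dots> = 384 * Cw\<^sup>2 * (\<delta> / 16 * tail (\<delta> / 2))" by (simp add: power2_eq_square)
  also have "\<dots> \<le> 384 * Cw\<^sup>2 * cap \<delta>"
    using cap_lower[of \<delta>] \<delta> True by (intro mult_left_mono) auto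
  finally show ?thesis by (simp add: cap_const_def)
next
  case False
  have "cap (2 * \<delta>) \<le> tail 1"
    unfolding cap_def tail_def by (intro finite_measure_mono tail_set) auto
  also have "\<dots> \<le> Cw * tail (1/2)" using tail_double[of 1] by simp
  also have "\<dots> \<le> Cw * (Cw * tail (1/4))"
    using Cw_ge_1 tail_double[of "1/2"] by (intro mult_left_mono) auto
  also have "\<dots> = 32 * Cw\<^sup>2 * (1/2 / 16 * tail (1/4))" by (simp add: power2_eq_square)
  also have "\<dots> \<le> 32 * Cw\<^sup>2 * cap (1/2)"
    using cap_lower[of "1/2"] by (intro mult_left_mono) auto
  also have "\<dots> \<le> 384 * Cw\<^sup>2 * cap \<delta>"
    using cap_mono[of "1/2" \<delta>] False by (intro mult_mono) auto
  finally show ?thesis by (simp add: cap_const_def)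
qed

lemma cap_const_ge: "2 \<le> cap_const"
proof -
  have "1 \<le> Cw\<^sup>2" using Cw_ge_1 by (simp add: one_le_power)
  then show ?thesis by (simp add: cap_const_def)
qed

lemma cap_iterate:
  assumes "0 < \<delta>"
  shows "cap (2 ^ j * \<delta>) \<le> cap_const ^ j * cap \<delta>"
proof (induction j)
  case (Suc j)
  have "cap (2 ^ Suc j * \<delta>) = cap (2 * (2 ^ j * \<delta>))" by (simp add: mult.assoc)
  also have "\<dots> \<le> cap_const * cap (2 ^ j * \<delta>)" using assms by (intro cap_double) simp
  also have "\<dots> \<le> cap_const * (cap_const ^ j * cap \<delta>)"
    using Suc cap_const_ge by (intro mult_left_mono) auto
  finally show ?case by (simp add: mult.assoc)
qed simp

lemma tail_ge_cap:
  assumes "0 < h" "h \<le> 1"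
  shows "cap h \<le> 12 * Cw * h * tail (h / 2)"
proof -
  have "cap h \<le> 12 * h * tail h" by (rule cap_upper[OF assms])
  also have "\<dots> \<le> 12 * h * (Cw * tail (h / 2))"
    using assms by (intro mult_left_mono tail_double) auto
  finally show ?thesis by (simp add: mult_ac)
qed

text \<open>Iterated doubling: the mass of a cap decays at most like the power \<open>log 2 cap_const\<close> of its radius. This
  exponent is the threshold \<open>\<gamma>\<^sub>0\<close> of the theorem.\<close>

lemma cap_growth:
  assumes "0 < h" "h \<le> 1"
  shows "cap 1 * (h / 2) powr (log 2 cap_const) \<le> cap h"
proof -
  define j where "j = nat \<lceil>log 2 (1 / h)\<rceil>"
  have l0: "0 \<le> log 2 (1 / h)" using assms by simp
  have j1: "log 2 (1 / h) \<le> real j" using l0 unfolding j_def by (simp add: le_of_int_ceiling)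
  have j2: "real j < log 2 (1 / h) + 1" using l0 unfolding j_def by linarith
  have a: "1 \<le> 2 ^ j * h"
  proof -
    have "1 / h = 2 powr log 2 (1 / h)" using assms by simp
    also have "\<dots> \<le> 2 powr real j" using j1 by (intro powr_mono) auto
    finally show ?thesis using assms by (simp add: powr_realpow divide_simps)
  qed
  have "cap_const ^ j = cap_const powr real j" using cap_const_ge by (simp add: powr_realpow)
  also have "\<dots> \<le> cap_const powr log 2 (2 / h)"
  proof (intro powr_mono)
    have "log 2 (2 / h) = log 2 (1 / h) + 1" using assms log_mult[of 2 2 "1 / h"] by simp
    then show "real j \<le> log 2 (2 / h)" using j2 by simp
  qed (use cap_const_ge in auto)
  also have "\<dots> = (2 / h) powr log 2 cap_const"
    using cap_const_ge assms by (simp add: powr_def log_def)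
  finally have c: "cap_const ^ j \<le> (2 / h) powr log 2 cap_const" .
  have "cap 1 \<le> cap (2 ^ j * h)" using a by (rule cap_mono)
  also have "\<dots> \<le> cap_const ^ j * cap h" using assms by (intro cap_iterate) auto
  also have "\<dots> \<le> (2 / h) powr log 2 cap_const * cap h" using c by (intro mult_right_mono) auto
  finally have "cap 1 * (h / 2) powr (log 2 cap_const) \<le> ((2 / h) powr log 2 cap_const * cap h) * (h / 2) powr (log 2 cap_const)"
    by (intro mult_right_mono) auto
  also have "\<dots> = cap h"
  proof -
    have "(2 / h) powr log 2 cap_const * (h / 2) powr (log 2 cap_const) = ((2 / h) * (h / 2)) powr log 2 cap_const"
      using assms by (intro powr_mult[symmetric]) 
    then show ?thesis using assms by (simp add: mult_ac)
  qed
  finally show ?thesis .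
qed

end

section \<open>Kernel estimates\<close>

text \<open>Since \<open>\<zeta>\<close> is the radial projection of \<open>w\<close>, replacing \<open>w\<close> by \<open>\<zeta>\<close> in \<open>1 - cnj w z\<close> costs at most
  \<open>1 - \<bar>w\<bar>\<close>, which is itself at most \<open>\<bar>1 - cnj w z\<bar>\<close>. So the kernel is governed by the Euclidean distance to
  \<open>\<zeta>\<close>.\<close>

lemma kernel_denominator_ge:
  assumes w: "cmod w < 1" and \<zeta>: "cmod \<zeta> = 1" "w = of_real (cmod w) * \<zeta>" and z: "cmod z < 1"
  shows "1 - cmod w \<le> cmod (1 - cnj w * z)" "cmod (\<zeta> - z) \<le> 2 * cmod (1 - cnj w * z)"
    "0 < cmod (1 - cnj w * z)"
proof -
  have le: "cmod (cnj w * z) \<le> cmod w * 1" unfolding norm_mult by (intro mult_mono) (use z in auto)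
  then show 1: "1 - cmod w \<le> cmod (1 - cnj w * z)"
    using norm_triangle_ineq2[of 1 "cnj w * z"] by simp
  then show "0 < cmod (1 - cnj w * z)" using w by linarith
  have cz: "cnj \<zeta> * \<zeta> = 1" using \<zeta>(1) by (metis complex_norm_square mult.commute of_real_1 one_power2)
  have "cmod (\<zeta> - z) = cmod (cnj \<zeta> * (\<zeta> - z))" using \<zeta>(1) by (simp add: norm_mult)
  also have "cnj \<zeta> * (\<zeta> - z) = (1 - cnj w * z) + (cnj w - cnj \<zeta>) * z"
    using cz by (simp add: algebra_simps)
  also have "cmod \<dots> \<le> cmod (1 - cnj w * z) + cmod (cnj w - cnj \<zeta>) * cmod z"
    by (metis norm_mult norm_triangle_ineq)
  also have "cmod (cnj w - cnj \<zeta>) * cmod z \<le> (1 - cmod w) * 1"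
  proof (intro mult_mono)
    have "cnj w - cnj \<zeta> = of_real (cmod w - 1) * cnj \<zeta>"
      by (subst \<zeta>(2)) (simp add: algebra_simps)
    then have "cmod (cnj w - cnj \<zeta>) = \<bar>cmod w - 1\<bar> * 1"
      using \<zeta>(1) by (simp only: norm_mult norm_of_real complex_mod_cnj)
    then show "cmod (cnj w - cnj \<zeta>) \<le> 1 - cmod w" using w by simp
  qed (use z w in auto)
  also have "cmod (1 - cnj w * z) + (1 - cmod w) * 1 \<le> 2 * cmod (1 - cnj w * z)" using 1 by simp
  finally show "cmod (\<zeta> - z) \<le> 2 * cmod (1 - cnj w * z)" by simp
qed

text \<open>Take the first of the disks about \<open>\<zeta>\<close> with radii \<open>2 (1 - \<bar>w\<bar>), 4 (1 - \<bar>w\<bar>), \<dots>\<close> that contains \<open>z\<close>;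
  outside the preceding one the kernel is small.\<close>

lemma kernel_dyadic_bound:
  assumes w: "cmod w < 1" and \<zeta>: "cmod \<zeta> = 1" "w = of_real (cmod w) * \<zeta>" and z: "cmod z < 1" and N: "0 \<le> N"
  shows "\<exists>i::nat. z \<in> ball \<zeta> (2 ^ (i + 1) * (1 - cmod w)) \<and>
     ((1 - cmod w) / cmod (1 - cnj w * z)) powr N \<le> 2 powr N * (2 powr - N) ^ i"
proof -
  define h where "h = 1 - cmod w"
  have h: "0 < h" using w by (simp add: h_def)
  define P where "P = (\<lambda>i::nat. cmod (\<zeta> - z) < 2 ^ (i + 1) * h)"
  have "\<exists>i. P i"
  proof -
    obtain i :: nat where i: "2 / h < 2 ^ i" using real_arch_pow[of 2 "2 / h"] by auto
    have "cmod (\<zeta> - z) \<le> cmod \<zeta> + cmod z" by (rule norm_triangle_ineq4)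
    also have "\<dots> < 2" using \<zeta>(1) z by simp
    also have "\<dots> < 2 ^ i * h" using i h by (simp add: divide_simps)
    also have "\<dots> \<le> 2 ^ (i + 1) * h" using h by simp
    finally show ?thesis unfolding P_def by blast
  qed
  define i where "i = (LEAST i. P i)"
  have Pi: "P i" unfolding i_def using \<open>\<exists>i. P i\<close> by (rule LeastI_ex)
  have den: "h \<le> cmod (1 - cnj w * z)" "cmod (\<zeta> - z) \<le> 2 * cmod (1 - cnj w * z)" "0 < cmod (1 - cnj w * z)"
    using kernel_denominator_ge[OF w \<zeta> z] by (auto simp: h_def)
  have "h / cmod (1 - cnj w * z) \<le> 2 * (1 / 2) ^ i"
  proof (cases i)
    case 0
    have "h / cmod (1 - cnj w * z) \<le> 1" using den by (simp add: divide_simps)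
    then show ?thesis using 0 by simp
  next
    case (Suc k)
    then have "\<not> P k" using not_less_Least[of k P] by (simp add: i_def)
    then have "2 ^ Suc k * h \<le> 2 * cmod (1 - cnj w * z)" using den(2) by (simp add: P_def not_less)
    then have "2 ^ k * h \<le> cmod (1 - cnj w * z)" by simp
    then have "h / cmod (1 - cnj w * z) \<le> h / (2 ^ k * h)"
      using h den by (intro divide_left_mono) auto
    then show ?thesis using Suc h by (simp add: power_divide)
  qed
  then have "(h / cmod (1 - cnj w * z)) powr N \<le> (2 * (1 / 2) ^ i) powr N"
    using N h by (intro powr_mono2) auto
  also have "\<dots> = 2 powr N * ((1 / 2) ^ i) powr N" by (simp add: powr_mult)
  also have "((1 / 2) ^ i) powr N = (2 powr - N) ^ i"
    by (simp add: powr_minus power_one_over powr_realpow[symmetric] powr_powr inverse_eq_divide powr_divide mult.commute)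
  finally show ?thesis using Pi by (auto simp: P_def dist_norm h_def)
qed

lemma exists_radial_projection:
  obtains \<zeta> :: complex where "cmod \<zeta> = 1" "w = of_real (cmod w) * \<zeta>"
proof (cases "w = 0")
  case True
  then show ?thesis using that[of 1] by simp
next
  case False
  then show ?thesis using that[of "w / of_real (cmod w)"] by (simp add: norm_divide)
qed

context radial_doubling
begin

lemma holomorphic_measurable: "f holomorphic_on unit_disk \<Longrightarrow> f \<in> borel_measurable M"
  unfolding measurable_M_eq
  by (rule borel_measurable_continuous_on_restrict) (rule holomorphic_on_imp_continuous_on)

lemma kernel_measurable: "(\<lambda>z. cmod (1 - cnj w * z)) \<in> borel_measurable M"
  unfolding measurable_M_eq
  by (rule borel_measurable_continuous_on_restrict) (intro continuous_intros)

text \<open>The majorization on circles is integrated over the circles of radius at least \<open>1 - (1 - \<bar>w\<bar>) / 2\<close>, for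
  which the factor in front of the mean is at most \<open>2 / (1 - \<bar>w\<bar>)\<close>. On the left this produces the mass of a
  tail, on the right an integral over the disk.\<close>

lemma point_estimate_kernel:
  assumes f: "f holomorphic_on unit_disk" and \<alpha>: "0 < \<alpha>" and w: "cmod w < 1"
  shows "ennreal (cmod (f w) powr \<alpha> * tail ((1 - cmod w) / 2)) \<le> ennreal (2 / (1 - cmod w) * 2 ^ N) *
     (\<integral>\<^sup>+ z. ennreal (((1 - cmod w) / cmod (1 - cnj w * z)) ^ N) * ennreal (cmod (f z) powr \<alpha>) \<partial>M)"
proof -
  define h where "h = 1 - cmod w"
  have h: "0 < h" "h \<le> 1" using w by (auto simp: h_def)
  define \<Psi> where "\<Psi> = (\<lambda>z. ennreal (cmod (f z) powr \<alpha> * ((1 - (cmod w)\<^sup>2) / cmod (1 - cnj w * z)) ^ N))"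
  have [measurable]: "\<Psi> \<in> borel_measurable M"
    using holomorphic_measurable[OF f] kernel_measurable[of w] unfolding \<Psi>_def by measurable
  have bd: "ennreal (cmod (f w) powr \<alpha>) * indicator {z\<in>unit_disk. 1 - h / 2 \<le> cmod z} z
     \<le> ennreal (2 / h) * (\<integral>\<^sup>+ t. \<Psi> (z * cis (2 * pi * t)) * indicator {0..1} t \<partial>lborel)" if z: "cmod z < 1" for z
  proof (cases "1 - h / 2 \<le> cmod z")
    case True
    then have wz2: "h / 2 \<le> cmod z - cmod w" unfolding h_def by (simp add: field_simps)
    then have wz1: "cmod w < cmod z" using h by linarith
    note wz = wz1 wz2
    have "cmod z / (cmod z - cmod w) \<le> 1 / (h / 2)"
      using wz z h by (intro frac_le) auto
    then have "ennreal (cmod z / (cmod z - cmod w)) \<le> ennreal (2 / h)" by (intro ennreal_leI) simp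
    moreover have "ennreal (cmod (f w) powr \<alpha>) \<le> ennreal (cmod z / (cmod z - cmod w)) * (\<integral>\<^sup>+ t. \<Psi> (z * cis (2 * pi * t)) * indicator {0..1} t \<partial>lborel)"
      unfolding \<Psi>_def by (rule holomorphic_circle_majorization[OF f \<alpha> z wz(1)])
    ultimately have "ennreal (cmod (f w) powr \<alpha>) \<le> ennreal (2 / h) * (\<integral>\<^sup>+ t. \<Psi> (z * cis (2 * pi * t)) * indicator {0..1} t \<partial>lborel)"
      by (meson mult_right_mono order_trans zero_le)
    then show ?thesis using True z by simp
  qed simp
  have "ennreal (cmod (f w) powr \<alpha> * tail (h / 2)) = (\<integral>\<^sup>+ z. ennreal (cmod (f w) powr \<alpha>) * indicator {z\<in>unit_disk. 1 - h / 2 \<le> cmod z} z \<partial>M)"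
    by (intro nn_integral_tail_indicator[symmetric]) simp
  also have "\<dots> \<le> (\<integral>\<^sup>+ z. ennreal (2 / h) * (\<integral>\<^sup>+ t. \<Psi> (z * cis (2 * pi * t)) * indicator {0..1} t \<partial>lborel) \<partial>M)"
    by (intro nn_integral_mono bd) (simp add: space_M)
  also have "\<dots> = ennreal (2 / h) * (\<integral>\<^sup>+ z. (\<integral>\<^sup>+ t. \<Psi> (z * cis (2 * pi * t)) * indicator {0..1} t \<partial>lborel) \<partial>M)"
  proof (rule nn_integral_cmult)
    have "(\<lambda>(z, t). \<Psi> (z * cis (2 * pi * t))) \<in> borel_measurable (M \<Otimes>\<^sub>M lborel)"
      by (rule polar_measurable) fact
    then have "(\<lambda>p. (case p of (z, t) \<Rightarrow> \<Psi> (z * cis (2 * pi * t))) * indicator {0..1} (snd p)) \<in> borel_measurable (M \<Otimes>\<^sub>M lborel)"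
      by measurable
    then have "(\<lambda>(z, t). \<Psi> (z * cis (2 * pi * t)) * indicator {0..1} t) \<in> borel_measurable (M \<Otimes>\<^sub>M lborel)"
      by (simp add: case_prod_beta')
    then show "(\<lambda>z. \<integral>\<^sup>+ t. \<Psi> (z * cis (2 * pi * t)) * indicator {0..1} t \<partial>lborel) \<in> borel_measurable M"
      by (rule lborel.borel_measurable_nn_integral)
  qed
  also have "(\<integral>\<^sup>+ z. (\<integral>\<^sup>+ t. \<Psi> (z * cis (2 * pi * t)) * indicator {0..1} t \<partial>lborel) \<partial>M) = (\<integral>\<^sup>+ z. \<Psi> z \<partial>M)"
    by (rule nn_integral_circle_average) fact
  also have "(\<integral>\<^sup>+ z. \<Psi> z \<partial>M) \<le> (\<integral>\<^sup>+ z. ennreal (2 ^ N) * (ennreal ((h / cmod (1 - cnj w * z)) ^ N) * ennreal (cmod (f z) powr \<alpha>)) \<partial>M)"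
  proof (intro nn_integral_mono)
    fix z
    have "1 - (cmod w)\<^sup>2 = (1 + cmod w) * h" by (simp add: h_def power2_eq_square algebra_simps)
    also have "\<dots> \<le> 2 * h" using w h by (intro mult_right_mono) auto
    finally have "(1 - (cmod w)\<^sup>2) / cmod (1 - cnj w * z) \<le> 2 * h / cmod (1 - cnj w * z)"
      by (intro divide_right_mono) auto
    moreover have "0 \<le> 1 - (cmod w)\<^sup>2" using w by (simp add: abs_square_le_1)
    ultimately have "((1 - (cmod w)\<^sup>2) / cmod (1 - cnj w * z)) ^ N \<le> (2 * h / cmod (1 - cnj w * z)) ^ N"
      by (intro power_mono) auto
    also have "\<dots> = 2 ^ N * (h / cmod (1 - cnj w * z)) ^ N" by (simp add: power_mult_distrib power_divide)
    finally have "((1 - (cmod w)\<^sup>2) / cmod (1 - cnj w * z)) ^ N \<le> 2 ^ N * (h / cmod (1 - cnj w * z)) ^ N" .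
    from mult_left_mono[OF this, of "cmod (f z) powr \<alpha>"]
    have "cmod (f z) powr \<alpha> * ((1 - (cmod w)\<^sup>2) / cmod (1 - cnj w * z)) ^ N
       \<le> 2 ^ N * ((h / cmod (1 - cnj w * z)) ^ N * cmod (f z) powr \<alpha>)"
      by (simp add: mult_ac)
    then show "\<Psi> z \<le> ennreal (2 ^ N) * (ennreal ((h / cmod (1 - cnj w * z)) ^ N) * ennreal (cmod (f z) powr \<alpha>))"
      unfolding \<Psi>_def using h by (simp add: ennreal_mult[symmetric] ennreal_leI)
  qed
  also have "\<dots> = ennreal (2 ^ N) * (\<integral>\<^sup>+ z. ennreal ((h / cmod (1 - cnj w * z)) ^ N) * ennreal (cmod (f z) powr \<alpha>) \<partial>M)"
  proof (rule nn_integral_cmult)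
    have [measurable]: "(\<lambda>z. cmod (1 - cnj w * z)) \<in> borel_measurable M" "f \<in> borel_measurable M"
      using kernel_measurable holomorphic_measurable[OF f] by auto
    show "(\<lambda>z. ennreal ((h / cmod (1 - cnj w * z)) ^ N) * ennreal (cmod (f z) powr \<alpha>)) \<in> borel_measurable M"
      by measurable
  qed
  finally have fin: "ennreal (cmod (f w) powr \<alpha> * tail (h / 2)) \<le> ennreal (2 / h) * (ennreal (2 ^ N) *
      (\<integral>\<^sup>+ z. ennreal ((h / cmod (1 - cnj w * z)) ^ N) * ennreal (cmod (f z) powr \<alpha>) \<partial>M))"
    by (simp add: mult_left_mono)
  have e: "ennreal (2 / h * 2 ^ N) = ennreal (2 / h) * ennreal (2 ^ N)" using h by (intro ennreal_mult) auto
  show ?thesis using fin unfolding h_def[symmetric] e by (simp only: mult.assoc)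
qed

lemma kernel_integral_le:
  assumes w: "cmod w < 1" and \<zeta>: "cmod \<zeta> = 1" "w = of_real (cmod w) * \<zeta>" and N: "0 \<le> N"
    and [measurable]: "g \<in> borel_measurable M"
  shows "(\<integral>\<^sup>+ z. ennreal (((1 - cmod w) / cmod (1 - cnj w * z)) powr N) * g z \<partial>M)
    \<le> (\<Sum>i. ennreal (2 powr N * (2 powr - N) ^ i) *
         (\<integral>\<^sup>+ z. g z * indicator (ball \<zeta> (2 ^ (i + 1) * (1 - cmod w)) \<inter> unit_disk) z \<partial>M))"
proof -
  define B where "B = (\<lambda>i::nat. ball \<zeta> (2 ^ (i + 1) * (1 - cmod w)) \<inter> unit_disk)"
  have [measurable]: "B i \<in> sets M" for i unfolding B_def by (intro borel_Int_disk) simp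
  have "(\<integral>\<^sup>+ z. ennreal (((1 - cmod w) / cmod (1 - cnj w * z)) powr N) * g z \<partial>M)
     \<le> (\<integral>\<^sup>+ z. (\<Sum>i. ennreal (2 powr N * (2 powr - N) ^ i) * (g z * indicator (B i) z)) \<partial>M)"
  proof (intro nn_integral_mono)
    fix z assume "z \<in> space M"
    then have z: "cmod z < 1" by (simp add: space_M)
    obtain i :: nat where i: "z \<in> B i" "((1 - cmod w) / cmod (1 - cnj w * z)) powr N \<le> 2 powr N * (2 powr - N) ^ i"
      using kernel_dyadic_bound[OF w \<zeta> z N] z by (auto simp: B_def)
    have "ennreal (((1 - cmod w) / cmod (1 - cnj w * z)) powr N) * g z \<le> ennreal (2 powr N * (2 powr - N) ^ i) * (g z * indicator (B i) z)"
      using i by (auto intro!: mult_right_mono ennreal_leI)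
    also have "\<dots> = (\<Sum>i\<in>{i}. ennreal (2 powr N * (2 powr - N) ^ i) * (g z * indicator (B i) z))" by simp
    also have "\<dots> \<le> (\<Sum>i. ennreal (2 powr N * (2 powr - N) ^ i) * (g z * indicator (B i) z))"
      by (intro sum_le_suminf) auto
    finally show "ennreal (((1 - cmod w) / cmod (1 - cnj w * z)) powr N) * g z
       \<le> (\<Sum>i. ennreal (2 powr N * (2 powr - N) ^ i) * (g z * indicator (B i) z))" .
  qed
  also have "\<dots> = (\<Sum>i. \<integral>\<^sup>+ z. ennreal (2 powr N * (2 powr - N) ^ i) * (g z * indicator (B i) z) \<partial>M)"
    by (intro nn_integral_suminf) measurable
  also have "\<dots> = (\<Sum>i. ennreal (2 powr N * (2 powr - N) ^ i) * (\<integral>\<^sup>+ z. g z * indicator (B i) z \<partial>M))"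
    by (intro suminf_cong nn_integral_cmult) measurable
  finally show ?thesis by (simp add: B_def)
qed

text \<open>The decay of the kernel beats the growth of the masses of the dyadic disks.\<close>

lemma geometric_cap_sum:
  assumes h: "0 < h" and q: "2 powr - N * cap_const < 1" and c: "0 \<le> c"
  shows "(\<Sum>i. ennreal (2 powr N * (2 powr - N) ^ i) * ennreal (c * cap (2 ^ (i + 1) * h)))
     \<le> ennreal (c * (2 powr N * cap_const / (1 - 2 powr - N * cap_const)) * cap h)"
proof -
  define q where "q = 2 powr - N * cap_const"
  have q01: "0 \<le> q" "q < 1" using q cap_const_ge by (auto simp: q_def)
  define D where "D = c * (2 powr N * cap_const) * cap h"
  have D: "0 \<le> D" using c cap_const_ge by (simp add: D_def)
  have sm: "(\<lambda>i. D * q ^ i) sums (D * (1 / (1 - q)))"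
    using q01 by (intro sums_mult geometric_sums) auto
  have "(\<Sum>i. ennreal (2 powr N * (2 powr - N) ^ i) * ennreal (c * cap (2 ^ (i + 1) * h))) \<le> (\<Sum>i. ennreal (D * q ^ i))"
  proof (intro suminf_le)
    fix i
    have "2 powr N * (2 powr - N) ^ i * (c * cap (2 ^ (i + 1) * h)) \<le> 2 powr N * (2 powr - N) ^ i * (c * (cap_const ^ (i + 1) * cap h))"
      using h c by (intro mult_left_mono cap_iterate) auto
    also have "\<dots> = D * q ^ i" by (simp add: D_def q_def power_mult_distrib mult_ac)
    finally show "ennreal (2 powr N * (2 powr - N) ^ i) * ennreal (c * cap (2 ^ (i + 1) * h)) \<le> ennreal (D * q ^ i)"
      using c by (simp add: ennreal_mult[symmetric] ennreal_leI)
  qed auto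
  also have "\<dots> = ennreal (D * (1 / (1 - q)))"
    using sm D q01 by (subst suminf_ennreal2) (auto simp: sums_iff)
  finally show ?thesis by (simp add: D_def q_def mult_ac)
qed

text \<open>The norm of the test functions, before normalization.\<close>

lemma kernel_power_integral:
  assumes N: "log 2 cap_const < N"
  shows "\<exists>C>0. \<forall>a. cmod a < 1 \<longrightarrow>
     (\<integral>\<^sup>+ z. ennreal (((1 - (cmod a)\<^sup>2) / cmod (1 - cnj a * z)) powr N) \<partial>M) \<le> ennreal (C * cap (1 - cmod a))"
proof -
  have N0: "0 < N" using N cap_const_ge by (smt (verit) zero_le_log_cancel_iff)
  have q: "2 powr - N * cap_const < 1"
  proof -
    have "cap_const < 2 powr N" using N cap_const_ge by (simp add: log_less_iff)
    then show ?thesis by (simp add: powr_minus divide_simps)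
  qed
  define C0 where "C0 = 2 powr N * cap_const / (1 - 2 powr - N * cap_const)"
  have C0: "0 < C0" using q cap_const_ge by (simp add: C0_def)
  show ?thesis
  proof (intro exI[of _ "2 powr N * C0"] conjI allI impI)
    show "0 < 2 powr N * C0" using C0 by simp
    fix a :: complex assume a: "cmod a < 1"
    define h where "h = 1 - cmod a"
    have h: "0 < h" using a by (simp add: h_def)
    obtain \<zeta> where \<zeta>: "cmod \<zeta> = 1" "a = of_real (cmod a) * \<zeta>" using exists_radial_projection by blast
    have "(\<integral>\<^sup>+ z. ennreal (((1 - (cmod a)\<^sup>2) / cmod (1 - cnj a * z)) powr N) \<partial>M)
       \<le> (\<integral>\<^sup>+ z. ennreal (2 powr N) * (ennreal ((h / cmod (1 - cnj a * z)) powr N) * 1) \<partial>M)"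
    proof (intro nn_integral_mono)
      fix z
      have "1 - (cmod a)\<^sup>2 = (1 + cmod a) * h" by (simp add: h_def power2_eq_square algebra_simps)
      also have "\<dots> \<le> 2 * h" using a h by (intro mult_right_mono) auto
      finally have "(1 - (cmod a)\<^sup>2) / cmod (1 - cnj a * z) \<le> 2 * (h / cmod (1 - cnj a * z))"
        by (simp add: divide_right_mono)
      moreover have "0 \<le> 1 - (cmod a)\<^sup>2" using a by (simp add: abs_square_le_1)
      ultimately have "((1 - (cmod a)\<^sup>2) / cmod (1 - cnj a * z)) powr N \<le> (2 * (h / cmod (1 - cnj a * z))) powr N"
        using N0 by (intro powr_mono2) auto
      also have "\<dots> = 2 powr N * (h / cmod (1 - cnj a * z)) powr N" by (rule powr_mult)
      finally show "ennreal (((1 - (cmod a)\<^sup>2) / cmod (1 - cnj a * z)) powr N)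
         \<le> ennreal (2 powr N) * (ennreal ((h / cmod (1 - cnj a * z)) powr N) * 1)"
        by (simp add: ennreal_mult[symmetric] ennreal_leI)
    qed
    also have "\<dots> = ennreal (2 powr N) * (\<integral>\<^sup>+ z. ennreal ((h / cmod (1 - cnj a * z)) powr N) * 1 \<partial>M)"
    proof (rule nn_integral_cmult)
      have [measurable]: "(\<lambda>z. cmod (1 - cnj a * z)) \<in> borel_measurable M" by (rule kernel_measurable)
      show "(\<lambda>z. ennreal ((h / cmod (1 - cnj a * z)) powr N) * 1) \<in> borel_measurable M"
        unfolding mult_1_right by measurable
    qed
    also have "(\<integral>\<^sup>+ z. ennreal ((h / cmod (1 - cnj a * z)) powr N) * 1 \<partial>M)
       \<le> (\<Sum>i. ennreal (2 powr N * (2 powr - N) ^ i) *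
         (\<integral>\<^sup>+ z. 1 * indicator (ball \<zeta> (2 ^ (i + 1) * (1 - cmod a)) \<inter> unit_disk) z \<partial>M))"
      unfolding h_def by (rule kernel_integral_le[OF a \<zeta>]) (use N0 in auto)
    also have "\<dots> = (\<Sum>i. ennreal (2 powr N * (2 powr - N) ^ i) * ennreal (1 * cap (2 ^ (i + 1) * h)))"
    proof (intro suminf_cong arg_cong2[where f = "(*)"] refl)
      fix i :: nat
      have "ball \<zeta> (2 ^ (i + 1) * (1 - cmod a)) \<inter> unit_disk \<in> sets M" by (intro borel_Int_disk) simp
      then show "(\<integral>\<^sup>+ z. 1 * indicator (ball \<zeta> (2 ^ (i + 1) * (1 - cmod a)) \<inter> unit_disk) z \<partial>M) = ennreal (1 * cap (2 ^ (i + 1) * h))"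
        using emeasure_ball_eq_cap[OF \<zeta>(1)] by (simp add: h_def)
    qed
    also have "\<dots> \<le> ennreal (1 * C0 * cap h)"
      unfolding C0_def by (rule geometric_cap_sum) (use h N0 q in auto)
    finally show "(\<integral>\<^sup>+ z. ennreal (((1 - (cmod a)\<^sup>2) / cmod (1 - cnj a * z)) powr N) \<partial>M) \<le> ennreal (2 powr N * C0 * cap (1 - cmod a))"
      using C0 by (simp add: h_def[symmetric] ennreal_mult mult_left_mono mult.assoc)
  qed
qed

text \<open>If the averages of \<open>\<bar>f\<bar>\<^sup>\<alpha>\<close> over all dyadic disks about the projection of \<open>w\<close> were less than \<open>l\<close>, then
  summing over these disks with the weights of the kernel would bound \<open>\<bar>f(w)\<bar>\<^sup>\<alpha>\<close> by a multiple of \<open>l\<close>. The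
  bound \<open>3\<close> on the radius, beyond which the disk contains the whole unit disk, makes the covering lemma
  applicable.\<close>

lemma large_value_gives_heavy_ball:
  assumes \<alpha>: "0 < \<alpha>"
  shows "\<exists>C>0. \<forall>f w l. f holomorphic_on unit_disk \<and> cmod w < 1 \<and> 0 < l \<and> C * l < cmod (f w) powr \<alpha> \<longrightarrow>
     (\<exists>\<zeta> \<delta>. cmod \<zeta> = 1 \<and> 0 < \<delta> \<and> \<delta> \<le> 3 \<and> w \<in> ball \<zeta> \<delta> \<and>
        ennreal (l * cap \<delta>) \<le> (\<integral>\<^sup>+ z. ennreal (cmod (f z) powr \<alpha>) * indicator (ball \<zeta> \<delta> \<inter> unit_disk) z \<partial>M))"
proof -
  \<comment> \<open>The exponent of the kernel is chosen such that its decay leaves a factor \<open>1 / 2\<close> from each dyadic disk to the next.\<close>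
  obtain N :: nat where N: "2 * cap_const < 2 ^ N" using real_arch_pow[of 2 "2 * cap_const"] by auto
  have q: "2 powr - real N * cap_const \<le> 1 / 2"
    using N cap_const_ge by (simp add: powr_minus powr_realpow divide_simps)
  define C where "C = 2 * 2 ^ N * (2 * 2 ^ N * cap_const) * (12 * Cw)"
  have C: "0 < C" using cap_const_ge Cw_ge_1 by (simp add: C_def)
  show ?thesis
  proof (intro exI[of _ C] conjI allI impI C)
    fix f :: "complex \<Rightarrow> complex" and w :: complex and l :: real
    assume A: "f holomorphic_on unit_disk \<and> cmod w < 1 \<and> 0 < l \<and> C * l < cmod (f w) powr \<alpha>"
    then have f: "f holomorphic_on unit_disk" and w: "cmod w < 1" and l: "0 < l" and big: "C * l < cmod (f w) powr \<alpha>" by auto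
    define h where "h = 1 - cmod w"
    have h: "0 < h" "h \<le> 1" using w by (auto simp: h_def)
    obtain \<zeta> where \<zeta>: "cmod \<zeta> = 1" "w = of_real (cmod w) * \<zeta>" using exists_radial_projection by blast
    define g where "g = (\<lambda>z. ennreal (cmod (f z) powr \<alpha>))"
    have [measurable]: "g \<in> borel_measurable M" using holomorphic_measurable[OF f] unfolding g_def by measurable
    have th: "0 < tail (h / 2)" using tail_pos[of "h / 2"] h by (simp add: tail_def)
    have "\<exists>i::nat. ennreal (l * cap (2 ^ (i + 1) * h)) \<le> (\<integral>\<^sup>+ z. g z * indicator (ball \<zeta> (2 ^ (i + 1) * h) \<inter> unit_disk) z \<partial>M)"
    proof (rule ccontr)
      assume "\<not> ?thesis"
      then have small: "(\<integral>\<^sup>+ z. g z * indicator (ball \<zeta> (2 ^ (i + 1) * h) \<inter> unit_disk) z \<partial>M) \<le> ennreal (l * cap (2 ^ (i + 1) * h))" for i :: nat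
        by (meson nle_le)
      have "(\<integral>\<^sup>+ z. ennreal ((h / cmod (1 - cnj w * z)) ^ N) * g z \<partial>M) = (\<integral>\<^sup>+ z. ennreal ((h / cmod (1 - cnj w * z)) powr real N) * g z \<partial>M)"
      proof (intro nn_integral_cong)
        fix z assume "z \<in> space M"
        then have "0 < h / cmod (1 - cnj w * z)" using kernel_denominator_ge(3)[OF w \<zeta>, of z] h by (simp add: space_M)
        then show "ennreal ((h / cmod (1 - cnj w * z)) ^ N) * g z = ennreal ((h / cmod (1 - cnj w * z)) powr real N) * g z"
          by (simp only: powr_realpow)
      qed
      also have "\<dots> \<le> (\<Sum>i. ennreal (2 powr real N * (2 powr - real N) ^ i) *
         (\<integral>\<^sup>+ z. g z * indicator (ball \<zeta> (2 ^ (i + 1) * (1 - cmod w)) \<inter> unit_disk) z \<partial>M))"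
        unfolding h_def by (rule kernel_integral_le[OF w \<zeta>]) auto
      also have "\<dots> \<le> (\<Sum>i. ennreal (2 powr real N * (2 powr - real N) ^ i) * ennreal (l * cap (2 ^ (i + 1) * h)))"
        by (intro suminf_le mult_left_mono) (use small in \<open>auto simp: h_def\<close>)
      also have "\<dots> \<le> ennreal (l * (2 powr real N * cap_const / (1 - 2 powr - real N * cap_const)) * cap h)"
        by (rule geometric_cap_sum) (use q h l in auto)
      also have "\<dots> \<le> ennreal (l * (2 * 2 ^ N * cap_const) * cap h)"
      proof (intro ennreal_leI mult_right_mono mult_left_mono)
        have "2 powr real N * cap_const / (1 - 2 powr - real N * cap_const) \<le> 2 powr real N * cap_const / (1 / 2)"
          using q cap_const_ge by (intro divide_left_mono) auto
        then show "2 powr real N * cap_const / (1 - 2 powr - real N * cap_const) \<le> 2 * 2 ^ N * cap_const"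
          by (simp add: powr_realpow)
      qed (use l in auto)
      finally have "ennreal (2 / h * 2 ^ N) * (\<integral>\<^sup>+ z. ennreal ((h / cmod (1 - cnj w * z)) ^ N) * g z \<partial>M)
          \<le> ennreal (2 / h * 2 ^ N) * ennreal (l * (2 * 2 ^ N * cap_const) * cap h)"
        by (rule mult_left_mono) simp
      then have "ennreal (cmod (f w) powr \<alpha> * tail (h / 2)) \<le> ennreal (2 / h * 2 ^ N) * ennreal (l * (2 * 2 ^ N * cap_const) * cap h)"
        using point_estimate_kernel[OF f \<alpha> w, of N] unfolding h_def[symmetric] g_def by (rule order_trans[rotated])
      also have "\<dots> = ennreal (2 / h * 2 ^ N * (l * (2 * 2 ^ N * cap_const) * cap h))"
        using h l cap_const_ge by (intro ennreal_mult[symmetric]) auto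
      finally have "cmod (f w) powr \<alpha> * tail (h / 2) \<le> 2 / h * 2 ^ N * (l * (2 * 2 ^ N * cap_const) * cap h)"
        using h l cap_const_ge by (subst (asm) ennreal_le_iff) auto
      also have "\<dots> \<le> 2 / h * 2 ^ N * (l * (2 * 2 ^ N * cap_const) * (12 * Cw * h * tail (h / 2)))"
        using h l cap_const_ge by (intro mult_left_mono tail_ge_cap) auto
      also have "\<dots> = C * l * tail (h / 2)" using h by (simp add: C_def field_simps)
      finally have "cmod (f w) powr \<alpha> \<le> C * l" using th by (rule mult_right_le_imp_le)
      then show False using big by simp
    qed
    then obtain i :: nat where i: "ennreal (l * cap (2 ^ (i + 1) * h)) \<le> (\<integral>\<^sup>+ z. g z * indicator (ball \<zeta> (2 ^ (i + 1) * h) \<inter> unit_disk) z \<partial>M)" by blast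
    define \<delta> where "\<delta> = min (2 ^ (i + 1) * h) 3"
    show "\<exists>\<zeta> \<delta>. cmod \<zeta> = 1 \<and> 0 < \<delta> \<and> \<delta> \<le> 3 \<and> w \<in> ball \<zeta> \<delta> \<and>
        ennreal (l * cap \<delta>) \<le> (\<integral>\<^sup>+ z. ennreal (cmod (f z) powr \<alpha>) * indicator (ball \<zeta> \<delta> \<inter> unit_disk) z \<partial>M)"
    proof (intro exI[of _ \<zeta>] exI[of _ \<delta>] conjI)
      have "\<zeta> - w = of_real (1 - cmod w) * \<zeta>" using \<zeta>(2) by (simp add: algebra_simps)
      then have "cmod (\<zeta> - w) = \<bar>1 - cmod w\<bar> * cmod \<zeta>" by (metis norm_mult norm_of_real)
      then have "dist \<zeta> w = h" using w \<zeta>(1) by (simp add: dist_norm h_def)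
      moreover have "h < 2 ^ (i + 1) * h"
      proof -
        have "(1::real) < 2 ^ (i + 1)" by (rule one_less_power) auto
        then show ?thesis using h by simp
      qed
      ultimately show "w \<in> ball \<zeta> \<delta>" using h by (simp add: \<delta>_def)
      have "ball \<zeta> (2 ^ (i + 1) * h) \<inter> unit_disk \<subseteq> ball \<zeta> \<delta> \<inter> unit_disk"
      proof -
        have "unit_disk \<subseteq> ball \<zeta> 3"
        proof
          fix z assume "z \<in> unit_disk"
          then show "z \<in> ball \<zeta> 3" using norm_triangle_ineq4[of \<zeta> z] \<zeta>(1) by (simp add: dist_norm)
        qed
        then show ?thesis by (auto simp: \<delta>_def)
      qed
      then have "(\<integral>\<^sup>+ z. g z * indicator (ball \<zeta> (2 ^ (i + 1) * h) \<inter> unit_disk) z \<partial>M) \<le> (\<integral>\<^sup>+ z. g z * indicator (ball \<zeta> \<delta> \<inter> unit_disk) z \<partial>M)"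
        by (intro nn_integral_mono mult_left_mono) (auto simp: indicator_def)
      moreover have "ennreal (l * cap \<delta>) \<le> ennreal (l * cap (2 ^ (i + 1) * h))"
        using l by (intro ennreal_leI mult_left_mono cap_mono) (auto simp: \<delta>_def)
      ultimately show "ennreal (l * cap \<delta>) \<le> (\<integral>\<^sup>+ z. ennreal (cmod (f z) powr \<alpha>) * indicator (ball \<zeta> \<delta> \<inter> unit_disk) z \<partial>M)"
        using i unfolding g_def by (meson order_trans)
    qed (use \<zeta> h in \<open>auto simp: \<delta>_def\<close>)
  qed
qed

lemma point_estimate:
  assumes f: "f holomorphic_on unit_disk" and p: "0 < p" and w: "cmod w \<le> r" and r: "r < 1"
    and I: "(\<integral>\<^sup>+ z. ennreal (cmod (f z) powr p) \<partial>M) \<le> ennreal I" "0 \<le> I"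
  shows "cmod (f w) powr p \<le> 2 / ((1 - r) * tail ((1 - r) / 2)) * I"
proof -
  have w1: "cmod w < 1" and r0: "0 \<le> r" using w r norm_ge_zero[of w] by linarith+
  have t: "0 < tail ((1 - r) / 2)" using tail_pos[of "(1 - r) / 2"] r r0 by (simp add: tail_def)
  have "ennreal (cmod (f w) powr p * tail ((1 - cmod w) / 2)) \<le> ennreal (2 / (1 - cmod w)) * (\<integral>\<^sup>+ z. ennreal (cmod (f z) powr p) \<partial>M)"
    using point_estimate_kernel[OF f p w1, of 0] by simp
  also have "\<dots> \<le> ennreal (2 / (1 - cmod w)) * ennreal I" by (rule mult_left_mono[OF I(1)]) simp
  also have "\<dots> = ennreal (2 / (1 - cmod w) * I)" using w1 I(2) by (intro ennreal_mult[symmetric]) auto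
  finally have "cmod (f w) powr p * tail ((1 - cmod w) / 2) \<le> 2 / (1 - cmod w) * I"
    using w1 I(2) by (subst (asm) ennreal_le_iff) auto
  also have "\<dots> \<le> 2 / (1 - r) * I" using w r I(2) by (intro mult_right_mono divide_left_mono) auto
  finally have "cmod (f w) powr p * tail ((1 - cmod w) / 2) \<le> 2 / (1 - r) * I" .
  moreover have "cmod (f w) powr p * tail ((1 - r) / 2) \<le> cmod (f w) powr p * tail ((1 - cmod w) / 2)"
    using w by (intro mult_left_mono tail_mono) auto
  ultimately have "cmod (f w) powr p * tail ((1 - r) / 2) \<le> 2 / (1 - r) * I" by linarith
  then show ?thesis using t r by (simp add: field_simps)
qed

end

section \<open>The Carleson embedding\<close>

lemma emeasure_UN_le_nn_integral_count_space:
  assumes C: "countable C" and X: "\<And>i. i \<in> C \<Longrightarrow> X i \<in> sets N"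
  shows "emeasure N (\<Union>i\<in>C. X i) \<le> (\<integral>\<^sup>+ i. emeasure N (X i) \<partial>count_space C)"
proof -
  have U: "(\<Union>i\<in>C. X i) \<in> sets N" using C X by (intro sets.countable_UN') auto
  have "emeasure N (\<Union>i\<in>C. X i) = (\<integral>\<^sup>+ x. indicator (\<Union>i\<in>C. X i) x \<partial>N)" using U by simp
  also have "\<dots> \<le> (\<integral>\<^sup>+ x. (\<integral>\<^sup>+ i. indicator (X i) x \<partial>count_space C) \<partial>N)"
  proof (intro nn_integral_mono)
    fix x
    show "indicator (\<Union>i\<in>C. X i) x \<le> (\<integral>\<^sup>+ i. indicator (X i) x \<partial>count_space C)"
    proof (cases "x \<in> (\<Union>i\<in>C. X i)")
      case True
      then obtain i where i: "i \<in> C" "x \<in> X i" by blast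
      have "indicator (X i) x \<le> (\<integral>\<^sup>+ i. indicator (X i) x \<partial>count_space C)"
        by (rule nn_integral_ge_point[OF i(1)])
      then show ?thesis using True i by simp
    qed simp
  qed
  also have "\<dots> = (\<integral>\<^sup>+ i. (\<integral>\<^sup>+ x. indicator (X i) x \<partial>N) \<partial>count_space C)"
    by (rule nn_integral_count_space_nn_integral[OF C]) (use X in auto)
  also have "\<dots> = (\<integral>\<^sup>+ i. emeasure N (X i) \<partial>count_space C)"
    by (intro nn_integral_cong) (use X in auto)
  finally show ?thesis .
qed

text \<open>A crude layer cake formula: already the levels between \<open>x / 2\<close> and \<open>x\<close> contribute enough.\<close>

lemma powr_le_tail_integral:
  fixes x t :: real
  assumes "0 \<le> x" "1 \<le> t"
  shows "ennreal (x powr t) \<le> ennreal (2 powr t) * (\<integral>\<^sup>+ l. ennreal (l powr (t - 1)) * indicator {0<..<x} l \<partial>lborel)"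
proof (cases "x = 0")
  case False
  then have x: "0 < x" using assms by simp
  have "ennreal (x powr t) = ennreal (2 powr t) * ennreal ((x / 2) powr (t - 1) * (x / 2))"
  proof -
    have "(x / 2) powr (t - 1) * (x / 2) = (x / 2) powr t"
      using x powr_add[of "x / 2" "t - 1" 1] by simp
    then have "2 powr t * ((x / 2) powr (t - 1) * (x / 2)) = (2 * (x / 2)) powr t"
      using powr_mult[of 2 "x / 2" t] by simp
    then have "x powr t = 2 powr t * ((x / 2) powr (t - 1) * (x / 2))" by simp
    then show ?thesis using x by (simp only: ennreal_mult[symmetric] powr_ge_zero) (simp add: ennreal_mult[symmetric])
  qed
  also have "ennreal ((x / 2) powr (t - 1) * (x / 2)) = (\<integral>\<^sup>+ l. ennreal ((x / 2) powr (t - 1)) * indicator {x / 2<..<x} l \<partial>lborel)"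
  proof -
    have "emeasure lborel {x / 2<..<x} = ennreal (x / 2)" using x by simp
    then show ?thesis
      by (simp only: nn_integral_cmult_indicator sets_lborel borel_open open_greaterThanLessThan
          ennreal_mult'[OF powr_ge_zero])
  qed
  also have "\<dots> \<le> (\<integral>\<^sup>+ l. ennreal (l powr (t - 1)) * indicator {0<..<x} l \<partial>lborel)"
    using x assms by (intro nn_integral_mono) (auto simp: indicator_def intro!: ennreal_leI powr_mono2)
  finally show ?thesis by (simp add: mult_left_mono)
qed simp

context radial_doubling
begin

lemma cap_quintuple: "0 < \<delta> \<Longrightarrow> cap (5 * \<delta>) \<le> cap_const ^ 3 * cap \<delta>"
  using cap_iterate[of \<delta> 3] cap_mono[of "5 * \<delta>" "8 * \<delta>"] by simp

text \<open>Vitali's covering lemma combined with a Carleson condition on the five times enlarged disks. Because \<open>s \<ge> 1\<close>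
  and the masses are at most \<open>m\<close>, the power \<open>s\<close> of a mass is at most \<open>m powr (s - 1)\<close> times that mass, so that
  the estimate becomes linear in the masses of disjoint sets.\<close>

lemma vitali_cap_sum:
  assumes \<nu>: "sets \<nu> = sets M" and s: "1 \<le> s" and \<kappa>: "0 \<le> \<kappa>" and m: "0 < m"
    and K: "\<And>\<zeta> \<delta>. (\<zeta>, \<delta>) \<in> K \<Longrightarrow> cmod \<zeta> = 1 \<and> 0 < \<delta> \<and> \<delta> \<le> 3 \<and> cap \<delta> \<le> m \<and>
       emeasure \<nu> (ball \<zeta> (5 * \<delta>) \<inter> unit_disk) \<le> ennreal (\<kappa> * cap (5 * \<delta>) powr s)"
    and S: "S \<subseteq> unit_disk" "S \<subseteq> (\<Union>(\<zeta>, \<delta>)\<in>K. ball \<zeta> \<delta>)"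
  obtains C where "countable C" "C \<subseteq> K"
    "disjoint_family_on (\<lambda>(\<zeta>, \<delta>). ball \<zeta> \<delta> \<inter> unit_disk) C"
    "emeasure \<nu> S \<le> ennreal (\<kappa> * (cap_const ^ 3) powr s * m powr (s - 1)) *
       (\<integral>\<^sup>+ i. emeasure M ((\<lambda>(\<zeta>, \<delta>). ball \<zeta> \<delta> \<inter> unit_disk) i) \<partial>count_space C)"
proof -
  have S': "S \<subseteq> (\<Union>i\<in>K. ball (fst i) (snd i))" using S(2) by (simp add: case_prod_unfold)
  have r: "0 < snd i \<and> snd i \<le> 3" if "i \<in> K" for i using K[of "fst i" "snd i"] that by simp
  obtain C where C: "countable C" "C \<subseteq> K"
     "pairwise (\<lambda>i j. disjnt (ball (fst i) (snd i)) (ball (fst j) (snd j))) C"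
     "S \<subseteq> (\<Union>i\<in>C. ball (fst i) (5 * snd i))"
    using Vitali_covering_lemma_balls[OF S' r] by blast
  have disj: "disjoint_family_on (\<lambda>(\<zeta>, \<delta>). ball \<zeta> \<delta> \<inter> unit_disk) C"
    using C(3) unfolding disjoint_family_on_def pairwise_def disjnt_def case_prod_unfold by blast
  have bs: "ball a b \<inter> unit_disk \<in> sets \<nu>" for a b unfolding \<nu> by (intro borel_Int_disk) simp
  define c where "c = \<kappa> * (cap_const ^ 3) powr s * m powr (s - 1)"
  have c0: "0 \<le> c" using \<kappa> by (simp add: c_def)
  have each: "emeasure \<nu> (ball (fst i) (5 * snd i) \<inter> unit_disk) \<le> ennreal c * emeasure M (ball (fst i) (snd i) \<inter> unit_disk)"
    if "i \<in> C" for i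
  proof -
    obtain \<zeta> \<delta> where i: "i = (\<zeta>, \<delta>)" by (cases i)
    have k: "cmod \<zeta> = 1" "0 < \<delta>" "cap \<delta> \<le> m" 
       "emeasure \<nu> (ball \<zeta> (5 * \<delta>) \<inter> unit_disk) \<le> ennreal (\<kappa> * cap (5 * \<delta>) powr s)"
      using K[of \<zeta> \<delta>] that i C(2) by auto
    have cp: "0 < cap \<delta>" using k by (intro cap_pos)
    have "cap (5 * \<delta>) powr s \<le> (cap_const ^ 3 * cap \<delta>) powr s"
      using cap_quintuple[OF k(2)] s by (intro powr_mono2) auto
    also have "\<dots> = (cap_const ^ 3) powr s * (cap \<delta> powr (s - 1) * cap \<delta>)"
      using cp powr_add[of "cap \<delta>" "s - 1" 1] by (simp add: powr_mult)
    also have "\<dots> \<le> (cap_const ^ 3) powr s * (m powr (s - 1) * cap \<delta>)"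
      using k s by (intro mult_left_mono mult_right_mono powr_mono2) auto
    finally have "\<kappa> * cap (5 * \<delta>) powr s \<le> \<kappa> * ((cap_const ^ 3) powr s * (m powr (s - 1) * cap \<delta>))"
      using \<kappa> by (rule mult_left_mono)
    then have "\<kappa> * cap (5 * \<delta>) powr s \<le> c * cap \<delta>" by (simp add: c_def mult_ac)
    then have "emeasure \<nu> (ball \<zeta> (5 * \<delta>) \<inter> unit_disk) \<le> ennreal (c * cap \<delta>)"
      using k(4) by (meson ennreal_leI order_trans)
    then show ?thesis using c0 by (simp add: i emeasure_ball_eq_cap[OF k(1)] ennreal_mult)
  qed
  have "emeasure \<nu> S \<le> emeasure \<nu> (\<Union>i\<in>C. ball (fst i) (5 * snd i) \<inter> unit_disk)"
    using C(1,4) S(1) bs by (intro emeasure_mono sets.countable_UN') auto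
  also have "\<dots> \<le> (\<integral>\<^sup>+ i. emeasure \<nu> (ball (fst i) (5 * snd i) \<inter> unit_disk) \<partial>count_space C)"
    by (rule emeasure_UN_le_nn_integral_count_space[OF C(1) bs])
  also have "\<dots> \<le> (\<integral>\<^sup>+ i. ennreal c * emeasure M (ball (fst i) (snd i) \<inter> unit_disk) \<partial>count_space C)"
    by (intro nn_integral_mono) (use each in auto)
  also have "\<dots> = ennreal c * (\<integral>\<^sup>+ i. emeasure M (ball (fst i) (snd i) \<inter> unit_disk) \<partial>count_space C)"
    by (rule nn_integral_cmult) simp
  finally have "emeasure \<nu> S \<le> ennreal c * (\<integral>\<^sup>+ i. emeasure M ((\<lambda>(\<zeta>, \<delta>). ball \<zeta> \<delta> \<inter> unit_disk) i) \<partial>count_space C)"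
    by (simp add: case_prod_beta')
  then show ?thesis using that[OF C(1,2) disj] by (simp add: c_def)
qed

text \<open>A measure that charges only a thin annulus at the boundary is covered by small disks. Their disjoint
  subfamily lies in the disk of twice the radius, which sums the small bounds to the large one.\<close>

lemma carleson_small_to_all:
  assumes \<nu>: "sets \<nu> = sets M" and s: "1 \<le> s" and \<kappa>: "0 \<le> \<kappa>" and \<delta>0: "0 < \<delta>0" "\<delta>0 \<le> 1"
    and small: "\<And>\<zeta> \<delta>. cmod \<zeta> = 1 \<Longrightarrow> 0 < \<delta> \<Longrightarrow> \<delta> \<le> \<delta>0 \<Longrightarrow>
       emeasure \<nu> (ball \<zeta> \<delta> \<inter> unit_disk) \<le> ennreal (\<kappa> * cap \<delta> powr s)"
    and conc: "emeasure \<nu> {w\<in>unit_disk. cmod w \<le> 1 - \<delta>0 / 5} = 0"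
    and \<zeta>: "cmod \<zeta> = 1" and \<delta>: "0 < \<delta>"
  shows "emeasure \<nu> (ball \<zeta> \<delta> \<inter> unit_disk) \<le> ennreal (\<kappa> * (cap_const ^ 4) powr s * cap \<delta> powr s)"
proof (cases "\<delta> \<le> \<delta>0")
  case True
  have "1 \<le> (cap_const ^ 4) powr s"
    using cap_const_ge s by (intro ge_one_powr_ge_zero one_le_power) auto
  then have "\<kappa> * 1 * cap \<delta> powr s \<le> \<kappa> * (cap_const ^ 4) powr s * cap \<delta> powr s"
    using \<kappa> by (intro mult_right_mono mult_left_mono) auto
  then show ?thesis using small[OF \<zeta> \<delta> True] by (metis ennreal_leI mult.right_neutral order_trans)
next
  case False
  define S where "S = ball \<zeta> \<delta> \<inter> {w\<in>unit_disk. 1 - \<delta>0 / 5 < cmod w}"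
  define \<rho> where "\<rho> = \<delta>0 / 5"
  have \<rho>: "0 < \<rho>" "\<rho> \<le> 3" "5 * \<rho> = \<delta>0" using \<delta>0 by (auto simp: \<rho>_def)
  define K where "K = {(\<zeta>', \<delta>'). cmod \<zeta>' = 1 \<and> \<delta>' = \<rho> \<and> cmod (\<zeta>' - \<zeta>) < \<delta> + \<rho>}"
  have sub: "S \<subseteq> (\<Union>(\<zeta>', \<delta>')\<in>K. ball \<zeta>' \<delta>')"
  proof
    fix w assume w: "w \<in> S"
    obtain \<zeta>' where z: "cmod \<zeta>' = 1" "w = of_real (cmod w) * \<zeta>'" using exists_radial_projection by blast
    have "\<zeta>' - w = of_real (1 - cmod w) * \<zeta>'" using z(2) by (simp add: algebra_simps)
    then have "cmod (\<zeta>' - w) = \<bar>1 - cmod w\<bar> * cmod \<zeta>'" by (metis norm_mult norm_of_real)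
    then have d: "cmod (\<zeta>' - w) < \<rho>" using w z(1) by (auto simp: S_def \<rho>_def)
    moreover have "cmod (\<zeta>' - \<zeta>) \<le> cmod (\<zeta>' - w) + cmod (\<zeta> - w)"
      using dist_triangle2[of \<zeta>' \<zeta> w] by (simp add: dist_norm)
    moreover have "cmod (\<zeta> - w) < \<delta>" using w by (auto simp: S_def dist_norm)
    ultimately have "(\<zeta>', \<rho>) \<in> K" using z by (simp add: K_def)
    then show "w \<in> (\<Union>(\<zeta>', \<delta>')\<in>K. ball \<zeta>' \<delta>')" using d by (force simp: dist_norm)
  qed
  have K: "cmod \<zeta>' = 1 \<and> 0 < \<delta>' \<and> \<delta>' \<le> 3 \<and> cap \<delta>' \<le> cap (2 * \<delta>) \<and>
       emeasure \<nu> (ball \<zeta>' (5 * \<delta>') \<inter> unit_disk) \<le> ennreal (\<kappa> * cap (5 * \<delta>') powr s)"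
    if "(\<zeta>', \<delta>') \<in> K" for \<zeta>' \<delta>'
    using that \<rho> small[of \<zeta>' \<delta>0] \<delta>0 False cap_mono[of \<rho> "2 * \<delta>"] by (auto simp: K_def)
  have Sd: "S \<subseteq> unit_disk" by (auto simp: S_def)
  have cp: "0 < cap (2 * \<delta>)" using \<delta> by (intro cap_pos) simp
  obtain C where C: "countable C" "C \<subseteq> K"
    "disjoint_family_on (\<lambda>(\<zeta>, \<delta>). ball \<zeta> \<delta> \<inter> unit_disk) C"
    "emeasure \<nu> S \<le> ennreal (\<kappa> * (cap_const ^ 3) powr s * cap (2 * \<delta>) powr (s - 1)) *
       (\<integral>\<^sup>+ i. emeasure M ((\<lambda>(\<zeta>, \<delta>). ball \<zeta> \<delta> \<inter> unit_disk) i) \<partial>count_space C)"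
    using vitali_cap_sum[OF \<nu> s \<kappa> cp K Sd sub] by blast
  have "(\<integral>\<^sup>+ i. emeasure M ((\<lambda>(\<zeta>, \<delta>). ball \<zeta> \<delta> \<inter> unit_disk) i) \<partial>count_space C)
     = emeasure M (\<Union>i\<in>C. (\<lambda>(\<zeta>, \<delta>). ball \<zeta> \<delta> \<inter> unit_disk) i)"
    by (rule emeasure_UN_countable[OF _ C(1) C(3), symmetric]) (auto intro!: borel_Int_disk)
  also have "\<dots> \<le> emeasure M (ball \<zeta> (2 * \<delta>) \<inter> unit_disk)"
  proof (rule emeasure_mono)
    show "(\<Union>i\<in>C. (\<lambda>(\<zeta>, \<delta>). ball \<zeta> \<delta> \<inter> unit_disk) i) \<subseteq> ball \<zeta> (2 * \<delta>) \<inter> unit_disk"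
    proof safe
      fix x \<zeta>' \<delta>' assume "(\<zeta>', \<delta>') \<in> C" "x \<in> ball \<zeta>' \<delta>'"
      then have "cmod (\<zeta>' - \<zeta>) < \<delta> + \<rho>" "dist \<zeta>' x < \<rho>" using C(2) by (auto simp: K_def)
      moreover have "dist \<zeta> x \<le> dist \<zeta>' \<zeta> + dist \<zeta>' x" by (metis dist_commute dist_triangle)
      ultimately show "x \<in> ball \<zeta> (2 * \<delta>)" using False \<rho> \<delta>0 by (simp add: dist_norm)
    qed
  qed (auto intro!: borel_Int_disk)
  also have "\<dots> = ennreal (cap (2 * \<delta>))" by (rule emeasure_ball_eq_cap[OF \<zeta>])
  finally have "emeasure \<nu> S \<le> ennreal (\<kappa> * (cap_const ^ 3) powr s * cap (2 * \<delta>) powr (s - 1)) * ennreal (cap (2 * \<delta>))"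
    using C(4) by (meson mult_left_mono order_trans zero_le)
  also have "\<dots> = ennreal (\<kappa> * (cap_const ^ 3) powr s * (cap (2 * \<delta>) powr (s - 1) * cap (2 * \<delta>)))"
    using \<kappa> by (simp add: ennreal_mult[symmetric] mult.assoc)
  also have "cap (2 * \<delta>) powr (s - 1) * cap (2 * \<delta>) = cap (2 * \<delta>) powr s"
    using cp powr_add[of "cap (2 * \<delta>)" "s - 1" 1] by simp
  also have "ennreal (\<kappa> * (cap_const ^ 3) powr s * cap (2 * \<delta>) powr s) \<le> ennreal (\<kappa> * (cap_const ^ 4) powr s * cap \<delta> powr s)"
  proof (rule ennreal_leI)
    have "cap (2 * \<delta>) powr s \<le> (cap_const * cap \<delta>) powr s"
      using cap_double[OF \<delta>] s by (intro powr_mono2) auto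
    then have "(cap_const ^ 3) powr s * cap (2 * \<delta>) powr s \<le> (cap_const ^ 3) powr s * (cap_const * cap \<delta>) powr s"
      by (intro mult_left_mono) auto
    also have "\<dots> = (cap_const ^ 4) powr s * cap \<delta> powr s"
      by (simp add: powr_mult[symmetric] eval_nat_numeral mult_ac)
    finally show "\<kappa> * (cap_const ^ 3) powr s * cap (2 * \<delta>) powr s \<le> \<kappa> * (cap_const ^ 4) powr s * cap \<delta> powr s"
      using \<kappa> by (simp add: mult.assoc mult_left_mono)
  qed
  finally have S: "emeasure \<nu> S \<le> ennreal (\<kappa> * (cap_const ^ 4) powr s * cap \<delta> powr s)" .
  have s1: "S \<in> sets \<nu>" "{w\<in>unit_disk. cmod w \<le> 1 - \<delta>0 / 5} \<in> sets \<nu>"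
  proof -
    have "{w. cmod w \<le> 1 - \<delta>0 / 5} \<inter> unit_disk \<in> sets \<nu>" unfolding \<nu> by (intro borel_Int_disk) measurable
    moreover have "{w. cmod w \<le> 1 - \<delta>0 / 5} \<inter> unit_disk = {w\<in>unit_disk. cmod w \<le> 1 - \<delta>0 / 5}" by auto
    ultimately show "{w\<in>unit_disk. cmod w \<le> 1 - \<delta>0 / 5} \<in> sets \<nu>" by simp
    have "(ball \<zeta> \<delta> \<inter> {w. 1 - \<delta>0 / 5 < cmod w}) \<inter> unit_disk \<in> sets \<nu>" unfolding \<nu> by (intro borel_Int_disk) measurable
    moreover have "(ball \<zeta> \<delta> \<inter> {w. 1 - \<delta>0 / 5 < cmod w}) \<inter> unit_disk = S" by (auto simp: S_def)
    ultimately show "S \<in> sets \<nu>" by simp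
  qed
  have "emeasure \<nu> (ball \<zeta> \<delta> \<inter> unit_disk) \<le> emeasure \<nu> (S \<union> {w\<in>unit_disk. cmod w \<le> 1 - \<delta>0 / 5})"
    by (rule emeasure_mono) (use s1 in \<open>auto simp: S_def\<close>)
  also have "\<dots> \<le> emeasure \<nu> S + emeasure \<nu> {w\<in>unit_disk. cmod w \<le> 1 - \<delta>0 / 5}"
    by (rule emeasure_subadditive) (use s1 in auto)
  also have "\<dots> = emeasure \<nu> S" using conc by simp
  finally show ?thesis using S by (rule order_trans)
qed

definition carleson_bound :: "complex measure \<Rightarrow> real \<Rightarrow> real \<Rightarrow> bool" where
  "carleson_bound \<nu> \<kappa> s \<longleftrightarrow> (\<forall>\<zeta> \<delta>. cmod \<zeta> = 1 \<and> 0 < \<delta> \<longrightarrow>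
     emeasure \<nu> (ball \<zeta> \<delta> \<inter> unit_disk) \<le> ennreal (\<kappa> * cap \<delta> powr s))"

text \<open>Every point where \<open>\<bar>f\<bar>\<^bsup>p/2\<^esup>\<close> is large lies in a disk with a large average, and the part of \<open>\<bar>f\<bar>\<^bsup>p/2\<^esup>\<close> below
  half the level contributes at most half of that average. Hence the mass of such a disk is controlled by
  the integral of the part above half the level; this integral is additive over the disjoint disks selected by
  Vitali's lemma, while the crude bound \<open>4 I / l\<^sup>2\<close> for each mass takes care of the exponent \<open>s = q / p > 1\<close>.\<close>

lemma carleson_weak_type:
  assumes s: "1 \<le> s" and p: "0 < p"
  shows "\<exists>A>0. \<forall>\<nu> \<kappa> f I l. sets \<nu> = sets M \<and> 0 \<le> \<kappa> \<and>
     carleson_bound \<nu> \<kappa> s \<and>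
     f holomorphic_on unit_disk \<and> 0 < I \<and> (\<integral>\<^sup>+ z. ennreal (cmod (f z) powr p) \<partial>M) \<le> ennreal I \<and> 0 < l \<longrightarrow>
     emeasure \<nu> {w\<in>unit_disk. A * l < cmod (f w) powr (p / 2)} \<le>
       ennreal (\<kappa> * (cap_const ^ 3) powr s * (4 * I / l\<^sup>2) powr (s - 1) * (2 / l)) *
       (\<integral>\<^sup>+ z. ennreal (cmod (f z) powr (p / 2)) * indicator {z. l / 2 < cmod (f z) powr (p / 2)} z \<partial>M)"
proof -
  have p2: "0 < p / 2" using p by simp
  obtain A where A: "0 < A" "\<And>f w l. f holomorphic_on unit_disk \<and> cmod w < 1 \<and> 0 < l \<and> A * l < cmod (f w) powr (p / 2) \<Longrightarrow>
     (\<exists>\<zeta> \<delta>. cmod \<zeta> = 1 \<and> 0 < \<delta> \<and> \<delta> \<le> 3 \<and> w \<in> ball \<zeta> \<delta> \<and>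
        ennreal (l * cap \<delta>) \<le> (\<integral>\<^sup>+ z. ennreal (cmod (f z) powr (p / 2)) * indicator (ball \<zeta> \<delta> \<inter> unit_disk) z \<partial>M))"
    using large_value_gives_heavy_ball[OF p2] by blast
  show ?thesis
  proof (intro exI[of _ A] conjI A(1) allI impI, elim conjE)
    fix \<nu> :: "complex measure" and \<kappa> I l :: real and f :: "complex \<Rightarrow> complex"
    assume \<nu>: "sets \<nu> = sets M" and \<kappa>: "0 \<le> \<kappa>"
      and carl: "carleson_bound \<nu> \<kappa> s"
      and f: "f holomorphic_on unit_disk" and I: "0 < I" "(\<integral>\<^sup>+ z. ennreal (cmod (f z) powr p) \<partial>M) \<le> ennreal I" and l: "0 < l"
    define g where "g = (\<lambda>z. cmod (f z) powr (p / 2))"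
    have g0: "0 \<le> g z" for z by (simp add: g_def)
    have g2: "g z * g z = cmod (f z) powr p" for z by (simp add: g_def powr_add[symmetric])
    have gm [measurable]: "g \<in> borel_measurable M" using holomorphic_measurable[OF f] unfolding g_def by measurable
    define G where "G = (\<lambda>z. ennreal (g z) * indicator {z. l / 2 < g z} z)"
    have Gm [measurable]: "G \<in> borel_measurable M"
    proof -
      have "G = (\<lambda>z. ennreal (g z) * indicator {l / 2<..} (g z))" by (auto simp: G_def indicator_def fun_eq_iff)
      then show ?thesis by simp
    qed
    define K where "K = {(\<zeta>, \<delta>). cmod \<zeta> = 1 \<and> 0 < \<delta> \<and> \<delta> \<le> 3 \<and>
        ennreal (l * cap \<delta>) \<le> (\<integral>\<^sup>+ z. ennreal (g z) * indicator (ball \<zeta> \<delta> \<inter> unit_disk) z \<partial>M)}"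
    have bs: "ball a b \<inter> unit_disk \<in> sets M" for a b by (intro borel_Int_disk) simp
    have heavy: "ennreal (cap \<delta>) \<le> ennreal (2 / l) * (\<integral>\<^sup>+ z. G z * indicator (ball \<zeta> \<delta> \<inter> unit_disk) z \<partial>M)"
      if "(\<zeta>, \<delta>) \<in> K" for \<zeta> \<delta>
    proof -
      let ?B = "ball \<zeta> \<delta> \<inter> unit_disk"
      have "ennreal (l * cap \<delta>) \<le> (\<integral>\<^sup>+ z. ennreal (g z) * indicator ?B z \<partial>M)" using that by (simp add: K_def)
      also have "\<dots> \<le> (\<integral>\<^sup>+ z. G z * indicator ?B z + ennreal (l / 2) * indicator ?B z \<partial>M)"
      proof (intro nn_integral_mono)
        fix z
        have "ennreal (g z) \<le> G z + ennreal (l / 2)"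
          by (cases "l / 2 < g z") (simp_all add: G_def ennreal_leI)
        then show "ennreal (g z) * indicator ?B z \<le> G z * indicator ?B z + ennreal (l / 2) * indicator ?B z"
          by (cases "z \<in> ?B") simp_all
      qed
      also have "\<dots> = (\<integral>\<^sup>+ z. G z * indicator ?B z \<partial>M) + (\<integral>\<^sup>+ z. ennreal (l / 2) * indicator ?B z \<partial>M)"
        using bs by (intro nn_integral_add) measurable
      also have "(\<integral>\<^sup>+ z. ennreal (l / 2) * indicator ?B z \<partial>M) = ennreal (l / 2 * cap \<delta>)"
      proof -
        have "cmod \<zeta> = 1" using that by (simp add: K_def)
        then show ?thesis using l
          by (simp only: nn_integral_cmult_indicator[OF bs] emeasure_ball_eq_cap ennreal_mult[OF _ cap_nonneg])
      qed
      finally have le: "ennreal (l * cap \<delta>) \<le> (\<integral>\<^sup>+ z. G z * indicator ?B z \<partial>M) + ennreal (l / 2 * cap \<delta>)" .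
      have "ennreal (l / 2 * cap \<delta>) + ennreal (l / 2 * cap \<delta>) = ennreal (l * cap \<delta>)"
        using l by (subst ennreal_plus[symmetric]) auto
      then have "ennreal (l / 2 * cap \<delta>) + ennreal (l / 2 * cap \<delta>) \<le> ennreal (l / 2 * cap \<delta>) + (\<integral>\<^sup>+ z. G z * indicator ?B z \<partial>M)"
        using le by (simp only: add.commute)
      then have "ennreal (l / 2 * cap \<delta>) \<le> (\<integral>\<^sup>+ z. G z * indicator ?B z \<partial>M)"
        unfolding ennreal_add_left_cancel_le by (simp only: infinity_ennreal_def ennreal_neq_top simp_thms)
      then have "ennreal (2 / l) * ennreal (l / 2 * cap \<delta>) \<le> ennreal (2 / l) * (\<integral>\<^sup>+ z. G z * indicator ?B z \<partial>M)"
        by (rule mult_left_mono) simp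
      moreover have "ennreal (2 / l) * ennreal (l / 2 * cap \<delta>) = ennreal (cap \<delta>)"
        unfolding ennreal_mult'[symmetric, OF divide_nonneg_pos[OF zero_le_numeral l]] using l by simp
      ultimately show ?thesis by simp
    qed
    have capm: "cap \<delta> \<le> 4 * I / l\<^sup>2" if k: "(\<zeta>, \<delta>) \<in> K" for \<zeta> \<delta>
    proof -
      have "(\<integral>\<^sup>+ z. G z * indicator (ball \<zeta> \<delta> \<inter> unit_disk) z \<partial>M) \<le> (\<integral>\<^sup>+ z. ennreal (2 / l) * ennreal (cmod (f z) powr p) \<partial>M)"
      proof (intro nn_integral_mono)
        fix z
        have "G z \<le> ennreal (2 / l * (g z * g z))"
        proof (cases "l / 2 < g z")
          case True
          then have "g z * 1 \<le> g z * (2 / l * g z)" using l g0[of z] by (intro mult_left_mono) (auto simp: field_simps)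
          then show ?thesis using True by (simp add: G_def ennreal_leI mult_ac)
        qed (simp add: G_def)
        then have "G z \<le> ennreal (2 / l) * ennreal (cmod (f z) powr p)"
          unfolding g2 using l by (subst ennreal_mult[symmetric]) auto
        moreover have "G z * indicator (ball \<zeta> \<delta> \<inter> unit_disk) z \<le> G z" by (auto simp: indicator_def)
        ultimately show "G z * indicator (ball \<zeta> \<delta> \<inter> unit_disk) z \<le> ennreal (2 / l) * ennreal (cmod (f z) powr p)" by (rule order_trans[rotated])
      qed
      also have "\<dots> = ennreal (2 / l) * (\<integral>\<^sup>+ z. ennreal (cmod (f z) powr p) \<partial>M)"
        using holomorphic_measurable[OF f] by (intro nn_integral_cmult) measurable
      also have "\<dots> \<le> ennreal (2 / l) * ennreal I" by (intro mult_left_mono I) simp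
      finally have "ennreal (2 / l) * (\<integral>\<^sup>+ z. G z * indicator (ball \<zeta> \<delta> \<inter> unit_disk) z \<partial>M) \<le> ennreal (2 / l) * (ennreal (2 / l) * ennreal I)"
        by (rule mult_left_mono) simp
      also have "\<dots> = ennreal (4 * I / l\<^sup>2)"
        using l I by (simp add: ennreal_mult[symmetric] power2_eq_square)
      finally have "ennreal (cap \<delta>) \<le> ennreal (4 * I / l\<^sup>2)" using heavy[OF k] by (rule order_trans[rotated])
      then show ?thesis using I l by (subst (asm) ennreal_le_iff) auto
    qed
    define m where "m = 4 * I / l\<^sup>2"
    have m: "0 < m" using I l by (simp add: m_def)
    define S where "S = {w\<in>unit_disk. A * l < g w}"
    have S1: "S \<subseteq> unit_disk" by (auto simp: S_def)
    have S2: "S \<subseteq> (\<Union>(\<zeta>, \<delta>)\<in>K. ball \<zeta> \<delta>)"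
    proof
      fix w assume "w \<in> S"
      then have "f holomorphic_on unit_disk \<and> cmod w < 1 \<and> 0 < l \<and> A * l < cmod (f w) powr (p / 2)"
        using f l by (auto simp: S_def g_def)
      from A(2)[OF this] show "w \<in> (\<Union>(\<zeta>, \<delta>)\<in>K. ball \<zeta> \<delta>)" unfolding K_def g_def by blast
    qed
    have K': "cmod \<zeta> = 1 \<and> 0 < \<delta> \<and> \<delta> \<le> 3 \<and> cap \<delta> \<le> m \<and>
       emeasure \<nu> (ball \<zeta> (5 * \<delta>) \<inter> unit_disk) \<le> ennreal (\<kappa> * cap (5 * \<delta>) powr s)" if "(\<zeta>, \<delta>) \<in> K" for \<zeta> \<delta>
      using that capm[OF that] carl unfolding m_def by (auto simp: K_def carleson_bound_def)
    obtain C where C: "countable C" "C \<subseteq> K"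
      "disjoint_family_on (\<lambda>(\<zeta>, \<delta>). ball \<zeta> \<delta> \<inter> unit_disk) C"
      "emeasure \<nu> S \<le> ennreal (\<kappa> * (cap_const ^ 3) powr s * m powr (s - 1)) *
         (\<integral>\<^sup>+ i. emeasure M ((\<lambda>(\<zeta>, \<delta>). ball \<zeta> \<delta> \<inter> unit_disk) i) \<partial>count_space C)"
      using vitali_cap_sum[OF \<nu> s \<kappa> m K' S1 S2] by blast
    have "(\<integral>\<^sup>+ i. emeasure M ((\<lambda>(\<zeta>, \<delta>). ball \<zeta> \<delta> \<inter> unit_disk) i) \<partial>count_space C)
       \<le> (\<integral>\<^sup>+ i. ennreal (2 / l) * emeasure (density M G) ((\<lambda>(\<zeta>, \<delta>). ball \<zeta> \<delta> \<inter> unit_disk) i) \<partial>count_space C)"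
    proof (intro nn_integral_mono)
      fix i assume "i \<in> space (count_space C)"
      then have "i \<in> K" using C(2) by auto
      moreover obtain \<zeta> \<delta> where i: "i = (\<zeta>, \<delta>)" by (cases i)
      ultimately have k: "(\<zeta>, \<delta>) \<in> K" by simp
      then have "emeasure M (ball \<zeta> \<delta> \<inter> unit_disk) = ennreal (cap \<delta>)" using K' emeasure_ball_eq_cap by blast
      moreover have "emeasure (density M G) (ball \<zeta> \<delta> \<inter> unit_disk) = (\<integral>\<^sup>+ z. G z * indicator (ball \<zeta> \<delta> \<inter> unit_disk) z \<partial>M)"
        by (rule emeasure_density[OF Gm bs])
      ultimately show "emeasure M ((\<lambda>(\<zeta>, \<delta>). ball \<zeta> \<delta> \<inter> unit_disk) i) \<le> ennreal (2 / l) * emeasure (density M G) ((\<lambda>(\<zeta>, \<delta>). ball \<zeta> \<delta> \<inter> unit_disk) i)"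
        using heavy[OF k] by (simp only: i prod.case)
    qed
    also have "\<dots> = ennreal (2 / l) * (\<integral>\<^sup>+ i. emeasure (density M G) ((\<lambda>(\<zeta>, \<delta>). ball \<zeta> \<delta> \<inter> unit_disk) i) \<partial>count_space C)"
      by (rule nn_integral_cmult) simp
    also have "(\<integral>\<^sup>+ i. emeasure (density M G) ((\<lambda>(\<zeta>, \<delta>). ball \<zeta> \<delta> \<inter> unit_disk) i) \<partial>count_space C)
       = emeasure (density M G) (\<Union>i\<in>C. (\<lambda>(\<zeta>, \<delta>). ball \<zeta> \<delta> \<inter> unit_disk) i)"
      by (rule emeasure_UN_countable[OF _ C(1) C(3), symmetric]) (use bs in auto)
    also have "\<dots> \<le> emeasure (density M G) (space M)"
      using emeasure_space[of "density M G"] by (simp only: space_density)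
    also have "\<dots> = (\<integral>\<^sup>+ z. G z \<partial>M)"
      by (subst emeasure_density) (auto intro!: nn_integral_cong)
    finally have "(\<integral>\<^sup>+ i. emeasure M ((\<lambda>(\<zeta>, \<delta>). ball \<zeta> \<delta> \<inter> unit_disk) i) \<partial>count_space C) \<le> ennreal (2 / l) * (\<integral>\<^sup>+ z. G z \<partial>M)"
      by (simp add: mult_left_mono)
    then have "emeasure \<nu> S \<le> ennreal (\<kappa> * (cap_const ^ 3) powr s * m powr (s - 1)) * (ennreal (2 / l) * (\<integral>\<^sup>+ z. G z \<partial>M))"
      using C(4) by (meson mult_left_mono order_trans zero_le)
    moreover have "ennreal (\<kappa> * (cap_const ^ 3) powr s * m powr (s - 1) * (2 / l)) = ennreal (\<kappa> * (cap_const ^ 3) powr s * m powr (s - 1)) * ennreal (2 / l)"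
      using \<kappa> l by (intro ennreal_mult) auto
    ultimately show "emeasure \<nu> {w\<in>unit_disk. A * l < cmod (f w) powr (p / 2)} \<le>
       ennreal (\<kappa> * (cap_const ^ 3) powr s * (4 * I / l\<^sup>2) powr (s - 1) * (2 / l)) *
       (\<integral>\<^sup>+ z. ennreal (cmod (f z) powr (p / 2)) * indicator {z. l / 2 < cmod (f z) powr (p / 2)} z \<partial>M)"
      unfolding S_def G_def g_def m_def by (simp only: mult.assoc)
  qed
qed

text \<open>Integrating the weak type estimate over the levels \<open>l\<close> with density \<open>l powr (2 q / p - 1)\<close>, all powers of
  \<open>l\<close> cancel, and what is left is the integral of \<open>\<bar>f\<bar>\<^bsup>p/2\<^esup>\<close> times the length \<open>2 \<bar>f\<bar>\<^bsup>p/2\<^esup>\<close> of the range of levels.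
  The exponent \<open>p / 2\<close> is chosen for this.\<close>

theorem carleson_embedding:
  assumes p: "0 < p" "p \<le> q"
  shows "\<exists>A>0. \<forall>\<nu> \<kappa> f I. finite_measure \<nu> \<and> sets \<nu> = sets M \<and> 0 \<le> \<kappa> \<and>
     carleson_bound \<nu> \<kappa> (q / p) \<and>
     f holomorphic_on unit_disk \<and> 0 < I \<and> (\<integral>\<^sup>+ z. ennreal (cmod (f z) powr p) \<partial>M) \<le> ennreal I \<longrightarrow>
     (\<integral>\<^sup>+ z. ennreal (cmod (f z) powr q) \<partial>\<nu>) \<le> ennreal (A * \<kappa> * I powr (q / p))"
proof -
  define s where "s = q / p"
  have s: "1 \<le> s" using p by (simp add: s_def)
  obtain A0 where A0: "0 < A0" and weak: "\<And>\<nu> \<kappa> f I l. sets \<nu> = sets M \<and> 0 \<le> \<kappa> \<and>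
     carleson_bound \<nu> \<kappa> s \<and>
     f holomorphic_on unit_disk \<and> 0 < I \<and> (\<integral>\<^sup>+ z. ennreal (cmod (f z) powr p) \<partial>M) \<le> ennreal I \<and> 0 < l \<Longrightarrow>
     emeasure \<nu> {w\<in>unit_disk. A0 * l < cmod (f w) powr (p / 2)} \<le>
       ennreal (\<kappa> * (cap_const ^ 3) powr s * (4 * I / l\<^sup>2) powr (s - 1) * (2 / l)) *
       (\<integral>\<^sup>+ z. ennreal (cmod (f z) powr (p / 2)) * indicator {z. l / 2 < cmod (f z) powr (p / 2)} z \<partial>M)"
    using carleson_weak_type[OF s p(1)] by blast
  \<comment> \<open>The constant \<open>c1\<close> collects the factors of the weak type estimate that are independent of the level.\<close>
  define c1 where "c1 = (cap_const ^ 3) powr s * 4 powr (s - 1) * 2"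
  define t where "t = 2 * s"
  have t: "1 \<le> t" using s by (simp add: t_def)
  define A where "A = (A0 powr t * 2 powr t) * (c1 * 2)"
  have c1: "0 < c1" using cap_const_ge by (simp add: c1_def)
  have A: "0 < A" using A0 c1 by (simp add: A_def)
  show ?thesis
  proof (intro exI[of _ A] conjI A allI impI, elim conjE)
    fix \<nu> :: "complex measure" and \<kappa> I :: real and f :: "complex \<Rightarrow> complex"
    assume fin\<nu>: "finite_measure \<nu>" and \<nu>: "sets \<nu> = sets M" and \<kappa>: "0 \<le> \<kappa>"
      and carl: "carleson_bound \<nu> \<kappa> (q / p)"
      and f: "f holomorphic_on unit_disk" and I: "0 < I" "(\<integral>\<^sup>+ z. ennreal (cmod (f z) powr p) \<partial>M) \<le> ennreal I"
    interpret \<nu>: finite_measure \<nu> by (rule fin\<nu>)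
    interpret PN: pair_sigma_finite \<nu> "lborel :: real measure" ..
    interpret PM: pair_sigma_finite M "lborel :: real measure" ..
    define g where "g = (\<lambda>z. cmod (f z) powr (p / 2))"
    have g0: "0 \<le> g z" for z by (simp add: g_def)
    have g2: "g z * g z = cmod (f z) powr p" for z by (simp add: g_def powr_add[symmetric])
    have gm [measurable]: "g \<in> borel_measurable M" using holomorphic_measurable[OF f] unfolding g_def by measurable
    have gn [measurable]: "g \<in> borel_measurable \<nu>" using gm unfolding measurable_cong_sets[OF \<nu> refl] .
    have sp: "space \<nu> = unit_disk" using sets_eq_imp_space_eq[OF \<nu>] space_M by simp
    define h where "h = (\<lambda>z. g z / A0)"
    have h0: "0 \<le> h z" for z using g0 A0 by (simp add: h_def)
    have hn [measurable]: "h \<in> borel_measurable \<nu>" unfolding h_def by measurable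
    have fq: "cmod (f z) powr q = A0 powr t * h z powr t" for z
    proof -
      have "A0 powr t * h z powr t = (A0 * h z) powr t" by (rule powr_mult[symmetric])
      also have "A0 * h z = cmod (f z) powr (p / 2)" using A0 by (simp add: h_def g_def)
      also have "(cmod (f z) powr (p / 2)) powr t = cmod (f z) powr q"
        using p by (simp add: powr_powr t_def s_def)
      finally show ?thesis by simp
    qed
    have wk: "emeasure \<nu> {w\<in>unit_disk. l < h w} \<le> ennreal (\<kappa> * c1 * I powr (s - 1)) * ennreal (l powr (1 - t)) * (\<integral>\<^sup>+ z. ennreal (g z) * indicator {z. l < 2 * g z} z \<partial>M)"
      if l: "0 < l" for l
    proof -
      have 1: "emeasure \<nu> {w\<in>unit_disk. A0 * l < cmod (f w) powr (p / 2)} \<le>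
       ennreal (\<kappa> * (cap_const ^ 3) powr s * (4 * I / l\<^sup>2) powr (s - 1) * (2 / l)) *
       (\<integral>\<^sup>+ z. ennreal (cmod (f z) powr (p / 2)) * indicator {z. l / 2 < cmod (f z) powr (p / 2)} z \<partial>M)"
        using \<nu> \<kappa> carl f I l unfolding s_def[symmetric] by (intro weak) blast
      have 2: "{w\<in>unit_disk. A0 * l < cmod (f w) powr (p / 2)} = {w\<in>unit_disk. l < h w}"
        using A0 by (simp add: h_def g_def pos_less_divide_eq mult.commute)
      have 3: "{z. l / 2 < cmod (f z) powr (p / 2)} = {z. l < 2 * g z}" by (auto simp: g_def)
      have "(4 * I / l\<^sup>2) powr (s - 1) * (2 / l) = 4 powr (s - 1) * I powr (s - 1) * 2 * ((1 / l\<^sup>2) powr (s - 1) * (1 / l))"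
        using I l powr_mult[of "4 * I" "1 / l\<^sup>2" "s - 1"] powr_mult[of 4 I "s - 1"] by simp
      also have "(1 / l\<^sup>2) powr (s - 1) * (1 / l) = l powr (1 - t)"
      proof -
        have a: "1 / l\<^sup>2 = l powr (- 2)" using l by (simp add: powr_minus powr_numeral inverse_eq_divide)
        have b: "1 / l = l powr (- 1)" using l by (simp add: powr_neg_one)
        from a b have "(1 / l\<^sup>2) powr (s - 1) * (1 / l) = l powr (- 2 * (s - 1) + - 1)"
          by (simp only: powr_powr powr_add)
        then show ?thesis by (simp add: t_def algebra_simps)
      qed
      finally have 4: "(4 * I / l\<^sup>2) powr (s - 1) * (2 / l) = 4 powr (s - 1) * I powr (s - 1) * 2 * l powr (1 - t)" .
      have 4: "\<kappa> * (cap_const ^ 3) powr s * (4 * I / l\<^sup>2) powr (s - 1) * (2 / l) = (\<kappa> * c1 * I powr (s - 1)) * l powr (1 - t)"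
        unfolding mult.assoc[of _ "(4 * I / l\<^sup>2) powr (s - 1)" "2 / l"] 4 by (simp add: c1_def mult_ac)
      have 5: "ennreal ((\<kappa> * c1 * I powr (s - 1)) * l powr (1 - t)) = ennreal (\<kappa> * c1 * I powr (s - 1)) * ennreal (l powr (1 - t))"
        using \<kappa> c1 by (intro ennreal_mult) auto
      show ?thesis using 1 unfolding 2 3 4 5 by (simp add: g_def)
    qed
    have Nmeas: "(\<lambda>(z, l). ennreal (l powr (t - 1)) * indicator {0<..<h z} l) \<in> borel_measurable (\<nu> \<Otimes>\<^sub>M lborel)"
    proof -
      have "(\<lambda>p. ennreal (snd p powr (t - 1)) * (if 0 < snd p \<and> snd p < h (fst p) then 1 else 0)) \<in> borel_measurable (\<nu> \<Otimes>\<^sub>M lborel)"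
        by measurable
      also have "(\<lambda>p. ennreal (snd p powr (t - 1)) * (if 0 < snd p \<and> snd p < h (fst p) then 1 else 0)) = (\<lambda>(z, l). ennreal (l powr (t - 1)) * indicator {0<..<h z} l)"
        by (auto simp: fun_eq_iff indicator_def)
      finally show ?thesis .
    qed
    have Mmeas: "(\<lambda>(z, l). ennreal (g z) * indicator {0<..<2 * g z} l) \<in> borel_measurable (M \<Otimes>\<^sub>M lborel)"
    proof -
      have "(\<lambda>p. ennreal (g (fst p)) * (if 0 < snd p \<and> snd p < 2 * g (fst p) then 1 else 0)) \<in> borel_measurable (M \<Otimes>\<^sub>M lborel)"
        by measurable
      also have "(\<lambda>p. ennreal (g (fst p)) * (if 0 < snd p \<and> snd p < 2 * g (fst p) then 1 else 0)) = (\<lambda>(z, l). ennreal (g z) * indicator {0<..<2 * g z} (l::real))"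
        by (auto simp: fun_eq_iff indicator_def)
      finally show ?thesis .
    qed
    define c2 where "c2 = \<kappa> * c1 * I powr (s - 1)"
    have c2: "0 \<le> c2" using \<kappa> c1 by (simp add: c2_def)
    have "(\<integral>\<^sup>+ z. ennreal (cmod (f z) powr q) \<partial>\<nu>) = (\<integral>\<^sup>+ z. ennreal (A0 powr t) * ennreal (h z powr t) \<partial>\<nu>)"
      by (simp only: fq ennreal_mult powr_ge_zero)
    also have "\<dots> \<le> (\<integral>\<^sup>+ z. ennreal (A0 powr t * 2 powr t) * (\<integral>\<^sup>+ l. ennreal (l powr (t - 1)) * indicator {0<..<h z} l \<partial>lborel) \<partial>\<nu>)"
    proof (intro nn_integral_mono)
      fix z
      have "ennreal (A0 powr t) * ennreal (h z powr t) \<le> ennreal (A0 powr t) * (ennreal (2 powr t) * (\<integral>\<^sup>+ l. ennreal (l powr (t - 1)) * indicator {0<..<h z} l \<partial>lborel))"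
        by (intro mult_left_mono powr_le_tail_integral h0 t) simp
      then show "ennreal (A0 powr t) * ennreal (h z powr t) \<le> ennreal (A0 powr t * 2 powr t) * (\<integral>\<^sup>+ l. ennreal (l powr (t - 1)) * indicator {0<..<h z} l \<partial>lborel)"
        by (simp only: ennreal_mult powr_ge_zero mult.assoc)
    qed
    also have "\<dots> = ennreal (A0 powr t * 2 powr t) * (\<integral>\<^sup>+ z. (\<integral>\<^sup>+ l. ennreal (l powr (t - 1)) * indicator {0<..<h z} l \<partial>lborel) \<partial>\<nu>)"
      by (intro nn_integral_cmult lborel.borel_measurable_nn_integral Nmeas)
    also have "(\<integral>\<^sup>+ z. (\<integral>\<^sup>+ l. ennreal (l powr (t - 1)) * indicator {0<..<h z} l \<partial>lborel) \<partial>\<nu>)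
       = (\<integral>\<^sup>+ l. (\<integral>\<^sup>+ z. ennreal (l powr (t - 1)) * indicator {0<..<h z} l \<partial>\<nu>) \<partial>lborel)"
      by (rule PN.Fubini'[OF Nmeas, symmetric])
    also have "\<dots> \<le> (\<integral>\<^sup>+ l. ennreal c2 * (\<integral>\<^sup>+ z. ennreal (g z) * indicator {0<..<2 * g z} l \<partial>M) \<partial>lborel)"
    proof (intro nn_integral_mono)
      fix l :: real
      show "(\<integral>\<^sup>+ z. ennreal (l powr (t - 1)) * indicator {0<..<h z} l \<partial>\<nu>) \<le> ennreal c2 * (\<integral>\<^sup>+ z. ennreal (g z) * indicator {0<..<2 * g z} l \<partial>M)"
      proof (cases "0 < l")
        case True
        have ms: "{w\<in>unit_disk. l < h w} \<in> sets \<nu>"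
        proof -
          have "{w\<in>space \<nu>. l < h w} \<in> sets \<nu>" by measurable
          then show ?thesis by (simp add: sp)
        qed
        have "(\<integral>\<^sup>+ z. ennreal (l powr (t - 1)) * indicator {0<..<h z} l \<partial>\<nu>) = (\<integral>\<^sup>+ z. ennreal (l powr (t - 1)) * indicator {w\<in>unit_disk. l < h w} z \<partial>\<nu>)"
          by (intro nn_integral_cong) (use True sp in \<open>auto simp: indicator_def\<close>)
        also have "\<dots> = ennreal (l powr (t - 1)) * emeasure \<nu> {w\<in>unit_disk. l < h w}"
          by (rule nn_integral_cmult_indicator[OF ms])
        also have "\<dots> \<le> ennreal (l powr (t - 1)) * (ennreal c2 * ennreal (l powr (1 - t)) * (\<integral>\<^sup>+ z. ennreal (g z) * indicator {z. l < 2 * g z} z \<partial>M))"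
          unfolding c2_def by (intro mult_left_mono wk True) simp
        also have "\<dots> = (ennreal (l powr (t - 1)) * ennreal (l powr (1 - t))) * (ennreal c2 * (\<integral>\<^sup>+ z. ennreal (g z) * indicator {z. l < 2 * g z} z \<partial>M))"
          by (simp only: mult_ac)
        also have "ennreal (l powr (t - 1)) * ennreal (l powr (1 - t)) = 1"
          using True by (simp add: ennreal_mult[symmetric] powr_add[symmetric])
        also have "(\<integral>\<^sup>+ z. ennreal (g z) * indicator {z. l < 2 * g z} z \<partial>M) = (\<integral>\<^sup>+ z. ennreal (g z) * indicator {0<..<2 * g z} l \<partial>M)"
          by (intro nn_integral_cong) (use True in \<open>auto simp: indicator_def\<close>)
        finally show ?thesis by simp
      qed simp
    qed
    also have "\<dots> = ennreal c2 * (\<integral>\<^sup>+ l. (\<integral>\<^sup>+ z. ennreal (g z) * indicator {0<..<2 * g z} l \<partial>M) \<partial>lborel)"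
    proof (rule nn_integral_cmult)
      have "(\<lambda>(l, z). ennreal (g z) * indicator {0<..<2 * g z} (l::real)) \<in> borel_measurable (lborel \<Otimes>\<^sub>M M)"
        using measurable_compose[OF measurable_pair_swap' Mmeas] by (simp add: case_prod_beta')
      then show "(\<lambda>l. \<integral>\<^sup>+ z. ennreal (g z) * indicator {0<..<2 * g z} (l::real) \<partial>M) \<in> borel_measurable lborel"
        by (rule borel_measurable_nn_integral)
    qed
    also have "(\<integral>\<^sup>+ l. (\<integral>\<^sup>+ z. ennreal (g z) * indicator {0<..<2 * g z} l \<partial>M) \<partial>lborel)
       = (\<integral>\<^sup>+ z. (\<integral>\<^sup>+ l. ennreal (g z) * indicator {0<..<2 * g z} l \<partial>lborel) \<partial>M)"
      by (rule PM.Fubini'[OF Mmeas])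
    also have "\<dots> = (\<integral>\<^sup>+ z. ennreal 2 * ennreal (cmod (f z) powr p) \<partial>M)"
    proof (intro nn_integral_cong)
      fix z
      have "(\<integral>\<^sup>+ l. ennreal (g z) * indicator {0<..<2 * g z} l \<partial>lborel) = ennreal (g z) * ennreal (2 * g z)"
        using g0[of z] by (subst nn_integral_cmult_indicator) auto
      also have "\<dots> = ennreal (2 * (g z * g z))" using g0[of z] by (subst ennreal_mult[symmetric]) (auto simp: mult_ac)
      also have "\<dots> = ennreal 2 * ennreal (cmod (f z) powr p)" unfolding g2 by (rule ennreal_mult) auto
      finally show "(\<integral>\<^sup>+ l. ennreal (g z) * indicator {0<..<2 * g z} l \<partial>lborel) = ennreal 2 * ennreal (cmod (f z) powr p)" .
    qed
    also have "\<dots> = ennreal 2 * (\<integral>\<^sup>+ z. ennreal (cmod (f z) powr p) \<partial>M)"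
      using holomorphic_measurable[OF f] by (intro nn_integral_cmult) measurable
    also have "\<dots> \<le> ennreal 2 * ennreal I" by (intro mult_left_mono I) simp
    finally have "(\<integral>\<^sup>+ z. ennreal (cmod (f z) powr q) \<partial>\<nu>) \<le> ennreal (A0 powr t * 2 powr t) * (ennreal c2 * (ennreal 2 * ennreal I))"
      by (simp add: mult_left_mono)
    also have "\<dots> = ennreal (A0 powr t * 2 powr t * (c2 * (2 * I)))"
      using c2 I by (simp only: ennreal_mult[symmetric] mult_nonneg_nonneg powr_ge_zero zero_le_numeral less_imp_le)
    also have "A0 powr t * 2 powr t * (c2 * (2 * I)) = A * \<kappa> * I powr (q / p)"
    proof -
      have "I powr (s - 1) * I = I powr s" using I powr_add[of I "s - 1" 1] by simp
      moreover have "A0 powr t * 2 powr t * (c2 * (2 * I)) = A * \<kappa> * (I powr (s - 1) * I)"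
        by (simp add: A_def c2_def mult_ac)
      ultimately show ?thesis by (simp add: s_def)
    qed
    finally show "(\<integral>\<^sup>+ z. ennreal (cmod (f z) powr q) \<partial>\<nu>) \<le> ennreal (A * \<kappa> * I powr (q / p))" .
  qed
qed

end

section \<open>The measure of a radial weight\<close>

text \<open>The image of area under \<open>z \<mapsto> \<bar>z\<bar>\<close> has a density, so null sets of radii give null sets in the disk. This
  lets a radial weight that is only Lebesgue measurable be replaced by a Borel one.\<close>

lemma AE_cmod_disk:
  assumes "AE s in lborel. P s"
  shows "AE z in restrict_space lborel unit_disk. P (cmod z)"
proof -
  obtain N where N: "{s \<in> space lborel. \<not> P s} \<subseteq> N" "emeasure lborel N = 0" "N \<in> sets lborel"
    by (rule AE_E[OF assms])
  have Nb: "N \<in> sets borel" using N(3) by simp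
  have cm: "cmod \<in> borel_measurable (restrict_space lborel unit_disk)"
    by (rule measurable_restrict_space1) simp
  have "emeasure (restrict_space lborel unit_disk) (cmod -` N \<inter> space (restrict_space lborel unit_disk))
     = emeasure (distr (restrict_space lborel unit_disk) borel cmod) N"
    by (rule emeasure_distr[OF cm Nb, symmetric])
  also have "\<dots> = (\<integral>\<^sup>+ s. ennreal (2 * pi * s) * indicator {0..1} s * indicator N s \<partial>lborel)"
    unfolding distr_cmod_disk by (rule emeasure_density) (use Nb in auto)
  also have "\<dots> = (\<integral>\<^sup>+ s. 0 \<partial>(lborel :: real measure))"
  proof (rule nn_integral_cong_AE)
    have "AE s in lborel. s \<notin> N" using null_setsI[OF N(2,3)] by (rule AE_not_in)
    then show "AE s in lborel. ennreal (2 * pi * s) * indicator {0..1} s * indicator N s = 0" by eventually_elim simp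
  qed
  finally have z: "emeasure (restrict_space lborel unit_disk) (cmod -` N \<inter> space (restrict_space lborel unit_disk)) = 0" by simp
  show ?thesis
  proof (rule AE_I[OF _ z])
    show "{z \<in> space (restrict_space lborel unit_disk). \<not> P (cmod z)} \<subseteq> cmod -` N \<inter> space (restrict_space lborel unit_disk)"
      using N(1) by auto
    show "cmod -` N \<inter> space (restrict_space lborel unit_disk) \<in> sets (restrict_space lborel unit_disk)"
      using measurable_sets[OF cm Nb] .
  qed
qed

lemma radial_density_rotation:
  fixes f :: "real \<Rightarrow> ennreal"
  assumes [measurable]: "f \<in> borel_measurable borel"
  defines "M \<equiv> density (restrict_space lborel unit_disk) (\<lambda>z. f (cmod z))"
  shows "distr M disk_borel (\<lambda>z. cis t * z) = M"
proof (rule measure_eqI)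
  have sM: "sets M = sets disk_borel" by (simp add: M_def sets_restrict_space)
  have spM: "space M = unit_disk" by (simp add: M_def space_restrict_space)
  show "sets (distr M disk_borel (\<lambda>z. cis t * z)) = sets M" by (simp add: sM)
  fix A assume "A \<in> sets (distr M disk_borel (\<lambda>z. cis t * z))"
  then have A: "A \<in> sets disk_borel" by simp
  then have AD: "A \<subseteq> unit_disk" and Ab [measurable]: "A \<in> sets borel"
    by (auto simp: sets_restrict_space)
  have fm: "(\<lambda>z. f (cmod z)) \<in> borel_measurable (restrict_space lborel unit_disk)"
    by (rule measurable_restrict_space1) simp
  have rot: "(\<lambda>z. cis t * z) \<in> measurable M disk_borel"
  proof (rule measurable_restrict_space2)
    show "(\<lambda>z. cis t * z) \<in> space M \<rightarrow> unit_disk" by (auto simp: spM norm_mult)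
    show "(\<lambda>z. cis t * z) \<in> borel_measurable M"
      unfolding M_def measurable_density_eq1 by (rule measurable_restrict_space1) simp
  qed
  have em: "emeasure M B = (\<integral>\<^sup>+ z. f (cmod z) * indicator B z \<partial>lborel)" if B: "B \<in> sets disk_borel" for B
  proof -
    have BD: "B \<subseteq> unit_disk" using B by (auto simp: sets_restrict_space)
    have "emeasure M B = (\<integral>\<^sup>+ z. f (cmod z) * indicator B z \<partial>restrict_space lborel unit_disk)"
      unfolding M_def using B by (intro emeasure_density[OF fm]) (simp add: sets_restrict_space)
    also have "\<dots> = (\<integral>\<^sup>+ z. f (cmod z) * indicator B z * indicator unit_disk z \<partial>lborel)"
      by (rule nn_integral_restrict_space) simp
    also have "\<dots> = (\<integral>\<^sup>+ z. f (cmod z) * indicator B z \<partial>lborel)"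
      by (intro nn_integral_cong) (use BD in \<open>auto simp: indicator_def\<close>)
    finally show ?thesis .
  qed
  have pre: "(\<lambda>z. cis t * z) -` A \<inter> space M \<in> sets disk_borel"
    using measurable_sets[OF rot A] sM by simp
  have "emeasure (distr M disk_borel (\<lambda>z. cis t * z)) A = emeasure M ((\<lambda>z. cis t * z) -` A \<inter> space M)"
    by (rule emeasure_distr[OF rot A])
  also have "\<dots> = (\<integral>\<^sup>+ z. f (cmod z) * indicator ((\<lambda>z. cis t * z) -` A \<inter> space M) z \<partial>lborel)"
    by (rule em[OF pre])
  also have "\<dots> = (\<integral>\<^sup>+ z. f (cmod (cis t * z)) * indicator A (cis t * z) \<partial>lborel)"
    by (intro nn_integral_cong) (use AD in \<open>auto simp: indicator_def spM norm_mult\<close>)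
  also have "\<dots> = (\<integral>\<^sup>+ z. f (cmod z) * indicator A z \<partial>(distr lborel borel (\<lambda>z. cis t * z)))"
    by (subst nn_integral_distr) auto
  also have "\<dots> = emeasure M A" unfolding distr_lborel_rotation by (rule em[OF A, symmetric])
  finally show "emeasure (distr M disk_borel (\<lambda>z. cis t * z)) A = emeasure M A" .
qed

lemma radial_density_tail:
  fixes f :: "real \<Rightarrow> ennreal"
  assumes [measurable]: "f \<in> borel_measurable borel"
  defines "M \<equiv> density (restrict_space lborel unit_disk) (\<lambda>z. f (cmod z))"
  shows "emeasure M {z\<in>unit_disk. r \<le> cmod z} = (\<integral>\<^sup>+ s. ennreal (2 * pi * s) * f s * indicator ({r..} \<inter> {0..1}) s \<partial>lborel)"
proof -
  have fm: "(\<lambda>z. f (cmod z)) \<in> borel_measurable (restrict_space lborel unit_disk)"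
    by (rule measurable_restrict_space1) simp
  have cm: "cmod \<in> borel_measurable (restrict_space lborel unit_disk)"
    by (rule measurable_restrict_space1) simp
  have S: "{z\<in>unit_disk. r \<le> cmod z} \<in> sets (restrict_space lborel unit_disk)"
  proof -
    have "{z\<in>space (restrict_space lborel unit_disk). r \<le> cmod z} \<in> sets (restrict_space lborel unit_disk)"
      using cm by measurable
    then show ?thesis by (simp add: space_restrict_space)
  qed
  have "emeasure M {z\<in>unit_disk. r \<le> cmod z} = (\<integral>\<^sup>+ z. f (cmod z) * indicator {z\<in>unit_disk. r \<le> cmod z} z \<partial>restrict_space lborel unit_disk)"
    unfolding M_def by (rule emeasure_density[OF fm S])
  also have "\<dots> = (\<integral>\<^sup>+ z. f (cmod z) * indicator {r..} (cmod z) \<partial>restrict_space lborel unit_disk)"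
    by (intro nn_integral_cong) (auto simp: indicator_def space_restrict_space)
  also have "\<dots> = (\<integral>\<^sup>+ s. f s * indicator {r..} s \<partial>(distr (restrict_space lborel unit_disk) borel cmod))"
    using cm by (subst nn_integral_distr) auto
  also have "\<dots> = (\<integral>\<^sup>+ s. ennreal (2 * pi * s) * indicator {0..1} s * (f s * indicator {r..} s) \<partial>lborel)"
    unfolding distr_cmod_disk by (subst nn_integral_density) auto
  also have "\<dots> = (\<integral>\<^sup>+ s. ennreal (2 * pi * s) * f s * indicator ({r..} \<inter> {0..1}) s \<partial>lborel)"
    by (intro nn_integral_cong) (auto simp: indicator_def)
  finally show ?thesis .
qed

lemma radial_weight_borel_version:
  assumes \<omega>: "radial_weight \<omega>"
  obtains \<omega>0 :: "real \<Rightarrow> real" where "\<omega>0 \<in> borel_measurable borel" "\<And>s. 0 \<le> \<omega>0 s"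
    "AE s in lborel. indicator {0<..<1} s * \<omega> (of_real s) = \<omega>0 s"
proof -
  define F where "F = (\<lambda>s::real. indicator {0<..<1} s * \<omega> (of_real s))"
  have F0: "0 \<le> F s" for s
  proof (cases "s \<in> {0<..<1}")
    case True
    then have "of_real s \<in> unit_disk" by simp
    then have "0 < \<omega> (of_real s)" using \<omega> unfolding radial_weight_def by blast
    then show ?thesis by (simp add: F_def)
  qed (simp add: F_def)
  have "F \<in> borel_measurable (completion lborel)"
  proof -
    have "integrable lebesgue (\<lambda>s::real. indicator {0<..<1} s *\<^sub>R \<omega> (of_real s))"
      using \<omega> unfolding radial_weight_def set_integrable_def by blast
    then show ?thesis unfolding F_def real_scaleR_def by (rule borel_measurable_integrable)
  qed
  then obtain F' where F': "F' \<in> borel_measurable lborel" "AE s in lborel. F s = F' s"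
    using completion_ex_borel_measurable_real by blast
  show ?thesis
  proof (rule that[of "\<lambda>s. max 0 (F' s)"])
    show "(\<lambda>s. max 0 (F' s)) \<in> borel_measurable borel" using F'(1) by simp
    show "AE s in lborel. indicator {0<..<1} s * \<omega> (of_real s) = max 0 (F' s)"
      using F'(2) 
    proof eventually_elim
      case (elim s)
      then show ?case using F0[of s] unfolding F_def by (metis max.absorb2)
    qed
  qed simp
qed

text \<open>The tail of width \<open>\<delta>\<close> has mass \<open>\<integral> 2 s \<omega>(s) ds\<close> over \<open>(1 - \<delta>, 1)\<close>. The factor \<open>2 s\<close> is at most \<open>2\<close>, and at
  least \<open>1\<close> when \<open>s \<ge> 1 / 2\<close>; tails of width \<open>\<delta> / 2\<close> consist of such \<open>s\<close>, so that doubling passes from \<open>\<omega>\<close> to the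
  measure.\<close>

lemma weight_measure_exists:
  assumes \<omega>D: "\<omega> \<in> D_hat"
  obtains M Cw where "radial_doubling M Cw"
    "\<And>\<Phi>. \<Phi> \<in> borel_measurable disk_borel \<Longrightarrow>
       (\<integral>\<^sup>+ z. \<Phi> z * ennreal (\<omega> z) \<partial>disk_area) = (\<integral>\<^sup>+ z. \<Phi> z \<partial>M)"
    "\<omega> \<in> borel_measurable disk_area"
proof -
  have \<omega>: "radial_weight \<omega>" using \<omega>D by (simp add: D_hat_def)
  obtain C where C: "0 < C" "\<And>r. 0 < r \<Longrightarrow> r < 1 \<Longrightarrow> weight_hat \<omega> r < C * weight_hat \<omega> ((1 + r) / 2)"
    using \<omega>D by (auto simp: D_hat_def)
  obtain \<omega>0 where w0 [measurable]: "\<omega>0 \<in> borel_measurable borel" and w0n: "\<And>s. 0 \<le> \<omega>0 s"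
    and w0e: "AE s in lborel. indicator {0<..<1} s * \<omega> (of_real s) = \<omega>0 s"
    using radial_weight_borel_version[OF \<omega>] by blast
  define f where "f = (\<lambda>s. ennreal (\<omega>0 s / pi))"
  have fm [measurable]: "f \<in> borel_measurable borel" unfolding f_def by measurable
  define R where "R = restrict_space (lborel :: complex measure) unit_disk"
  define M where "M = density R (\<lambda>z. f (cmod z))"
  have sM: "sets M = sets disk_borel" by (simp add: M_def R_def sets_restrict_space)
  have spM: "space M = unit_disk" by (simp add: M_def R_def space_restrict_space)
  have spR: "space R = unit_disk" by (simp add: R_def space_restrict_space)
  have "AE z in R. indicator {0<..<1} (cmod z) * \<omega> (of_real (cmod z)) = \<omega>0 (cmod z)"
    unfolding R_def by (rule AE_cmod_disk[OF w0e])
  moreover have "AE z in R. cmod z \<noteq> 0"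
    unfolding R_def by (rule AE_cmod_disk) (rule AE_lborel_singleton)
  moreover have "AE z in R. z \<in> space R" by (rule AE_space)
  ultimately have AER: "AE z in R. \<omega> z = \<omega>0 (cmod z)"
  proof eventually_elim
    case (elim z)
    show ?case
    proof -
      have z: "z \<in> space R" "indicator {0<..<1} (cmod z) * \<omega> (of_real (cmod z)) = \<omega>0 (cmod z)" "cmod z \<noteq> 0"
        using elim by auto
      have "z \<in> unit_disk" using z(1) spR by simp
      then have "\<omega> z = \<omega> (of_real (cmod z))" using \<omega> unfolding radial_weight_def by blast
      moreover have "cmod z \<in> {0<..<1}" using \<open>z \<in> unit_disk\<close> z(3) by simp
      ultimately show ?thesis using z(2) by simp
    qed
  qed
  have AEl: "AE z in lborel. z \<in> unit_disk \<longrightarrow> \<omega> z = \<omega>0 (cmod z)"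
  proof -
    have "unit_disk \<inter> space lborel \<in> sets (lborel :: complex measure)" by simp
    from AE_restrict_space_iff[OF this, of "\<lambda>z. \<omega> z = \<omega>0 (cmod z)"] show ?thesis using AER unfolding R_def by simp
  qed
  have wm: "\<omega> \<in> borel_measurable (lebesgue_on unit_disk)"
  proof -
    have "(\<lambda>z. indicator unit_disk z * \<omega>0 (cmod z)) \<in> borel_measurable lebesgue"
    proof (rule measurable_completion)
      have [measurable]: "(\<lambda>z::complex. \<omega>0 (cmod z)) \<in> borel_measurable borel"
        by measurable
      show "(\<lambda>z. indicator unit_disk z * \<omega>0 (cmod z)) \<in> borel_measurable lborel"
        unfolding measurable_lborel1 by (intro borel_measurable_times borel_measurable_indicator) auto
    qed
    moreover have "AE z in lebesgue. indicator unit_disk z * \<omega>0 (cmod z) = indicator unit_disk z * \<omega> z"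
    proof (rule AE_completion)
      show "AE z in lborel. indicator unit_disk z * \<omega>0 (cmod z) = indicator unit_disk z * \<omega> z"
        using AEl by eventually_elim (auto simp: indicator_def)
    qed
    ultimately have "(\<lambda>z. indicator unit_disk z * \<omega> z) \<in> borel_measurable lebesgue"
      by (rule borel_measurable_AE)
    moreover have "unit_disk \<inter> space lebesgue \<in> sets (lebesgue :: complex measure)" by simp
    ultimately show ?thesis by (simp only: borel_measurable_restrict_space_iff real_scaleR_def)
  qed
  have trans: "(\<integral>\<^sup>+ z. \<Phi> z * ennreal (\<omega> z) \<partial>disk_area) = (\<integral>\<^sup>+ z. \<Phi> z \<partial>M)" if \<Phi>: "\<Phi> \<in> borel_measurable disk_borel" for \<Phi>
  proof -
    have "measurable R borel = measurable disk_borel (borel :: ennreal measure)"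
      by (rule measurable_cong_sets) (simp_all add: R_def sets_restrict_space)
    then have \<Phi>R: "\<Phi> \<in> borel_measurable R" using \<Phi> by simp
    have \<Phi>I: "(\<lambda>z. \<Phi> z * indicator unit_disk z) \<in> borel_measurable borel"
      using \<Phi> by (subst (asm) borel_measurable_restrict_space_iff_ennreal) auto
    have \<Phi>L: "\<Phi> \<in> borel_measurable (lebesgue_on unit_disk)"
      using \<Phi>I by (subst borel_measurable_restrict_space_iff_ennreal) (auto intro: measurable_completion)
    have "(\<integral>\<^sup>+ z. \<Phi> z * ennreal (\<omega> z) \<partial>disk_area) = (\<integral>\<^sup>+ z. ennreal (1 / pi) * (\<Phi> z * ennreal (\<omega> z)) \<partial>lebesgue_on unit_disk)"
      unfolding disk_area_def using \<Phi>L wm by (intro nn_integral_density) auto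
    also have "\<dots> = (\<integral>\<^sup>+ z. ennreal (1 / pi) * (\<Phi> z * ennreal (\<omega> z)) * indicator unit_disk z \<partial>lebesgue)"
      by (rule nn_integral_restrict_space) simp
    also have "\<dots> = (\<integral>\<^sup>+ z. ennreal (1 / pi) * (\<Phi> z * ennreal (\<omega> z)) * indicator unit_disk z \<partial>lborel)"
      by (rule nn_integral_completion)
    also have "\<dots> = (\<integral>\<^sup>+ z. f (cmod z) * \<Phi> z * indicator unit_disk z \<partial>lborel)"
    proof (rule nn_integral_cong_AE)
      show "AE z in lborel. ennreal (1 / pi) * (\<Phi> z * ennreal (\<omega> z)) * indicator unit_disk z = f (cmod z) * \<Phi> z * indicator unit_disk z"
        using AEl
      proof eventually_elim
        case (elim z)
        have "f (cmod z) = ennreal (1 / pi) * ennreal (\<omega>0 (cmod z))"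
          unfolding f_def using w0n by (subst ennreal_mult[symmetric]) auto
        then show ?case using elim by (cases "z \<in> unit_disk") (simp_all add: mult_ac)
      qed
    qed
    also have "\<dots> = (\<integral>\<^sup>+ z. f (cmod z) * \<Phi> z \<partial>R)"
      unfolding R_def by (rule nn_integral_restrict_space[symmetric]) simp
    also have "\<dots> = (\<integral>\<^sup>+ z. \<Phi> z \<partial>M)"
    proof -
      have "(\<lambda>z. f (cmod z)) \<in> borel_measurable R" unfolding R_def by (rule measurable_restrict_space1) simp
      then show ?thesis unfolding M_def using \<Phi>R by (intro nn_integral_density[symmetric])
    qed
    finally show ?thesis .
  qed
  define H where "H = (\<lambda>r. \<integral>\<^sup>+ s. ennreal (\<omega>0 s) * indicator {r<..<1} s \<partial>lborel)"
  have Hw: "H r = ennreal (weight_hat \<omega> r)" "0 \<le> weight_hat \<omega> r" if r: "0 \<le> r" "r < 1" for r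
  proof -
    define F where "F = (\<lambda>s::real. indicator {0<..<1} s *\<^sub>R \<omega> (of_real s))"
    have Fi: "integrable lebesgue F" using \<omega> unfolding radial_weight_def set_integrable_def F_def by blast
    define Fr where "Fr = (\<lambda>s::real. indicator {r<..<1} s *\<^sub>R \<omega> (of_real s))"
    have FrF: "Fr = (\<lambda>s. indicator {r<..<1} s *\<^sub>R F s)" using r by (auto simp: Fr_def F_def indicator_def fun_eq_iff)
    have Fri: "integrable lebesgue Fr" unfolding FrF using Fi by (intro integrable_mult_indicator) auto
    have Fr0: "0 \<le> Fr s" for s
    proof (cases "s \<in> {r<..<1}")
      case True
      then have "of_real s \<in> unit_disk" using r by simp
      then have "0 < \<omega> (of_real s)" using \<omega> unfolding radial_weight_def by blast
      then show ?thesis by (simp add: Fr_def)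
    qed (simp add: Fr_def)
    have "ennreal (weight_hat \<omega> r) = (\<integral>\<^sup>+ s. ennreal (Fr s) \<partial>lebesgue)"
      unfolding weight_hat_def set_lebesgue_integral_def Fr_def[symmetric]
      by (rule nn_integral_eq_integral[OF Fri, symmetric]) (simp add: Fr0)
    also have "\<dots> = (\<integral>\<^sup>+ s. ennreal (Fr s) \<partial>lborel)" by (rule nn_integral_completion)
    also have "\<dots> = H r"
      unfolding H_def
    proof (rule nn_integral_cong_AE)
      show "AE s in lborel. ennreal (Fr s) = ennreal (\<omega>0 s) * indicator {r<..<1} s"
        using w0e by eventually_elim (use r in \<open>auto simp: Fr_def indicator_def split: if_splits\<close>)
    qed
    finally show "H r = ennreal (weight_hat \<omega> r)" by simp
    show "0 \<le> weight_hat \<omega> r" unfolding weight_hat_def set_lebesgue_integral_def Fr_def[symmetric]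
      by (rule integral_nonneg_AE) (simp add: Fr0)
  qed
  have Hpos: "0 < H r" if r: "0 \<le> r" "r < 1" for r
  proof (rule ccontr)
    assume "\<not> 0 < H r"
    then have "H r = 0" by simp
    then have "AE s in lborel. ennreal (\<omega>0 s) * indicator {r<..<1} s = 0"
      unfolding H_def by (subst (asm) nn_integral_0_iff_AE) auto
    with w0e have "AE s in lborel. s \<notin> {r<..<1}"
    proof eventually_elim
      case (elim s)
      show ?case
      proof
        assume s: "s \<in> {r<..<1}"
        then have "of_real s \<in> unit_disk" using r by simp
        then have "0 < \<omega> (of_real s)" using \<omega> unfolding radial_weight_def by blast
        then have "0 < \<omega>0 s" using elim(1) s r by simp
        then show False using elim(2) s by simp
      qed
    qed
    moreover have "{s \<in> space lborel. \<not> s \<notin> {r<..<1}} = {r<..<1}" by auto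
    ultimately have "emeasure lborel {r<..<1} = 0"
      using AE_iff_measurable[of "{r<..<1}" lborel "\<lambda>s. s \<notin> {r<..<1}"] by simp
    then show False using r by simp
  qed
  define T where "T = (\<lambda>r. emeasure M {z\<in>unit_disk. r \<le> cmod z})"
  have T: "T r = (\<integral>\<^sup>+ s. ennreal (2 * s) * ennreal (\<omega>0 s) * indicator ({r..} \<inter> {0..1}) s \<partial>lborel)" for r
    unfolding T_def M_def R_def radial_density_tail[OF fm]
  proof (intro nn_integral_cong)
    fix s :: real
    have "ennreal (2 * pi * s) * f s = ennreal (2 * s) * ennreal (\<omega>0 s)" if "0 \<le> s"
      using that w0n[of s] by (simp add: f_def ennreal_mult[symmetric])
    then show "ennreal (2 * pi * s) * f s * indicator ({r..} \<inter> {0..1}) s = ennreal (2 * s) * ennreal (\<omega>0 s) * indicator ({r..} \<inter> {0..1}) s"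
      by (auto simp: indicator_def)
  qed
  have T_le: "T r \<le> 2 * H r" if r: "0 \<le> r" "r < 1" for r
  proof -
    have "AE s in lborel. s \<noteq> r" "AE s in lborel. s \<noteq> (1::real)" by (rule AE_lborel_singleton)+
    then have "AE s in lborel. ennreal (2 * s) * ennreal (\<omega>0 s) * indicator ({r..} \<inter> {0..1}) s \<le> 2 * (ennreal (\<omega>0 s) * indicator {r<..<1} s)"
    proof eventually_elim
      case (elim s)
      show ?case
      proof (cases "s \<in> {r..} \<inter> {0..1}")
        case True
        then have "s \<in> {r<..<1}" using elim by auto
        moreover have "ennreal (2 * s) \<le> 2" using True by (simp add: ennreal_le_iff2 flip: ennreal_numeral)
        ultimately show ?thesis
          using mult_right_mono[of "ennreal (2 * s)" 2 "ennreal (\<omega>0 s)"] True by simp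
      qed simp
    qed
    then have "T r \<le> (\<integral>\<^sup>+ s. 2 * (ennreal (\<omega>0 s) * indicator {r<..<1} s) \<partial>lborel)"
      unfolding T by (rule nn_integral_mono_AE)
    also have "\<dots> = 2 * H r" unfolding H_def by (rule nn_integral_cmult) simp
    finally show ?thesis .
  qed
  have T_ge: "H r \<le> T r" if r: "1 / 2 \<le> r" "r < 1" for r
    unfolding H_def T
  proof (intro nn_integral_mono)
    fix s :: real
    show "ennreal (\<omega>0 s) * indicator {r<..<1} s \<le> ennreal (2 * s) * ennreal (\<omega>0 s) * indicator ({r..} \<inter> {0..1}) s"
    proof (cases "s \<in> {r<..<1}")
      case True
      then have "1 \<le> ennreal (2 * s)" using r by (simp flip: ennreal_1)
      from mult_right_mono[OF this, of "ennreal (\<omega>0 s)"] show ?thesis using True r by simp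
    qed simp
  qed
  have T_mono: "T r' \<le> T r" if "r \<le> r'" for r r'
    unfolding T by (intro nn_integral_mono) (use that in \<open>auto simp: indicator_def\<close>)
  have T0: "T 0 < \<infinity>"
  proof -
    have "T 0 \<le> 2 * ennreal (weight_hat \<omega> 0)" using T_le[of 0] Hw[of 0] by simp
    also have "\<dots> < \<infinity>" by (simp add: ennreal_mult_less_top)
    finally show ?thesis .
  qed
  have fin: "emeasure M (space M) \<noteq> \<infinity>"
  proof -
    have "space M = {z\<in>unit_disk. 0 \<le> cmod z}" by (auto simp: spM)
    then show ?thesis using T0 by (simp add: T_def)
  qed
  interpret M: finite_measure M by (rule finite_measureI) (rule fin)
  define w where "w = (\<lambda>\<delta>. measure M {z\<in>unit_disk. 1 - \<delta> \<le> cmod z})"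
  have wT: "ennreal (w \<delta>) = T (1 - \<delta>)" for \<delta> by (simp add: w_def T_def M.emeasure_eq_measure)
  have wpos: "0 < w \<delta>" if "0 < \<delta>" "\<delta> \<le> 1" for \<delta>
  proof -
    define d where "d = min \<delta> (1/2)"
    have "0 < H (1 - d)" using that by (intro Hpos) (auto simp: d_def)
    also have "\<dots> \<le> T (1 - d)" using that by (intro T_ge) (auto simp: d_def)
    also have "\<dots> \<le> T (1 - \<delta>)" by (intro T_mono) (auto simp: d_def)
    finally show ?thesis by (simp add: wT[symmetric])
  qed
  \<comment> \<open>The second argument of the maximum serves only the full disk, \<open>\<delta> = 1\<close>.\<close>
  define Cw where "Cw = max (2 * C) (w 1 / w (1/2))"
  have doubling: "w \<delta> \<le> Cw * w (\<delta> / 2)" if \<delta>: "0 < \<delta>" "\<delta> \<le> 1" for \<delta>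
  proof (cases "\<delta> = 1")
    case True
    have "w 1 = w 1 / w (1/2) * w (1/2)" using wpos[of "1/2"] by simp
    also have "\<dots> \<le> Cw * w (1/2)" using wpos[of "1/2"] by (intro mult_right_mono) (auto simp: Cw_def)
    finally show ?thesis using True by simp
  next
    case False
    then have \<delta>1: "\<delta> < 1" using \<delta> by simp
    have e1: "(1 + (1 - \<delta>)) / 2 = 1 - \<delta> / 2" by (simp add: field_simps)
    have "ennreal (w \<delta>) \<le> 2 * H (1 - \<delta>)" unfolding wT using \<delta> by (intro T_le) auto
    also have "\<dots> = ennreal (2 * weight_hat \<omega> (1 - \<delta>))"
      using Hw[of "1 - \<delta>"] \<delta> by (simp add: ennreal_mult)
    finally have a: "w \<delta> \<le> 2 * weight_hat \<omega> (1 - \<delta>)"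
      using Hw(2)[of "1 - \<delta>"] \<delta> by (simp add: ennreal_le_iff)
    have b: "weight_hat \<omega> (1 - \<delta>) \<le> C * weight_hat \<omega> (1 - \<delta> / 2)"
      using C(2)[of "1 - \<delta>"] \<delta> \<delta>1 unfolding e1 by simp
    have "ennreal (weight_hat \<omega> (1 - \<delta> / 2)) \<le> ennreal (w (\<delta> / 2))"
      using Hw(1)[of "1 - \<delta> / 2"] T_ge[of "1 - \<delta> / 2"] \<delta> wT[of "\<delta> / 2"] by simp
    then have c: "weight_hat \<omega> (1 - \<delta> / 2) \<le> w (\<delta> / 2)"
      by (simp add: w_def ennreal_le_iff)
    have "w \<delta> \<le> 2 * (C * weight_hat \<omega> (1 - \<delta> / 2))" using a b by linarith
    also have "\<dots> \<le> 2 * (C * w (\<delta> / 2))" using c C(1) by simp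
    also have "\<dots> \<le> Cw * w (\<delta> / 2)"
    proof -
      have "2 * C * w (\<delta> / 2) \<le> Cw * w (\<delta> / 2)" by (intro mult_right_mono) (auto simp: Cw_def w_def)
      then show ?thesis by simp
    qed
    finally show ?thesis .
  qed
  have "radial_doubling M Cw"
  proof (unfold_locales)
    show "sets M = sets disk_borel" by (rule sM)
    show "distr M disk_borel (\<lambda>z. cis t * z) = M" for t
      unfolding M_def R_def by (rule radial_density_rotation[OF fm])
    show "0 < measure M {z \<in> unit_disk. 1 - \<delta> \<le> cmod z}" if "0 < \<delta>" "\<delta> \<le> 1" for \<delta>
      using wpos[OF that] by (simp add: w_def)
    show "measure M {z \<in> unit_disk. 1 - \<delta> \<le> cmod z} \<le> Cw * measure M {z \<in> unit_disk. 1 - \<delta> / 2 \<le> cmod z}"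
      if "0 < \<delta>" "\<delta> \<le> 1" for \<delta>
      using doubling[OF that] by (simp add: w_def)
  qed
  moreover have "\<omega> \<in> borel_measurable disk_area" using wm by (simp add: disk_area_def)
  ultimately show ?thesis using that trans by blast
qed

section \<open>The spaces \<open>L\<^sup>q\<close> as quasi-normed spaces\<close>

lemma Lq_spaceI:
  assumes "g \<in> borel_measurable \<mu>" "(\<integral>\<^sup>+ z. ennreal (cmod (g z) powr q) \<partial>\<mu>) < \<infinity>"
  shows "g \<in> Lq_space \<mu> q"
  using assms by (auto simp: Lq_space_def intro!: integrableI_bounded)

lemma Lq_norm_nonneg: "0 \<le> Lq_norm \<mu> q g"
  by (simp add: Lq_norm_def)

lemma Lq_norm_powr:
  assumes "g \<in> Lq_space \<mu> q" "0 < q"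
  shows "ennreal (Lq_norm \<mu> q g powr q) = (\<integral>\<^sup>+ z. ennreal (cmod (g z) powr q) \<partial>\<mu>)"
proof -
  have i: "integrable \<mu> (\<lambda>z. cmod (g z) powr q)" using assms by (simp add: Lq_space_def)
  have "0 \<le> (LINT z|\<mu>. cmod (g z) powr q)" by (intro integral_nonneg_AE) simp
  then have "Lq_norm \<mu> q g powr q = (LINT z|\<mu>. cmod (g z) powr q)"
    using assms(2) by (simp add: Lq_norm_def powr_powr)
  then show ?thesis using nn_integral_eq_integral[OF i] by simp
qed

lemma Lq_norm_le:
  assumes "g \<in> Lq_space \<mu> q" "0 < q" "0 \<le> c" "(\<integral>\<^sup>+ z. ennreal (cmod (g z) powr q) \<partial>\<mu>) \<le> ennreal (c powr q)"
  shows "Lq_norm \<mu> q g \<le> c"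
proof -
  have "Lq_norm \<mu> q g powr q \<le> c powr q"
    using assms(4) unfolding Lq_norm_powr[OF assms(1,2), symmetric] by (simp add: ennreal_le_iff)
  then show ?thesis using assms(2,3) by (meson Lq_norm_nonneg not_le powr_less_mono2)
qed

lemma Lq_dominated:
  assumes "v \<in> Lq_space \<mu> q" "0 < q" "g \<in> borel_measurable \<mu>" "0 \<le> c"
    and le: "\<And>z. z \<in> space \<mu> \<Longrightarrow> cmod (g z) \<le> c * cmod (v z)"
  shows "g \<in> Lq_space \<mu> q" "Lq_norm \<mu> q g \<le> c * Lq_norm \<mu> q v"
proof -
  have [measurable]: "v \<in> borel_measurable \<mu>" using assms(1) by (simp add: Lq_space_def)
  have vm: "(\<lambda>z. ennreal (cmod (v z) powr q)) \<in> borel_measurable \<mu>" by measurable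
  have "(\<integral>\<^sup>+ z. ennreal (cmod (g z) powr q) \<partial>\<mu>) \<le> (\<integral>\<^sup>+ z. ennreal (c powr q) * ennreal (cmod (v z) powr q) \<partial>\<mu>)"
  proof (intro nn_integral_mono)
    fix z assume "z \<in> space \<mu>"
    then have "cmod (g z) powr q \<le> (c * cmod (v z)) powr q" using le assms(2) by (intro powr_mono2) auto
    then show "ennreal (cmod (g z) powr q) \<le> ennreal (c powr q) * ennreal (cmod (v z) powr q)"
      by (simp add: powr_mult ennreal_mult[symmetric] ennreal_leI)
  qed
  also have "\<dots> = ennreal (c powr q) * (\<integral>\<^sup>+ z. ennreal (cmod (v z) powr q) \<partial>\<mu>)"
    by (rule nn_integral_cmult[OF vm])
  also have "\<dots> = ennreal ((c * Lq_norm \<mu> q v) powr q)"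
    unfolding Lq_norm_powr[OF assms(1,2), symmetric] by (simp add: powr_mult ennreal_mult[symmetric])
  finally have le': "(\<integral>\<^sup>+ z. ennreal (cmod (g z) powr q) \<partial>\<mu>) \<le> ennreal ((c * Lq_norm \<mu> q v) powr q)" .
  then show "g \<in> Lq_space \<mu> q" using assms(3) by (intro Lq_spaceI) (auto intro: le_less_trans)
  then show "Lq_norm \<mu> q g \<le> c * Lq_norm \<mu> q v"
    using le' assms(2,4) by (intro Lq_norm_le) (auto simp: Lq_norm_nonneg)
qed

lemma powr_add_le_two:
  fixes x y q :: real
  assumes "0 \<le> x" "0 \<le> y" "0 < q"
  shows "(x + y) powr q \<le> 2 powr q * (x powr q + y powr q)"
proof -
  have "(x + y) powr q \<le> (2 * max x y) powr q" using assms by (intro powr_mono2) auto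
  also have "\<dots> = 2 powr q * max x y powr q" by (rule powr_mult)
  also have "\<dots> \<le> 2 powr q * (x powr q + y powr q)"
    by (intro mult_left_mono) (auto simp: max_def)
  finally show ?thesis .
qed

text \<open>A quasi-triangle inequality is enough for estimates up to constants.\<close>

lemma Lq_add:
  assumes "f \<in> Lq_space \<mu> q" "g \<in> Lq_space \<mu> q" "1 \<le> q"
  shows "(\<lambda>z. f z + g z) \<in> Lq_space \<mu> q"
    "Lq_norm \<mu> q (\<lambda>z. f z + g z) \<le> 4 * (Lq_norm \<mu> q f + Lq_norm \<mu> q g)"
proof -
  have q: "0 < q" using assms by simp
  have [measurable]: "f \<in> borel_measurable \<mu>" "g \<in> borel_measurable \<mu>" using assms by (auto simp: Lq_space_def)
  define m where "m = Lq_norm \<mu> q f + Lq_norm \<mu> q g"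
  have m: "0 \<le> m" "Lq_norm \<mu> q f \<le> m" "Lq_norm \<mu> q g \<le> m" by (auto simp: m_def Lq_norm_nonneg)
  have "(\<integral>\<^sup>+ z. ennreal (cmod (f z + g z) powr q) \<partial>\<mu>) \<le> (\<integral>\<^sup>+ z. ennreal (2 powr q) * (ennreal (cmod (f z) powr q) + ennreal (cmod (g z) powr q)) \<partial>\<mu>)"
  proof (intro nn_integral_mono)
    fix z
    have "cmod (f z + g z) powr q \<le> (cmod (f z) + cmod (g z)) powr q"
      using q by (intro powr_mono2 norm_triangle_ineq) auto
    also have "\<dots> \<le> 2 powr q * (cmod (f z) powr q + cmod (g z) powr q)" by (rule powr_add_le_two) (use q in auto)
    finally show "ennreal (cmod (f z + g z) powr q) \<le> ennreal (2 powr q) * (ennreal (cmod (f z) powr q) + ennreal (cmod (g z) powr q))"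
      by (simp add: ennreal_plus[symmetric] ennreal_mult[symmetric] ennreal_leI del: ennreal_plus)
  qed
  also have "\<dots> = ennreal (2 powr q) * (\<integral>\<^sup>+ z. (ennreal (cmod (f z) powr q) + ennreal (cmod (g z) powr q)) \<partial>\<mu>)"
    by (rule nn_integral_cmult) measurable
  also have "(\<integral>\<^sup>+ z. (ennreal (cmod (f z) powr q) + ennreal (cmod (g z) powr q)) \<partial>\<mu>) = ennreal (Lq_norm \<mu> q f powr q) + ennreal (Lq_norm \<mu> q g powr q)"
    unfolding Lq_norm_powr[OF assms(1) q] Lq_norm_powr[OF assms(2) q] by (rule nn_integral_add) measurable
  also have "ennreal (2 powr q) * (ennreal (Lq_norm \<mu> q f powr q) + ennreal (Lq_norm \<mu> q g powr q)) = ennreal (2 powr q * (Lq_norm \<mu> q f powr q + Lq_norm \<mu> q g powr q))"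
    by (simp add: ennreal_plus[symmetric] ennreal_mult[symmetric] del: ennreal_plus)
  also have "\<dots> \<le> ennreal ((4 * m) powr q)"
  proof (rule ennreal_leI)
    have "Lq_norm \<mu> q f powr q + Lq_norm \<mu> q g powr q \<le> m powr q + m powr q"
      using m q by (intro add_mono powr_mono2) (auto simp: Lq_norm_nonneg)
    also have "\<dots> = 2 powr 1 * m powr q" by simp
    also have "\<dots> \<le> 2 powr q * m powr q" using assms(3) by (intro mult_right_mono powr_mono) auto
    finally have "2 powr q * (Lq_norm \<mu> q f powr q + Lq_norm \<mu> q g powr q) \<le> 2 powr q * (2 powr q * m powr q)"
      by (intro mult_left_mono) auto
    also have "\<dots> = (2 * (2 * m)) powr q" by (simp only: powr_mult)
    finally show "2 powr q * (Lq_norm \<mu> q f powr q + Lq_norm \<mu> q g powr q) \<le> (4 * m) powr q" by simp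
  qed
  finally have le: "(\<integral>\<^sup>+ z. ennreal (cmod (f z + g z) powr q) \<partial>\<mu>) \<le> ennreal ((4 * m) powr q)" .
  then show 1: "(\<lambda>z. f z + g z) \<in> Lq_space \<mu> q" by (intro Lq_spaceI) (auto intro: le_less_trans)
  show "Lq_norm \<mu> q (\<lambda>z. f z + g z) \<le> 4 * (Lq_norm \<mu> q f + Lq_norm \<mu> q g)"
    unfolding m_def[symmetric] by (rule Lq_norm_le[OF 1 q _ le]) (use m in simp)
qed

lemma Lq_scale:
  assumes "f \<in> Lq_space \<mu> q" "1 \<le> q"
  shows "(\<lambda>z. c * f z) \<in> Lq_space \<mu> q" "Lq_norm \<mu> q (\<lambda>z. c * f z) \<le> cmod c * Lq_norm \<mu> q f"
  using Lq_dominated[of f \<mu> q "\<lambda>z. c * f z" "cmod c"] assms by (auto simp: norm_mult Lq_space_def)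

lemma Lq_diff:
  assumes "f \<in> Lq_space \<mu> q" "g \<in> Lq_space \<mu> q" "1 \<le> q"
  shows "(\<lambda>z. f z - g z) \<in> Lq_space \<mu> q"
    "Lq_norm \<mu> q (\<lambda>z. f z - g z) \<le> 4 * (Lq_norm \<mu> q f + Lq_norm \<mu> q g)"
  using Lq_add[OF assms(1) Lq_scale(1)[OF assms(2,3), of "-1"] assms(3)] Lq_scale(2)[OF assms(2,3), of "-1"] by auto

section \<open>Carleson squares\<close>

lemma Re_of_real_divide_pos:
  fixes v :: complex
  assumes "0 < c" "0 < Re v"
  shows "0 < Re (of_real c / v)"
proof -
  have "0 < (Re v)\<^sup>2 + (Im v)\<^sup>2" using assms by (simp add: sum_power2_gt_zero_iff)
  then show ?thesis using assms by (simp add: Re_divide)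
qed

text \<open>A description without arguments of points; it exhibits the square as a Borel set.\<close>

lemma carleson_square_eq:
  assumes a: "0 < cmod a" "cmod a < 1"
  shows "carleson_square a = {z. cmod a \<le> cmod z \<and> cmod z < 1 \<and> cmod a * cmod z * cos ((1 - cmod a) / 2) \<le> Re (a * cnj z)}"
proof -
  define \<eta> where "\<eta> = (1 - cmod a) / 2"
  have \<eta>: "0 \<le> \<eta>" using a unfolding \<eta>_def by simp
  have "1 - cmod a \<le> 2" using norm_ge_zero[of a] by linarith
  then have "\<eta> \<le> 1" unfolding \<eta>_def by simp
  also have "1 \<le> pi" using pi_gt3 by simp
  finally have "\<eta> \<le> pi" .
  note \<eta> = \<eta> this
  have arg: "\<bar>Arg w\<bar> \<le> \<eta> \<longleftrightarrow> cmod w * cos \<eta> \<le> Re w" if w: "w \<noteq> 0" for w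
  proof -
    have "Re w = cmod w * cos (Arg w)" using rcis_cmod_Arg[of w] by (metis Re_rcis)
    also have "cos (Arg w) = cos \<bar>Arg w\<bar>" by simp
    finally have "cmod w * cos \<eta> \<le> Re w \<longleftrightarrow> cos \<eta> \<le> cos \<bar>Arg w\<bar>" using w by simp
    also have "\<dots> \<longleftrightarrow> \<bar>Arg w\<bar> \<le> \<eta>" using \<eta> Arg_bounded[of w] by (intro cos_mono_le_eq) auto
    finally show ?thesis by simp
  qed
  have "z \<in> carleson_square a \<longleftrightarrow> cmod a \<le> cmod z \<and> cmod z < 1 \<and> cmod (a * cnj z) * cos \<eta> \<le> Re (a * cnj z)" for z
  proof
    assume "z \<in> carleson_square a"
    then obtain r t \<theta> where z: "z = of_real r * cis t" "cmod a \<le> r" "r < 1" "cis t = cis \<theta>" "\<bar>Arg (a * cis (- \<theta>))\<bar> \<le> \<eta>"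
      unfolding carleson_square_def carleson_arc_def \<eta>_def by auto
    have r: "0 < r" using z(2) a(1) by linarith
    define b where "b = a * cis (- \<theta>)"
    have zb: "a * cnj z = of_real r * b" using z by (simp add: cis_cnj b_def)
    have e1: "cmod (a * cnj z) = r * cmod b" unfolding zb norm_mult using r by simp
    have e2: "Re (a * cnj z) = r * Re b" unfolding zb by simp
    have "b \<noteq> 0" using a by (auto simp: b_def)
    moreover have "\<bar>Arg b\<bar> \<le> \<eta>" using z(5) by (simp only: b_def)
    ultimately have "cmod b * cos \<eta> \<le> Re b" using arg by blast
    then have "r * (cmod b * cos \<eta>) \<le> r * Re b" using r by (intro mult_left_mono) auto
    moreover have "cmod z = r" using z(1) r by (simp add: norm_mult)
    ultimately show "cmod a \<le> cmod z \<and> cmod z < 1 \<and> cmod (a * cnj z) * cos \<eta> \<le> Re (a * cnj z)"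
      unfolding e1 e2 using z(2,3) by (simp only: mult.assoc)
  next
    assume z: "cmod a \<le> cmod z \<and> cmod z < 1 \<and> cmod (a * cnj z) * cos \<eta> \<le> Re (a * cnj z)"
    define t where "t = Arg z"
    define r where "r = cmod z"
    have r: "0 < r" "cmod a \<le> r" "r < 1" using z a by (auto simp: r_def)
    have zr: "z = of_real r * cis t" using rcis_cmod_Arg[of z] by (simp add: rcis_def r_def t_def)
    define b where "b = a * cis (- t)"
    have zb: "a * cnj z = of_real r * b" unfolding b_def by (subst zr) (simp add: cis_cnj)
    have e1: "cmod (a * cnj z) = r * cmod b" unfolding zb norm_mult using r by simp
    have e2: "Re (a * cnj z) = r * Re b" unfolding zb by simp
    have "r * (cmod b * cos \<eta>) \<le> r * Re b"
      using z unfolding e1 e2 by (simp only: mult.assoc)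
    then have "cmod b * cos \<eta> \<le> Re b" using r(1) by (rule mult_left_le_imp_le)
    then have "cmod (a * cis (- t)) * cos \<eta> \<le> Re (a * cis (- t))" by (simp only: b_def)
    moreover have "a * cis (- t) \<noteq> 0" using a by auto
    ultimately have "\<bar>Arg (a * cis (- t))\<bar> \<le> \<eta>" using arg by blast
    then show "z \<in> carleson_square a"
      unfolding carleson_square_def carleson_arc_def \<eta>_def using zr r by blast
  qed
  then show ?thesis by (auto simp: \<eta>_def norm_mult)
qed

text \<open>A Carleson square is comparable to a disk centred at the projection of \<open>a\<close>, which is why disks can replace
  squares throughout.\<close>

lemma carleson_square_sandwich:
  assumes a: "1 / 4 \<le> cmod a" "cmod a < 1" and \<zeta>: "cmod \<zeta> = 1" "a = of_real (cmod a) * \<zeta>"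
  shows "ball \<zeta> ((1 - cmod a) / 16) \<inter> unit_disk \<subseteq> carleson_square a"
    "carleson_square a \<subseteq> ball \<zeta> (2 * (1 - cmod a)) \<inter> unit_disk"
proof -
  define \<delta> where "\<delta> = 1 - cmod a"
  have \<delta>: "0 < \<delta>" "\<delta> \<le> 3/4" using a by (auto simp: \<delta>_def)
  have a0: "0 < cmod a" using a(1) by linarith
  have eq: "carleson_square a = {z. cmod a \<le> cmod z \<and> cmod z < 1 \<and> cmod a * cmod z * cos ((1 - cmod a) / 2) \<le> Re (a * cnj z)}"
    by (rule carleson_square_eq[OF a0 a(2)])
  have polar: "\<exists>x. \<bar>x\<bar> \<le> pi \<and> dist \<zeta> z = cmod (1 - of_real (cmod z) * cis x)
      \<and> Re (a * cnj z) = cmod a * cmod z * cos \<bar>x\<bar>" for z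
  proof -
    define x where "x = Arg (\<zeta> * cnj z)"
    have e: "\<zeta> * cnj z = of_real (cmod z) * cis x" using rcis_cmod_Arg[of "\<zeta> * cnj z"] \<zeta>(1) by (simp add: rcis_def x_def norm_mult)
    have cz: "\<zeta> * cnj \<zeta> = 1" using \<zeta>(1) by (metis complex_norm_square of_real_1 one_power2)
    have "dist \<zeta> z = cmod (cnj (\<zeta> - z))" unfolding complex_mod_cnj by (rule dist_norm)
    also have "\<dots> = cmod (\<zeta> * (cnj \<zeta> - cnj z))" using \<zeta>(1) by (simp only: norm_mult) simp
    also have "\<zeta> * (cnj \<zeta> - cnj z) = 1 - of_real (cmod z) * cis x" using e cz by (simp add: right_diff_distrib)
    finally have d: "dist \<zeta> z = cmod (1 - of_real (cmod z) * cis x)" .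
    have "a * cnj z = of_real (cmod a) * (\<zeta> * cnj z)" by (subst \<zeta>(2)) simp
    then have "a * cnj z = of_real (cmod a * cmod z) * cis x" unfolding e by simp
    then have "Re (a * cnj z) = cmod a * cmod z * cos \<bar>x\<bar>" by simp
    moreover have "\<bar>x\<bar> \<le> pi" using Arg_bounded[of "\<zeta> * cnj z"] by (simp add: x_def abs_le_iff)
    ultimately show ?thesis using d by blast
  qed
  show "ball \<zeta> ((1 - cmod a) / 16) \<inter> unit_disk \<subseteq> carleson_square a"
  proof
    fix z assume z: "z \<in> ball \<zeta> ((1 - cmod a) / 16) \<inter> unit_disk"
    obtain x where x: "\<bar>x\<bar> \<le> pi" "dist \<zeta> z = cmod (1 - of_real (cmod z) * cis x)" "Re (a * cnj z) = cmod a * cmod z * cos \<bar>x\<bar>"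
      using polar by blast
    have d: "dist \<zeta> z < \<delta> / 16" using z by (simp add: \<delta>_def)
    have "1 - cmod z \<le> dist \<zeta> z" using norm_triangle_ineq2[of \<zeta> z] \<zeta>(1) by (simp add: dist_norm)
    then have zz: "1 - \<delta> / 16 < cmod z" using d by linarith
    then have "\<bar>x\<bar> / 8 \<le> dist \<zeta> z" unfolding x(2) using x(1) \<delta> by (intro norm_one_minus_polar_ge) auto
    then have "\<bar>x\<bar> \<le> \<delta> / 2" using d by linarith
    then have "cos (\<delta> / 2) \<le> cos \<bar>x\<bar>" using \<delta> pi_gt3 by (intro cos_monotone_0_pi_le) auto
    then have "cmod a * cmod z * cos ((1 - cmod a) / 2) \<le> Re (a * cnj z)"
      unfolding x(3) \<delta>_def by (intro mult_left_mono) auto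
    moreover have "cmod a \<le> cmod z"
    proof -
      have "cmod a = 1 - \<delta>" by (simp add: \<delta>_def)
      then show ?thesis using zz \<delta> by linarith
    qed
    ultimately show "z \<in> carleson_square a" using z unfolding eq by simp
  qed
  show "carleson_square a \<subseteq> ball \<zeta> (2 * (1 - cmod a)) \<inter> unit_disk"
  proof
    fix z assume z: "z \<in> carleson_square a"
    then have z1: "cmod a \<le> cmod z" "cmod z < 1" "cmod a * cmod z * cos (\<delta> / 2) \<le> Re (a * cnj z)"
      unfolding eq by (auto simp: \<delta>_def)
    obtain x where x: "\<bar>x\<bar> \<le> pi" "dist \<zeta> z = cmod (1 - of_real (cmod z) * cis x)" "Re (a * cnj z) = cmod a * cmod z * cos \<bar>x\<bar>"
      using polar by blast
    have "0 < cmod z" using a0 z1(1) by linarith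
    then have "0 < cmod a * cmod z" using a0 by (rule mult_pos_pos[rotated])
    with z1(3) have "cos (\<delta> / 2) \<le> cos \<bar>x\<bar>" unfolding x(3) by (rule mult_left_le_imp_le)
    then have xs: "\<bar>x\<bar> \<le> \<delta> / 2" using x(1) \<delta> pi_gt3 by (subst (asm) cos_mono_le_eq) auto
    have "cmod (1 - of_real (cmod z) * cis x) = cmod (of_real (1 - cmod z) + of_real (cmod z) * (1 - cis x))"
      by (simp add: algebra_simps)
    also have "\<dots> \<le> (1 - cmod z) + cmod z * cmod (1 - cis x)"
      by (rule order_trans[OF norm_triangle_ineq]) (use z1 in \<open>simp add: norm_mult del: of_real_diff\<close>)
    also have "\<dots> \<le> \<delta> + 1 * \<bar>x\<bar>"
      by (intro add_mono mult_mono norm_one_minus_cis_le) (use z1 in \<open>auto simp: \<delta>_def\<close>)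
    also have "\<dots> < 2 * \<delta>" using xs \<delta> by simp
    finally show "z \<in> ball \<zeta> (2 * (1 - cmod a)) \<inter> unit_disk" using x(2) z1 by (simp add: \<delta>_def)
  qed
qed

section \<open>Test functions in the weighted Bergman space\<close>

text \<open>The measure \<open>M\<close> is \<open>\<omega> dA\<close> on Borel sets of the disk, where \<open>dA\<close> is \<^const>\<open>disk_area\<close>.\<close>

locale weighted_bergman = radial_doubling +
  fixes \<omega> :: "complex \<Rightarrow> real" and p q :: real
  assumes nn_integral_weight: "\<And>\<Phi>. \<Phi> \<in> borel_measurable disk_borel \<Longrightarrow>
       (\<integral>\<^sup>+ z. \<Phi> z * ennreal (\<omega> z) \<partial>disk_area) = (\<integral>\<^sup>+ z. \<Phi> z \<partial>M)"
    and weight_measurable: "\<omega> \<in> borel_measurable disk_area"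
    and weight_pos: "\<And>z. z \<in> unit_disk \<Longrightarrow> 0 < \<omega> z"
    and p1: "1 \<le> p" and pq: "p \<le> q"
begin

abbreviation Y where "Y \<equiv> bergman_space \<omega> p"
abbreviation nY where "nY \<equiv> bergman_norm \<omega> p"

lemma p_pos: "0 < p" and q_pos: "0 < q" and q1: "1 \<le> q" and s1: "1 \<le> q / p"
  using p1 pq by auto

lemma space_disk_area: "space disk_area = unit_disk"
  by (simp add: disk_area_def)

lemma weighted_integral:
  assumes h: "h \<in> borel_measurable disk_borel" "\<And>z. 0 \<le> h z"
  shows "integrable disk_area (\<lambda>z. h z * \<omega> z) \<longleftrightarrow> (\<integral>\<^sup>+ z. ennreal (h z) \<partial>M) < \<infinity>"
    "(LINT z|disk_area. h z * \<omega> z) = (LINT z|M. h z)"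
proof -
  have hd: "h \<in> borel_measurable disk_area"
  proof -
    have "(\<lambda>z. indicator unit_disk z *\<^sub>R h z) \<in> borel_measurable borel"
      using h(1) by (subst (asm) borel_measurable_restrict_space_iff) auto
    then have "(\<lambda>z. indicator unit_disk z *\<^sub>R h z) \<in> borel_measurable lebesgue" by (intro measurable_completion) simp
    moreover have "unit_disk \<inter> space lebesgue \<in> sets (lebesgue :: complex measure)" by simp
    ultimately have "h \<in> borel_measurable (lebesgue_on unit_disk)"
      by (simp only: borel_measurable_restrict_space_iff)
    then show ?thesis by (simp add: disk_area_def)
  qed
  have m: "(\<lambda>z. h z * \<omega> z) \<in> borel_measurable disk_area" using hd weight_measurable by measurable
  have "(\<integral>\<^sup>+ z. ennreal (h z * \<omega> z) \<partial>disk_area) = (\<integral>\<^sup>+ z. ennreal (h z) * ennreal (\<omega> z) \<partial>disk_area)"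
    by (intro nn_integral_cong ennreal_mult h less_imp_le weight_pos) (simp add: space_disk_area)
  also have "\<dots> = (\<integral>\<^sup>+ z. ennreal (h z) \<partial>M)" using h(1) by (intro nn_integral_weight) simp
  finally have nn: "(\<integral>\<^sup>+ z. ennreal (h z * \<omega> z) \<partial>disk_area) = (\<integral>\<^sup>+ z. ennreal (h z) \<partial>M)" .
  have nng: "AE z in disk_area. 0 \<le> h z * \<omega> z"
    by (intro AE_I2 mult_nonneg_nonneg h less_imp_le weight_pos) (simp add: space_disk_area)
  show "integrable disk_area (\<lambda>z. h z * \<omega> z) \<longleftrightarrow> (\<integral>\<^sup>+ z. ennreal (h z) \<partial>M) < \<infinity>"
  proof
    assume "integrable disk_area (\<lambda>z. h z * \<omega> z)"
    from nn_integral_eq_integral[OF this nng] show "(\<integral>\<^sup>+ z. ennreal (h z) \<partial>M) < \<infinity>" unfolding nn by simp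
  next
    assume "(\<integral>\<^sup>+ z. ennreal (h z) \<partial>M) < \<infinity>"
    then show "integrable disk_area (\<lambda>z. h z * \<omega> z)" unfolding nn[symmetric] by (rule integrableI_nonneg[OF m nng])
  qed
  have hM: "h \<in> borel_measurable M" using h(1) by (simp add: measurable_M_eq)
  show "(LINT z|disk_area. h z * \<omega> z) = (LINT z|M. h z)"
    unfolding integral_eq_nn_integral[OF m nng] nn
    by (rule integral_eq_nn_integral[OF hM, symmetric]) (simp add: h)
qed

lemma bergman_space_iff: "f \<in> Y \<longleftrightarrow> f holomorphic_on unit_disk \<and> f \<in> Lq_space M p"
proof (cases "f holomorphic_on unit_disk")
  case True
  have fm: "f \<in> borel_measurable disk_borel" using holomorphic_measurable[OF True] by (simp add: measurable_M_eq)
  have hm: "(\<lambda>z. cmod (f z) powr p) \<in> borel_measurable disk_borel" using fm by measurable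
  have "f \<in> Lq_space M p \<longleftrightarrow> integrable M (\<lambda>z. cmod (f z) powr p)"
    using fm by (simp add: Lq_space_def measurable_M_eq)
  also have "\<dots> \<longleftrightarrow> (\<integral>\<^sup>+ z. ennreal (cmod (f z) powr p) \<partial>M) < \<infinity>"
    using hm by (subst integrable_iff_bounded) (simp add: measurable_M_eq)
  also have "\<dots> \<longleftrightarrow> integrable disk_area (\<lambda>z. cmod (f z) powr p * \<omega> z)"
    using weighted_integral(1)[OF hm] by simp
  finally show ?thesis using True by (simp add: bergman_space_def)
qed (simp add: bergman_space_def)

lemma bergman_norm_eq: "f holomorphic_on unit_disk \<Longrightarrow> nY f = Lq_norm M p f"
proof -
  assume "f holomorphic_on unit_disk"
  then have fm: "f \<in> borel_measurable disk_borel" using holomorphic_measurable by (simp add: measurable_M_eq)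
  have hm: "(\<lambda>z. cmod (f z) powr p) \<in> borel_measurable disk_borel" using fm by measurable
  show ?thesis unfolding bergman_norm_def Lq_norm_def using weighted_integral(2)[OF hm] by simp
qed

lemma bergman_norm_powr: "f \<in> Y \<Longrightarrow> ennreal (nY f powr p) = (\<integral>\<^sup>+ z. ennreal (cmod (f z) powr p) \<partial>M)"
  using bergman_norm_eq Lq_norm_powr[of f M p] p_pos by (simp add: bergman_space_iff)

lemma bergman_norm_nonneg: "0 \<le> nY f" by (simp add: bergman_norm_def)

lemma bergman_lincomb:
  assumes "f \<in> Y" "g \<in> Y"
  shows "(\<lambda>z. c * f z + d * g z) \<in> Y" "nY (\<lambda>z. c * f z + d * g z) \<le> 4 * (cmod c * nY f + cmod d * nY g)"
proof -
  have h: "f holomorphic_on unit_disk" "g holomorphic_on unit_disk" "f \<in> Lq_space M p" "g \<in> Lq_space M p"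
    using assms by (auto simp: bergman_space_iff)
  have hl: "(\<lambda>z. c * f z + d * g z) holomorphic_on unit_disk" using h by (intro holomorphic_intros)
  note sc = Lq_scale[OF h(3) p1, of c] Lq_scale[OF h(4) p1, of d]
  have ad: "(\<lambda>z. c * f z + d * g z) \<in> Lq_space M p"
    "Lq_norm M p (\<lambda>z. c * f z + d * g z) \<le> 4 * (Lq_norm M p (\<lambda>z. c * f z) + Lq_norm M p (\<lambda>z. d * g z))"
    using Lq_add[OF sc(1) sc(3) p1] by auto
  show "(\<lambda>z. c * f z + d * g z) \<in> Y" using hl ad by (simp add: bergman_space_iff)
  show "nY (\<lambda>z. c * f z + d * g z) \<le> 4 * (cmod c * nY f + cmod d * nY g)"
    unfolding bergman_norm_eq[OF hl] bergman_norm_eq[OF h(1)] bergman_norm_eq[OF h(2)] 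
    by (rule order_trans[OF ad(2)]) (intro mult_left_mono add_mono sc(2,4), simp)
qed

lemma bergman_const: "(\<lambda>_. c) \<in> Y"
  by (auto simp: bergman_space_iff Lq_space_def)

lemma bergman_point:
  assumes f: "f \<in> Y" and w: "cmod w \<le> r" "r < 1"
  shows "cmod (f w) powr p \<le> 2 / ((1 - r) * tail ((1 - r) / 2)) * nY f powr p"
  using point_estimate[of f p w r "nY f powr p"] f w p_pos bergman_norm_powr[OF f] by (simp add: bergman_space_iff)

text \<open>Functions in the Bergman space at distance zero agree on the disk, so point evaluations, and hence the
  truncated operators below, are well defined on classes.\<close>

lemma bergman_null:
  assumes "f \<in> Y" "nY f = 0" "cmod w < 1"
  shows "f w = 0"
  using bergman_point[of f w "cmod w"] assms by simp

lemma weight_square_eq: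
  assumes a: "0 < cmod a" "cmod a < 1"
  shows "weight_square \<omega> a = measure M (carleson_square a)" "carleson_square a \<in> sets M"
proof -
  let ?S = "carleson_square a"
  have "{z. cmod a \<le> cmod z \<and> cmod a * cmod z * cos ((1 - cmod a) / 2) \<le> Re (a * cnj z)} \<in> sets borel"
  proof -
    have "closed {z. cmod a \<le> cmod z \<and> cmod a * cmod z * cos ((1 - cmod a) / 2) \<le> Re (a * cnj z)}"
      by (intro closed_Collect_conj closed_Collect_le continuous_intros)
    then show ?thesis by simp
  qed
  then have "{z. cmod a \<le> cmod z \<and> cmod a * cmod z * cos ((1 - cmod a) / 2) \<le> Re (a * cnj z)} \<inter> unit_disk \<in> sets M"
    by (rule borel_Int_disk)
  also have "{z. cmod a \<le> cmod z \<and> cmod a * cmod z * cos ((1 - cmod a) / 2) \<le> Re (a * cnj z)} \<inter> unit_disk = ?S"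
    unfolding carleson_square_eq[OF a] by auto
  finally show S: "?S \<in> sets M" .
  have "weight_square \<omega> a = (LINT z|disk_area. indicator ?S z * \<omega> z)"
    by (simp add: weight_square_def set_lebesgue_integral_def)
  also have "\<dots> = (LINT z|M. indicator ?S z)"
    by (rule weighted_integral(2)) (use S sets_M in auto)
  also have "\<dots> = measure M ?S" using S by simp
  finally show "weight_square \<omega> a = measure M ?S" .
qed

lemma weight_square_bounds:
  assumes a: "1 / 4 \<le> cmod a" "cmod a < 1"
  shows "cap (1 - cmod a) \<le> cap_const ^ 4 * weight_square \<omega> a"
    "weight_square \<omega> a \<le> cap_const * cap (1 - cmod a)" "0 < weight_square \<omega> a"
proof -
  have a0: "0 < cmod a" using a(1) by linarith
  obtain \<zeta> where \<zeta>: "cmod \<zeta> = 1" "a = of_real (cmod a) * \<zeta>" using exists_radial_projection by blast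
  note sw = carleson_square_sandwich[OF a \<zeta>]
  note ws = weight_square_eq[OF a0 a(2)]
  define \<delta> where "\<delta> = 1 - cmod a"
  have \<delta>: "0 < \<delta>" using a by (simp add: \<delta>_def)
  have l: "cap (\<delta> / 16) \<le> weight_square \<omega> a"
    unfolding ws(1) measure_ball_eq_cap[OF \<zeta>(1), symmetric] \<delta>_def by (rule finite_measure_mono[OF sw(1) ws(2)])
  have "cap \<delta> \<le> cap_const ^ 4 * cap (\<delta> / 16)" using cap_iterate[of "\<delta> / 16" 4] \<delta> by simp
  also have "\<dots> \<le> cap_const ^ 4 * weight_square \<omega> a" using l cap_const_ge by (intro mult_left_mono) auto
  finally show "cap (1 - cmod a) \<le> cap_const ^ 4 * weight_square \<omega> a" by (simp add: \<delta>_def)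
  show "0 < weight_square \<omega> a" using l cap_pos[of "\<delta> / 16"] \<delta> by simp
  have "weight_square \<omega> a \<le> cap (2 * \<delta>)"
    unfolding ws(1) measure_ball_eq_cap[OF \<zeta>(1), symmetric] \<delta>_def
    by (rule finite_measure_mono[OF sw(2)]) (intro borel_Int_disk, simp)
  also have "\<dots> \<le> cap_const * cap \<delta>" by (rule cap_double[OF \<delta>])
  finally show "weight_square \<omega> a \<le> cap_const * cap (1 - cmod a)" by (simp add: \<delta>_def)
qed

lemma Re_one_minus_pos:
  assumes "cmod a < 1" "cmod z < 1"
  shows "0 < Re (1 - cnj a * z)"
proof -
  have "Re (cnj a * z) \<le> cmod (cnj a * z)" by (rule complex_Re_le_cmod)
  also have "\<dots> \<le> cmod a * 1" unfolding norm_mult by (intro mult_mono) (use assms in auto)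
  finally show ?thesis using assms by simp
qed

lemma test_fun_powr:
  assumes a: "1 / 4 \<le> cmod a" "cmod a < 1" and z: "cmod z < 1"
  shows "cmod (test_fun \<omega> a p \<gamma> z) powr p = ((1 - (cmod a)\<^sup>2) / cmod (1 - cnj a * z)) powr (\<gamma> + 1) / weight_square \<omega> a"
proof -
  have ws: "0 < weight_square \<omega> a" by (rule weight_square_bounds(3)[OF a])
  have num: "0 \<le> 1 - (cmod a)\<^sup>2" using a by (simp add: abs_square_le_1)
  have e: "cmod (of_real (1 - (cmod a)\<^sup>2) / (1 - cnj a * z)) = (1 - (cmod a)\<^sup>2) / cmod (1 - cnj a * z)"
    using num unfolding norm_divide norm_of_real by simp
  have "cmod (test_fun \<omega> a p \<gamma> z) = ((1 - (cmod a)\<^sup>2) / cmod (1 - cnj a * z)) powr ((\<gamma> + 1) / p) * (1 / weight_square \<omega> a powr (1 / p))"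
  proof -
    have n: "cmod (B powr of_real x) = cmod B powr x" for B :: complex and x :: real
      by (simp add: norm_powr_real_powr')
    show ?thesis unfolding test_fun_def norm_mult n e norm_of_real by simp
  qed
  moreover have "(weight_square \<omega> a powr (1 / p)) powr p = weight_square \<omega> a"
    using ws p_pos by (simp add: powr_powr)
  moreover have "(x powr ((\<gamma> + 1) / p)) powr p = x powr (\<gamma> + 1)" for x :: real
    using p_pos by (simp add: powr_powr)
  ultimately show ?thesis by (simp only: powr_divide times_divide_eq_right mult_1_right)
qed

lemma test_fun_holomorphic:
  assumes a: "cmod a < 1"
  shows "test_fun \<omega> a p \<gamma> holomorphic_on unit_disk"
proof -
  have num: "0 < 1 - (cmod a)\<^sup>2" using a by (simp add: abs_square_less_1)
  have pos: "0 < Re (of_real (1 - (cmod a)\<^sup>2) / (1 - cnj a * z))" if "cmod z < 1" for z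
  proof -
    have "0 < Re (1 - cnj a * z)" by (rule Re_one_minus_pos[OF a that])
    then show ?thesis by (rule Re_of_real_divide_pos[OF num])
  qed
  have nz: "1 - cnj a * z \<noteq> 0" if "cmod z < 1" for z using Re_one_minus_pos[OF a that] by (metis zero_complex.sel(1) less_irrefl)
  have np: "of_real (1 - (cmod a)\<^sup>2) / (1 - cnj a * z) \<notin> \<real>\<^sub>\<le>\<^sub>0" if "cmod z < 1" for z
    using pos[OF that] by (metis complex_nonpos_Reals_iff not_le)
  have np: "\<And>z. z \<in> unit_disk \<Longrightarrow> of_real (1 - (cmod a)\<^sup>2) / (1 - cnj a * z) \<notin> \<real>\<^sub>\<le>\<^sub>0" using np by simp
  have "(\<lambda>z. (of_real (1 - (cmod a)\<^sup>2) / (1 - cnj a * z)) powr of_real ((\<gamma> + 1) / p) * of_real (1 / weight_square \<omega> a powr (1 / p))) holomorphic_on unit_disk"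
  proof (intro holomorphic_on_mult holomorphic_on_powr holomorphic_on_divide holomorphic_on_diff holomorphic_on_const holomorphic_on_ident)
    fix z assume "z \<in> unit_disk"
    then show "1 - cnj a * z \<noteq> 0" using nz by simp
  qed (use np in blast)
  then show ?thesis unfolding test_fun_def .
qed

text \<open>The restriction \<open>\<bar>a\<bar> \<ge> 1 / 4\<close> keeps \<open>a\<close> away from the origin, where the Carleson square degenerates; only
  \<open>\<bar>a\<bar> \<rightarrow> 1\<close> matters.\<close>

lemma test_fun_bounded:
  assumes \<gamma>: "log 2 cap_const < \<gamma>"
  shows "\<exists>b>0. \<forall>a. 1 / 4 \<le> cmod a \<and> cmod a < 1 \<longrightarrow> test_fun \<omega> a p \<gamma> \<in> Y \<and> nY (test_fun \<omega> a p \<gamma>) \<le> b"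
proof -
  have "log 2 cap_const < \<gamma> + 1" using \<gamma> by simp
  from kernel_power_integral[OF this] obtain C where C: "0 < C" "\<And>a. cmod a < 1 \<Longrightarrow>
     (\<integral>\<^sup>+ z. ennreal (((1 - (cmod a)\<^sup>2) / cmod (1 - cnj a * z)) powr (\<gamma> + 1)) \<partial>M) \<le> ennreal (C * cap (1 - cmod a))" by blast
  define b where "b = (C * cap_const ^ 4) powr (1 / p)"
  have b: "0 < b" using C cap_const_ge by (simp add: b_def)
  have bp: "b powr p = C * cap_const ^ 4" using C cap_const_ge p_pos by (simp add: b_def powr_powr)
  have "test_fun \<omega> a p \<gamma> \<in> Y \<and> nY (test_fun \<omega> a p \<gamma>) \<le> b" if a: "1 / 4 \<le> cmod a" "cmod a < 1" for a
  proof
    let ?F = "test_fun \<omega> a p \<gamma>"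
    have ws: "0 < weight_square \<omega> a" by (rule weight_square_bounds(3)[OF a])
    have hol: "?F holomorphic_on unit_disk" by (rule test_fun_holomorphic[OF a(2)])
    have [measurable]: "(\<lambda>z. cmod (1 - cnj a * z)) \<in> borel_measurable M" by (rule kernel_measurable)
    have "(\<integral>\<^sup>+ z. ennreal (cmod (?F z) powr p) \<partial>M) = (\<integral>\<^sup>+ z. ennreal (1 / weight_square \<omega> a) * ennreal (((1 - (cmod a)\<^sup>2) / cmod (1 - cnj a * z)) powr (\<gamma> + 1)) \<partial>M)"
    proof (intro nn_integral_cong)
      fix z assume "z \<in> space M"
      then have "cmod (?F z) powr p = ((1 - (cmod a)\<^sup>2) / cmod (1 - cnj a * z)) powr (\<gamma> + 1) / weight_square \<omega> a"
        by (intro test_fun_powr a) (simp add: space_M)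
      then show "ennreal (cmod (?F z) powr p) = ennreal (1 / weight_square \<omega> a) * ennreal (((1 - (cmod a)\<^sup>2) / cmod (1 - cnj a * z)) powr (\<gamma> + 1))"
        using ws by (simp add: ennreal_mult[symmetric])
    qed
    also have "\<dots> = ennreal (1 / weight_square \<omega> a) * (\<integral>\<^sup>+ z. ennreal (((1 - (cmod a)\<^sup>2) / cmod (1 - cnj a * z)) powr (\<gamma> + 1)) \<partial>M)"
      by (intro nn_integral_cmult) measurable
    also have "\<dots> \<le> ennreal (1 / weight_square \<omega> a) * ennreal (C * cap (1 - cmod a))"
      by (intro mult_left_mono C(2) a) simp
    also have "\<dots> = ennreal (1 / weight_square \<omega> a * (C * cap (1 - cmod a)))"
      using C ws by (intro ennreal_mult[symmetric]) auto
    also have "\<dots> \<le> ennreal (b powr p)"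
    proof (rule ennreal_leI)
      have "1 / weight_square \<omega> a * (C * cap (1 - cmod a)) \<le> 1 / weight_square \<omega> a * (C * (cap_const ^ 4 * weight_square \<omega> a))"
        using C ws weight_square_bounds(1)[OF a] by (intro mult_left_mono) auto
      then show "1 / weight_square \<omega> a * (C * cap (1 - cmod a)) \<le> b powr p" using ws by (simp add: bp)
    qed
    finally have le: "(\<integral>\<^sup>+ z. ennreal (cmod (?F z) powr p) \<partial>M) \<le> ennreal (b powr p)" .
    have L: "?F \<in> Lq_space M p" using le by (intro Lq_spaceI holomorphic_measurable[OF hol]) (auto intro: le_less_trans)
    show "?F \<in> Y" using L hol by (simp add: bergman_space_iff)
    show "nY ?F \<le> b" unfolding bergman_norm_eq[OF hol] by (rule Lq_norm_le[OF L p_pos _ le]) (use b in simp)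
  qed
  then show ?thesis using b by blast
qed

text \<open>For fixed \<open>z\<close> the numerator of the kernel gives \<open>(1 - \<bar>a\<bar>) powr (\<gamma> + 1)\<close>, whereas the mass of the Carleson
  square is at least of the order of \<open>(1 - \<bar>a\<bar>) powr log 2 cap_const\<close>.\<close>

lemma test_fun_tendsto_0:
  assumes \<gamma>: "log 2 cap_const < \<gamma>" and a: "\<And>n. 1 / 4 \<le> cmod (a n)" "\<And>n. cmod (a n) < 1"
    and lim: "(\<lambda>n. cmod (a n)) \<longlonglongrightarrow> 1" and z: "cmod z < 1"
  shows "(\<lambda>n. test_fun \<omega> (a n) p \<gamma> z) \<longlonglongrightarrow> 0"
proof -
  define \<beta> where "\<beta> = log 2 cap_const"
  have \<beta>: "0 \<le> \<beta>" using cap_const_ge by (simp add: \<beta>_def)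
  define \<delta> where "\<delta> = (\<lambda>n. 1 - cmod (a n))"
  have \<delta>: "0 < \<delta> n" "\<delta> n \<le> 1" for n using a(1)[of n] a(2)[of n] by (auto simp: \<delta>_def)
  have \<delta>lim: "\<delta> \<longlonglongrightarrow> 0" using tendsto_diff[OF tendsto_const[of 1] lim] by (simp add: \<delta>_def)
  define D where "D = (2 / (1 - cmod z)) powr (\<gamma> + 1) * cap_const ^ 4 * 2 powr \<beta> / cap 1"
  have D: "0 \<le> D" using cap_const_ge by (simp add: D_def)
  have bd: "cmod (test_fun \<omega> (a n) p \<gamma> z) powr p \<le> D * \<delta> n powr (\<gamma> + 1 - \<beta>)" for n
  proof -
    have ws: "0 < weight_square \<omega> (a n)" by (rule weight_square_bounds(3)[OF a])
    have "cmod (cnj (a n) * z) \<le> 1 * cmod z" unfolding norm_mult by (intro mult_mono) (use a(2)[of n] in auto)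
    then have den: "1 - cmod z \<le> cmod (1 - cnj (a n) * z)" using norm_triangle_ineq2[of 1 "cnj (a n) * z"] by simp
    have "1 - (cmod (a n))\<^sup>2 = (1 + cmod (a n)) * \<delta> n" by (simp add: \<delta>_def power2_eq_square algebra_simps)
    also have "\<dots> \<le> 2 * \<delta> n" using a(2)[of n] \<delta>[of n] by (intro mult_right_mono) auto
    finally have num: "1 - (cmod (a n))\<^sup>2 \<le> 2 * \<delta> n" .
    have num0: "0 \<le> 1 - (cmod (a n))\<^sup>2" using a(2)[of n] by (simp add: abs_square_le_1)
    have "(1 - (cmod (a n))\<^sup>2) / cmod (1 - cnj (a n) * z) \<le> 2 * \<delta> n / (1 - cmod z)"
      using num num0 den z \<delta>[of n] by (intro frac_le) auto
    then have k: "((1 - (cmod (a n))\<^sup>2) / cmod (1 - cnj (a n) * z)) powr (\<gamma> + 1) \<le> (2 / (1 - cmod z) * \<delta> n) powr (\<gamma> + 1)"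
      using num0 \<gamma> \<beta> by (intro powr_mono2) (auto simp: \<beta>_def)
    have "cap 1 * (\<delta> n / 2) powr \<beta> \<le> cap (\<delta> n)" unfolding \<beta>_def by (rule cap_growth[OF \<delta>])
    also have "\<dots> \<le> cap_const ^ 4 * weight_square \<omega> (a n)" unfolding \<delta>_def by (rule weight_square_bounds(1)[OF a])
    finally have w: "cap 1 * (\<delta> n / 2) powr \<beta> \<le> cap_const ^ 4 * weight_square \<omega> (a n)" .
    have c1: "0 < cap 1" by (rule cap_pos) simp
    have "1 / weight_square \<omega> (a n) \<le> cap_const ^ 4 / (cap 1 * (\<delta> n / 2) powr \<beta>)"
    proof -
      have "0 < cap 1 * (\<delta> n / 2) powr \<beta>" using c1 \<delta>(1)[of n] by simp
      then show ?thesis using w ws by (simp add: pos_divide_le_eq pos_le_divide_eq)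
    qed
    then have "((1 - (cmod (a n))\<^sup>2) / cmod (1 - cnj (a n) * z)) powr (\<gamma> + 1) * (1 / weight_square \<omega> (a n))
        \<le> (2 / (1 - cmod z) * \<delta> n) powr (\<gamma> + 1) * (cap_const ^ 4 / (cap 1 * (\<delta> n / 2) powr \<beta>))"
      using k ws by (intro mult_mono) auto
    also have "\<dots> = D * \<delta> n powr (\<gamma> + 1 - \<beta>)"
      using \<delta>(1)[of n] unfolding D_def powr_mult powr_divide powr_diff by (simp add: mult.assoc)
    finally show ?thesis by (simp only: test_fun_powr[OF a(1)[of n] a(2)[of n] z] times_divide_eq_right mult_1_right)
  qed
  have "(\<lambda>n. (D * \<delta> n powr (\<gamma> + 1 - \<beta>)) powr (1 / p)) \<longlonglongrightarrow> 0"
  proof (rule tendsto_zero_powrI[OF _ tendsto_const])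
    have "(\<lambda>n. \<delta> n powr (\<gamma> + 1 - \<beta>)) \<longlonglongrightarrow> 0"
    proof (rule tendsto_zero_powrI[OF \<delta>lim tendsto_const])
      show "\<forall>\<^sub>F n in sequentially. 0 \<le> \<delta> n" using \<delta>(1) by (intro always_eventually allI less_imp_le)
      show "0 < \<gamma> + 1 - \<beta>" using \<gamma> by (simp add: \<beta>_def)
    qed
    then show "(\<lambda>n. D * \<delta> n powr (\<gamma> + 1 - \<beta>)) \<longlonglongrightarrow> 0" by (rule tendsto_mult_right_zero)
    show "\<forall>\<^sub>F n in sequentially. 0 \<le> D * \<delta> n powr (\<gamma> + 1 - \<beta>)"
      using D by (intro always_eventually allI mult_nonneg_nonneg powr_ge_zero)
    show "0 < 1 / p" using p_pos by simp
  qed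
  moreover have "cmod (test_fun \<omega> (a n) p \<gamma> z) \<le> (D * \<delta> n powr (\<gamma> + 1 - \<beta>)) powr (1 / p)" for n
  proof -
    have "cmod (test_fun \<omega> (a n) p \<gamma> z) = (cmod (test_fun \<omega> (a n) p \<gamma> z) powr p) powr (1 / p)"
      using p_pos by (simp add: powr_powr)
    also have "\<dots> \<le> (D * \<delta> n powr (\<gamma> + 1 - \<beta>)) powr (1 / p)" using bd[of n] p_pos by (intro powr_mono2) auto
    finally show ?thesis .
  qed
  then have "\<forall>\<^sub>F n in sequentially. norm (test_fun \<omega> (a n) p \<gamma> z) \<le> (D * \<delta> n powr (\<gamma> + 1 - \<beta>)) powr (1 / p)"
    by (intro always_eventually allI)
  ultimately show ?thesis by (rule Lim_null_comparison[rotated])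
qed

end

section \<open>Truncations of a weighted composition operator\<close>

locale bounded_weighted_comp = weighted_bergman +
  fixes u \<phi> :: "complex \<Rightarrow> complex" and \<mu> :: "complex measure"
  assumes sets_mu: "sets \<mu> = sets disk_borel"
    and u_measurable: "u \<in> borel_measurable disk_borel"
    and phi_holomorphic: "\<phi> holomorphic_on unit_disk"
    and phi_maps: "\<phi> ` unit_disk \<subseteq> unit_disk"
    and bounded: "bounded_op (bergman_space \<omega> p) (bergman_norm \<omega> p) (Lq_space \<mu> q) (Lq_norm \<mu> q) (weighted_comp u \<phi>)"
begin

abbreviation Z where "Z \<equiv> Lq_space \<mu> q"
abbreviation nZ where "nZ \<equiv> Lq_norm \<mu> q"
abbreviation T where "T \<equiv> weighted_comp u \<phi>"

lemma space_mu: "space \<mu> = unit_disk"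
  using sets_eq_imp_space_eq[OF sets_mu] by (simp add: space_restrict_space)

lemma measurable_mu_eq: "measurable \<mu> N = measurable disk_borel N"
  by (rule measurable_cong_sets) (use sets_mu in auto)

lemma phi_in_disk: "cmod z < 1 \<Longrightarrow> cmod (\<phi> z) < 1"
  using phi_maps by (auto simp: image_subset_iff)

lemma phi_measurable: "\<phi> \<in> measurable \<mu> disk_borel"
proof (rule measurable_restrict_space2)
  show "\<phi> \<in> space \<mu> \<rightarrow> unit_disk" using phi_in_disk by (auto simp: space_mu)
  show "\<phi> \<in> borel_measurable \<mu>" unfolding measurable_mu_eq
    by (rule borel_measurable_continuous_on_restrict) (rule holomorphic_on_imp_continuous_on[OF phi_holomorphic])
qed

lemma u_meas [measurable]: "u \<in> borel_measurable \<mu>"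
  using u_measurable by (simp add: measurable_mu_eq)

lemma comp_measurable: "f holomorphic_on unit_disk \<Longrightarrow> (\<lambda>z. f (\<phi> z)) \<in> borel_measurable \<mu>"
  using measurable_compose[OF phi_measurable, of f borel] holomorphic_measurable by (simp add: measurable_M_eq)

lemma T_apply: "T f z = u z * f (\<phi> z)"
  by (simp add: weighted_comp_def)

lemma T_in: "f \<in> Y \<Longrightarrow> T f \<in> Z"
  using bounded by (simp add: bounded_op_def linear_op_def)

lemma T_bounded: obtains B where "0 \<le> B" "\<And>f. f \<in> Y \<Longrightarrow> nZ (T f) \<le> B * nY f"
proof -
  obtain B where B: "\<forall>f\<in>Y. nZ (T f) \<le> B * nY f" using bounded by (auto simp: bounded_op_def)
  have "nZ (T f) \<le> \<bar>B\<bar> * nY f" if "f \<in> Y" for f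
  proof -
    have "nZ (T f) \<le> B * nY f" using B that by blast
    also have "\<dots> \<le> \<bar>B\<bar> * nY f" by (intro mult_right_mono bergman_norm_nonneg) simp
    finally show ?thesis .
  qed
  then show ?thesis using that[of "\<bar>B\<bar>"] by simp
qed

lemma u_in: "u \<in> Z"
  using T_in[OF bergman_const[of 1]] by (simp add: weighted_comp_def)

text \<open>The measure \<open>\<nu>\<close> for which the norm of \<open>T f\<close> in \<open>L\<^sup>q(\<mu>)\<close> is that of \<open>f\<close> in \<open>L\<^sup>q(\<nu>)\<close>.\<close>

definition pushed :: "complex measure" where
  "pushed = distr (density \<mu> (\<lambda>z. ennreal (cmod (u z) powr q))) disk_borel \<phi>"

lemma sets_pushed: "sets pushed = sets M"
  by (simp add: pushed_def sets_M)

lemma nn_integral_pushed: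
  assumes "g \<in> borel_measurable disk_borel"
  shows "(\<integral>\<^sup>+ w. g w \<partial>pushed) = (\<integral>\<^sup>+ z. ennreal (cmod (u z) powr q) * g (\<phi> z) \<partial>\<mu>)"
proof -
  have "(\<integral>\<^sup>+ w. g w \<partial>pushed) = (\<integral>\<^sup>+ z. g (\<phi> z) \<partial>density \<mu> (\<lambda>z. ennreal (cmod (u z) powr q)))"
    unfolding pushed_def using phi_measurable assms by (intro nn_integral_distr) (simp_all add: measurable_density_eq1)
  also have "\<dots> = (\<integral>\<^sup>+ z. ennreal (cmod (u z) powr q) * g (\<phi> z) \<partial>\<mu>)"
    using measurable_compose[OF phi_measurable assms] by (intro nn_integral_density) measurable
  finally show ?thesis .
qed

lemma finite_pushed: "finite_measure pushed"
proof (rule finite_measureI)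
  have "emeasure pushed (space pushed) = (\<integral>\<^sup>+ w. 1 \<partial>pushed)" by simp
  also have "\<dots> = (\<integral>\<^sup>+ z. ennreal (cmod (u z) powr q) * 1 \<partial>\<mu>)" by (rule nn_integral_pushed) simp
  also have "\<dots> = ennreal (nZ u powr q)" using Lq_norm_powr[OF u_in q_pos] by simp
  finally show "emeasure pushed (space pushed) \<noteq> \<infinity>" by simp
qed

text \<open>Guarantees that the suprema defining the operator norms of the differences \<open>T - K\<close> are finite: functions \<open>f\<^sub>n\<close> of
  the unit ball with images of norm larger than \<open>n\<close> would contradict the convergence of a subsequence of \<open>K f\<^sub>n\<close>.\<close>

lemma compact_op_difference_bdd:
  assumes K: "compact_op Y nY Z nZ K"
  shows "bdd_above ((\<lambda>f. nZ (\<lambda>x. T f x - K f x)) ` {f \<in> Y. nY f \<le> 1})"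
proof (rule ccontr)
  assume unb: "\<not> ?thesis"
  have "\<exists>f. f \<in> Y \<and> nY f \<le> 1 \<and> real n < nZ (\<lambda>x. T f x - K f x)" for n :: nat
  proof (rule ccontr)
    assume neg: "\<not> ?thesis"
    have "bdd_above ((\<lambda>f. nZ (\<lambda>x. T f x - K f x)) ` {f \<in> Y. nY f \<le> 1})"
    proof (rule bdd_aboveI2)
      fix f assume "f \<in> {f \<in> Y. nY f \<le> 1}"
      then show "nZ (\<lambda>x. T f x - K f x) \<le> real n" using neg by (metis mem_Collect_eq not_le)
    qed
    then show False using unb by blast
  qed
  then obtain f where f: "\<And>n::nat. f n \<in> Y" "\<And>n. nY (f n) \<le> 1" "\<And>n. real n < nZ (\<lambda>x. T (f n) x - K (f n) x)" by metis
  obtain s g where s: "strict_mono (s :: nat \<Rightarrow> nat)" and g: "g \<in> Z" and lim: "(\<lambda>n. nZ (\<lambda>x. K (f (s n)) x - g x)) \<longlonglongrightarrow> 0"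
    using K f(1,2) unfolding compact_op_def by blast
  have KZ: "K h \<in> Z" if "h \<in> Y" for h using K that by (simp add: compact_op_def linear_op_def)
  obtain B where B: "0 \<le> B" "\<And>f. f \<in> Y \<Longrightarrow> nZ (T f) \<le> B * nY f" using T_bounded by blast
  define R where "R = 4 * (4 * (B + nZ g) + 4 * 1)"
  have "\<forall>\<^sub>F n in sequentially. nZ (\<lambda>x. K (f (s n)) x - g x) < 1" using order_tendstoD(2)[OF lim] by simp
  moreover obtain N where N: "R \<le> real N" using real_arch_simple by blast
  ultimately have "\<forall>\<^sub>F n in sequentially. nZ (\<lambda>x. K (f (s n)) x - g x) < 1 \<and> N \<le> n"
    by (intro eventually_conj eventually_ge_at_top)
  then obtain n where n: "nZ (\<lambda>x. K (f (s n)) x - g x) < 1" "N \<le> n"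
    using eventually_happens'[OF sequentially_bot] by blast
  then have n: "nZ (\<lambda>x. K (f (s n)) x - g x) < 1" "R \<le> real n" using N by auto
  let ?h = "f (s n)"
  have d1: "(\<lambda>x. T ?h x - g x) \<in> Z" "nZ (\<lambda>x. T ?h x - g x) \<le> 4 * (nZ (T ?h) + nZ g)"
    using Lq_diff[OF T_in[OF f(1)] g q1] by auto
  have d2: "(\<lambda>x. K ?h x - g x) \<in> Z" using Lq_diff(1)[OF KZ[OF f(1)] g q1] .
  have "nZ (\<lambda>x. T ?h x - K ?h x) = nZ (\<lambda>x. (T ?h x - g x) - (K ?h x - g x))" by simp
  also have "\<dots> \<le> 4 * (nZ (\<lambda>x. T ?h x - g x) + nZ (\<lambda>x. K ?h x - g x))"
    by (rule Lq_diff(2)[OF d1(1) d2 q1])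
  also have "\<dots> \<le> R"
  proof -
    have "nZ (T ?h) \<le> B * nY ?h" by (rule B(2)[OF f(1)])
    also have "\<dots> \<le> B * 1" using B(1) f(2) by (intro mult_left_mono) auto
    finally have "nZ (T ?h) \<le> B" by simp
    then have "nZ (\<lambda>x. T ?h x - g x) \<le> 4 * (B + nZ g)" by (intro order_trans[OF d1(2)]) simp
    then show ?thesis using n(1) unfolding R_def by (intro mult_left_mono add_mono) auto
  qed
  also have "\<dots> \<le> real (s n)" using n(2) seq_suble[OF s, of n] by linarith
  finally show False using f(3)[of "s n"] by linarith
qed

lemma op_norm_upper:
  assumes K: "compact_op Y nY Z nZ K" and f: "f \<in> Y" "nY f \<le> 1"
  shows "nZ (\<lambda>x. T f x - K f x) \<le> op_norm Y nY nZ (\<lambda>f x. T f x - K f x)"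
  unfolding op_norm_def by (rule cSUP_upper[OF _ compact_op_difference_bdd[OF K]]) (use f in simp)

lemma zero_unit_ball: "(\<lambda>_. 0) \<in> {f \<in> Y. nY f \<le> 1}"
  using bergman_const[of 0] by (simp add: bergman_norm_def)

lemma op_norm_nonneg:
  assumes K: "compact_op Y nY Z nZ K"
  shows "0 \<le> op_norm Y nY nZ (\<lambda>f x. T f x - K f x)"
proof -
  have "(\<lambda>_. 0) \<in> Y" "nY (\<lambda>_. 0) \<le> 1" using zero_unit_ball by auto
  from op_norm_upper[OF K this] show ?thesis by (rule order_trans[OF Lq_norm_nonneg])
qed

lemma ess_norm_le:
  assumes K: "compact_op Y nY Z nZ K"
  shows "ess_norm Y nY Z nZ T \<le> op_norm Y nY nZ (\<lambda>f x. T f x - K f x)"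
  unfolding ess_norm_def
proof (rule cINF_lower)
  show "bdd_below ((\<lambda>K. op_norm Y nY nZ (\<lambda>f x. T f x - K f x)) ` {K. compact_op Y nY Z nZ K})"
    by (rule bdd_belowI2[of _ 0]) (simp add: op_norm_nonneg)
  show "K \<in> {K. compact_op Y nY Z nZ K}" using K by simp
qed

definition cutoff :: "real \<Rightarrow> (complex \<Rightarrow> complex) \<Rightarrow> complex \<Rightarrow> complex" where
  "cutoff r f = (\<lambda>z. if cmod (\<phi> z) \<le> r then u z * f (\<phi> z) else 0)"

lemma cutoff_set: "{z \<in> space \<mu>. cmod (\<phi> z) \<le> r} \<in> sets \<mu>"
proof -
  have "\<phi> \<in> borel_measurable \<mu>" using comp_measurable[of "\<lambda>z. z"] by simp
  then show ?thesis by measurable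
qed

lemma cutoff_measurable:
  assumes "f holomorphic_on unit_disk"
  shows "cutoff r f \<in> borel_measurable \<mu>"
proof -
  have [measurable]: "(\<lambda>z. f (\<phi> z)) \<in> borel_measurable \<mu>" by (rule comp_measurable[OF assms])
  show ?thesis unfolding cutoff_def by (rule measurable_If[OF _ _ cutoff_set]) measurable
qed

lemma zero_nZ: "nZ (\<lambda>_. 0) = 0"
  by (simp add: Lq_norm_def)

lemma nZ_cong: "(\<And>z. z \<in> unit_disk \<Longrightarrow> f z = g z) \<Longrightarrow> nZ f = nZ g"
  unfolding Lq_norm_def by (intro arg_cong2[where f = "(powr)"] refl Bochner_Integration.integral_cong) (auto simp: space_mu)

text \<open>Bounded sequences in the Bergman space are locally bounded, so by Montel's theorem a subsequence converges
  uniformly on \<open>\<bar>w\<bar> \<le> r\<close>; multiplication by \<open>u\<close>, which lies in \<open>L\<^sup>q\<close>, makes this convergence in \<open>L\<^sup>q\<close>.\<close>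

lemma cutoff_compact:
  assumes r: "0 \<le> r" "r < 1"
  shows "compact_op Y nY Z nZ (cutoff r)"
  unfolding compact_op_def linear_op_def
proof (intro conjI ballI allI impI)
  fix f assume "f \<in> Y"
  then have hol: "f holomorphic_on unit_disk" by (simp add: bergman_space_iff)
  show "cutoff r f \<in> Z"
    by (rule Lq_dominated(1)[OF T_in[OF \<open>f \<in> Y\<close>] q_pos cutoff_measurable[OF hol], of 1])
       (auto simp: cutoff_def T_apply)
next
  fix f g assume fg: "f \<in> Y" "g \<in> Y" "nY (\<lambda>x. f x - g x) = 0"
  have "(\<lambda>z. f z - g z) \<in> Y" using bergman_lincomb(1)[OF fg(1,2), of 1 "-1"] by simp
  from bergman_null[OF this fg(3)] have eq: "f w = g w" if "cmod w < 1" for w using that eq_iff_diff_eq_0 by blast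
  have "nZ (\<lambda>x. cutoff r f x - cutoff r g x) = nZ (\<lambda>_. 0)"
  proof (rule nZ_cong)
    fix z assume "z \<in> unit_disk"
    then have "f (\<phi> z) = g (\<phi> z)" by (intro eq phi_in_disk) simp
    then show "cutoff r f z - cutoff r g z = 0" by (simp add: cutoff_def)
  qed
  then show "nZ (\<lambda>x. cutoff r f x - cutoff r g x) = 0" by (simp add: zero_nZ)
next
  fix f g
  have "(\<lambda>x. cutoff r (\<lambda>y. f y + g y) x - (cutoff r f x + cutoff r g x)) = (\<lambda>_. 0)"
    by (auto simp: cutoff_def fun_eq_iff algebra_simps)
  then show "nZ (\<lambda>x. cutoff r (\<lambda>y. f y + g y) x - (cutoff r f x + cutoff r g x)) = 0" by (simp add: zero_nZ)
next
  fix c f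
  have "(\<lambda>x. cutoff r (\<lambda>y. c * f y) x - c * cutoff r f x) = (\<lambda>_. 0)"
    by (auto simp: cutoff_def fun_eq_iff algebra_simps)
  then show "nZ (\<lambda>x. cutoff r (\<lambda>y. c * f y) x - c * cutoff r f x) = 0" by (simp add: zero_nZ)
next
  fix f :: "nat \<Rightarrow> complex \<Rightarrow> complex" and B
  assume fB: "\<forall>n. f n \<in> Y \<and> nY (f n) \<le> B"
  define H where "H = {h. h \<in> Y \<and> nY h \<le> B}"
  have B0: "0 \<le> B" using fB bergman_norm_nonneg order_trans by blast
  have bdd: "\<exists>C. \<forall>h\<in>H. \<forall>z\<in>Q. cmod (h z) \<le> C" if Q: "compact Q" "Q \<subseteq> unit_disk" for Q
  proof -
    obtain \<rho> where \<rho>: "0 \<le> \<rho>" "\<rho> < 1" "Q \<subseteq> cball 0 \<rho>"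
    proof (cases "Q = {}")
      case True
      then show ?thesis using that[of 0] by simp
    next
      case False
      then obtain x where x: "x \<in> Q" "\<And>y. y \<in> Q \<Longrightarrow> cmod y \<le> cmod x"
        using continuous_attains_sup[OF Q(1) False, of cmod] continuous_on_norm_id by blast
      then show ?thesis using that[of "cmod x"] Q(2) by (auto simp: subset_iff)
    qed
    define D where "D = 2 / ((1 - \<rho>) * tail ((1 - \<rho>) / 2))"
    have D: "0 \<le> D" using \<rho> by (simp add: D_def)
    have "cmod (h z) \<le> (D * B powr p) powr (1 / p)" if h: "h \<in> H" and z: "z \<in> Q" for h z
    proof -
      have "cmod (h z) powr p \<le> D * nY h powr p"
        unfolding D_def by (rule bergman_point) (use h z \<rho> in \<open>auto simp: H_def\<close>)
      also have "\<dots> \<le> D * B powr p"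
        using h p_pos D by (intro mult_left_mono powr_mono2) (auto simp: H_def bergman_norm_nonneg)
      finally have "(cmod (h z) powr p) powr (1 / p) \<le> (D * B powr p) powr (1 / p)" using p_pos by (intro powr_mono2) auto
      then show ?thesis using p_pos by (simp add: powr_powr)
    qed
    then show ?thesis by blast
  qed
  have Hhol: "h holomorphic_on unit_disk" if "h \<in> H" for h using that by (simp add: H_def bergman_space_iff)
  have rng: "range f \<subseteq> H" using fB by (auto simp: H_def)
  obtain g s where g: "g holomorphic_on unit_disk" and s: "strict_mono (s :: nat \<Rightarrow> nat)"
    and unif: "\<And>Q. compact Q \<Longrightarrow> Q \<subseteq> unit_disk \<Longrightarrow> uniform_limit Q (f \<circ> s) g sequentially"
    by (rule Montel[OF open_ball Hhol bdd rng]) blast+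
  have cb: "cball 0 r \<subseteq> unit_disk" using r by auto
  have lim: "uniform_limit (cball 0 r) (f \<circ> s) g sequentially" by (rule unif[OF compact_cball cb])
  have "compact (g ` cball 0 r)"
    by (rule compact_continuous_image[OF continuous_on_subset[OF holomorphic_on_imp_continuous_on[OF g] cb] compact_cball])
  then obtain G where G: "\<And>w. w \<in> cball 0 r \<Longrightarrow> cmod (g w) \<le> G"
    using compact_imp_bounded bounded_iff by (metis imageI)
  have G0: "0 \<le> G" using G[of 0] r by (simp add: order_trans[OF norm_ge_zero])
  have gZ: "cutoff r g \<in> Z"
  proof (rule Lq_dominated(1)[OF u_in q_pos cutoff_measurable[OF g] G0])
    fix z
    show "cmod (cutoff r g z) \<le> G * cmod (u z)"
      using G[of "\<phi> z"] G0 mult_right_mono[of "cmod (g (\<phi> z))" G "cmod (u z)"] by (auto simp: cutoff_def norm_mult mult.commute)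
  qed
  have "(\<lambda>n. nZ (\<lambda>x. cutoff r (f (s n)) x - cutoff r g x)) \<longlonglongrightarrow> 0"
  proof (rule LIMSEQ_I)
    fix e :: real assume e: "0 < e"
    define e' where "e' = e / (nZ u + 1)"
    have e': "0 < e'" using e Lq_norm_nonneg[of \<mu> q u] by (simp add: e'_def)
    have "\<forall>\<^sub>F n in sequentially. \<forall>w\<in>cball 0 r. dist ((f \<circ> s) n w) (g w) < e'"
      using lim e' unfolding uniform_limit_iff by blast
    then obtain N where N: "\<And>n w. N \<le> n \<Longrightarrow> w \<in> cball 0 r \<Longrightarrow> dist (f (s n) w) (g w) < e'"
      unfolding eventually_sequentially comp_def by blast
    show "\<exists>N. \<forall>n\<ge>N. norm (nZ (\<lambda>x. cutoff r (f (s n)) x - cutoff r g x) - 0) < e"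
    proof (intro exI[of _ N] allI impI)
      fix n assume n: "N \<le> n"
      have hol: "f (s n) holomorphic_on unit_disk" using fB by (simp add: bergman_space_iff)
      have [measurable]: "cutoff r (f (s n)) \<in> borel_measurable \<mu>" "cutoff r g \<in> borel_measurable \<mu>"
        using cutoff_measurable hol g by auto
      have "nZ (\<lambda>x. cutoff r (f (s n)) x - cutoff r g x) \<le> e' * nZ u"
      proof (rule Lq_dominated(2)[OF u_in q_pos])
        fix z assume "z \<in> space \<mu>"
        show "cmod (cutoff r (f (s n)) z - cutoff r g z) \<le> e' * cmod (u z)"
        proof (cases "cmod (\<phi> z) \<le> r")
          case True
          then have "cmod (f (s n) (\<phi> z) - g (\<phi> z)) \<le> e'" using N[OF n, of "\<phi> z"] by (simp add: dist_norm)
          then have "cmod (u z) * cmod (f (s n) (\<phi> z) - g (\<phi> z)) \<le> cmod (u z) * e'" by (intro mult_left_mono) auto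
          then show ?thesis using True by (simp add: cutoff_def norm_mult[symmetric] right_diff_distrib mult.commute)
        qed (use e' in \<open>simp add: cutoff_def\<close>)
      qed (use e' in auto)
      also have "\<dots> < e"
      proof -
        have "e' * nZ u < e' * (nZ u + 1)" using e' by simp
        also have "\<dots> = e" using Lq_norm_nonneg[of \<mu> q u] by (simp add: e'_def)
        finally show ?thesis .
      qed
      finally show "norm (nZ (\<lambda>x. cutoff r (f (s n)) x - cutoff r g x) - 0) < e" using Lq_norm_nonneg by simp
    qed
  qed
  then show "\<exists>s g. strict_mono s \<and> g \<in> Z \<and> (\<lambda>n. nZ (\<lambda>x. cutoff r (f (s n)) x - g x)) \<longlonglongrightarrow> 0"
    using s gZ by blast
qed

lemma ess_norm_nonneg: "0 \<le> ess_norm Y nY Z nZ T"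
  unfolding ess_norm_def
proof (rule cINF_greatest)
  show "{K. compact_op Y nY Z nZ K} \<noteq> {}" using cutoff_compact[of 0] by auto
qed (use op_norm_nonneg in auto)

end

section \<open>The two-sided estimate\<close>

context bounded_weighted_comp
begin

definition test_integral :: "real \<Rightarrow> complex \<Rightarrow> ennreal" where
  "test_integral \<gamma> a = (\<integral>\<^sup>+ z. ennreal (cmod (test_fun \<omega> a p \<gamma> (\<phi> z)) powr q * cmod (u z) powr q) \<partial>\<mu>)"

lemma hol_powr_measurable:
  "f holomorphic_on unit_disk \<Longrightarrow> (\<lambda>w. ennreal (cmod (f w) powr q)) \<in> borel_measurable disk_borel"
proof -
  assume "f holomorphic_on unit_disk"
  then have [measurable]: "f \<in> borel_measurable disk_borel" using holomorphic_measurable by (simp add: measurable_M_eq)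
  show ?thesis by measurable
qed

lemma test_integral_pushed:
  assumes "cmod a < 1"
  shows "test_integral \<gamma> a = (\<integral>\<^sup>+ w. ennreal (cmod (test_fun \<omega> a p \<gamma> w) powr q) \<partial>pushed)"
  unfolding nn_integral_pushed[OF hol_powr_measurable[OF test_fun_holomorphic[OF assms]]] test_integral_def
  by (intro nn_integral_cong) (simp add: ennreal_mult[symmetric] mult.commute)

lemma test_integral_norm:
  "test_integral \<gamma> a = (\<integral>\<^sup>+ z. ennreal (cmod (T (test_fun \<omega> a p \<gamma>) z) powr q) \<partial>\<mu>)"
  unfolding test_integral_def T_apply norm_mult powr_mult by (simp only: mult.commute)

text \<open>With \<open>\<bar>a\<bar> = 1 - \<delta>\<close>, the base of the power in the test function has modulus at least \<open>\<delta> / (2 \<delta>) = 1 / 2\<close> on the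
  disk of radius \<open>\<delta>\<close> about \<open>a / \<bar>a\<bar>\<close>.\<close>

lemma pushed_ball_le:
  assumes \<gamma>: "0 < \<gamma>" and l: "0 \<le> l" and \<zeta>: "cmod \<zeta> = 1" and \<delta>: "0 < \<delta>" "\<delta> \<le> 3/4"
    and le: "test_integral \<gamma> (of_real (1 - \<delta>) * \<zeta>) \<le> ennreal l"
  shows "emeasure pushed (ball \<zeta> \<delta> \<inter> unit_disk) \<le> ennreal (l * (2 powr ((\<gamma> + 1) * (q / p)) * cap_const powr (q / p)) * cap \<delta> powr (q / p))"
proof -
  define s where "s = q / p"
  have s: "1 \<le> s" using s1 by (simp add: s_def)
  define a where "a = of_real (1 - \<delta>) * \<zeta>"
  have na: "cmod a = 1 - \<delta>" using \<delta> \<zeta> unfolding a_def norm_mult norm_of_real by simp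
  have a: "1 / 4 \<le> cmod a" "cmod a < 1" using \<delta> by (auto simp: na)
  define W where "W = weight_square \<omega> a"
  have W: "0 < W" "W \<le> cap_const * cap \<delta>" using weight_square_bounds[OF a] by (auto simp: W_def na)
  define m where "m = ((1 / 2) powr (\<gamma> + 1) / W) powr s"
  have m: "0 < m" using W by (simp add: m_def)
  let ?B = "ball \<zeta> \<delta> \<inter> unit_disk"
  have B: "?B \<in> sets pushed" unfolding sets_pushed by (intro borel_Int_disk) simp
  have low: "m \<le> cmod (test_fun \<omega> a p \<gamma> w) powr q" if w: "w \<in> ?B" for w
  proof -
    have w1: "cmod w < 1" and wd: "cmod (\<zeta> - w) < \<delta>" using w by (auto simp: dist_norm)
    have cz: "cnj \<zeta> * \<zeta> = 1" using \<zeta> by (metis complex_norm_square mult.commute of_real_1 one_power2)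
    have "1 - cnj a * w = cnj \<zeta> * (\<zeta> - w) + of_real \<delta> * (cnj \<zeta> * w)"
      using cz by (simp add: a_def algebra_simps)
    then have "cmod (1 - cnj a * w) \<le> cmod (cnj \<zeta> * (\<zeta> - w)) + cmod (of_real \<delta> * (cnj \<zeta> * w))"
      by (simp only: norm_triangle_ineq)
    also have "\<dots> \<le> \<delta> + \<delta> * 1"
    proof (intro add_mono)
      show "cmod (cnj \<zeta> * (\<zeta> - w)) \<le> \<delta>" using wd \<zeta> by (simp add: norm_mult)
      have "\<delta> * cmod w \<le> \<delta> * 1" using \<delta> w1 by (intro mult_left_mono) auto
      then show "cmod (of_real \<delta> * (cnj \<zeta> * w)) \<le> \<delta> * 1" using \<delta> \<zeta> by (simp add: norm_mult)
    qed
    finally have den: "cmod (1 - cnj a * w) \<le> 2 * \<delta>" by simp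
    have den0: "0 < cmod (1 - cnj a * w)"
      using Re_one_minus_pos[OF a(2) w1] complex_Re_le_cmod order_less_le_trans by blast
    have "\<delta> \<le> (1 + cmod a) * \<delta>" using \<delta> by (simp add: na)
    also have "\<dots> = 1 - (cmod a)\<^sup>2" by (simp add: na power2_eq_square algebra_simps)
    finally have num: "\<delta> \<le> 1 - (cmod a)\<^sup>2" .
    have "1 / 2 = \<delta> / (2 * \<delta>)" using \<delta> by simp
    also have "\<dots> \<le> (1 - (cmod a)\<^sup>2) / cmod (1 - cnj a * w)" using num den den0 \<delta> by (intro frac_le) auto
    finally have "(1 / 2) powr (\<gamma> + 1) \<le> ((1 - (cmod a)\<^sup>2) / cmod (1 - cnj a * w)) powr (\<gamma> + 1)"
      using \<gamma> by (intro powr_mono2) auto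
    then have "(1 / 2) powr (\<gamma> + 1) / W \<le> cmod (test_fun \<omega> a p \<gamma> w) powr p"
      unfolding test_fun_powr[OF a w1] W_def[symmetric] using W by (intro divide_right_mono) auto
    then have "m \<le> (cmod (test_fun \<omega> a p \<gamma> w) powr p) powr s"
      unfolding m_def using s W by (intro powr_mono2) auto
    also have "\<dots> = cmod (test_fun \<omega> a p \<gamma> w) powr q" using p_pos by (simp add: powr_powr s_def)
    finally show ?thesis .
  qed
  have "ennreal m * emeasure pushed ?B = (\<integral>\<^sup>+ w. ennreal m * indicator ?B w \<partial>pushed)"
    using B by (simp only: nn_integral_cmult_indicator)
  also have "\<dots> \<le> (\<integral>\<^sup>+ w. ennreal (cmod (test_fun \<omega> a p \<gamma> w) powr q) \<partial>pushed)"
  proof (intro nn_integral_mono)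
    fix w
    show "ennreal m * indicator ?B w \<le> ennreal (cmod (test_fun \<omega> a p \<gamma> w) powr q)"
      using low[of w] by (cases "w \<in> ?B") (simp_all add: ennreal_leI)
  qed
  also have "\<dots> \<le> ennreal l" using le unfolding a_def[symmetric] test_integral_pushed[OF a(2)] .
  finally have 1: "ennreal m * emeasure pushed ?B \<le> ennreal l" .
  have "emeasure pushed ?B = ennreal (1 / m) * (ennreal m * emeasure pushed ?B)"
    using m by (simp add: mult.assoc[symmetric] ennreal_mult[symmetric])
  also have "\<dots> \<le> ennreal (1 / m) * ennreal l" by (rule mult_left_mono[OF 1]) simp
  also have "\<dots> = ennreal (l * (1 / m))" using m l by (simp add: ennreal_mult[symmetric] mult.commute)
  also have "\<dots> \<le> ennreal (l * (2 powr ((\<gamma> + 1) * s) * cap_const powr s) * cap \<delta> powr s)"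
  proof (rule ennreal_leI)
    have "1 / m = (2 powr (\<gamma> + 1) * W) powr s"
    proof -
      have "1 / m = (1 / ((1 / 2) powr (\<gamma> + 1) / W)) powr s" unfolding m_def by (simp add: powr_divide)
      also have "1 / ((1 / 2) powr (\<gamma> + 1) / W) = 2 powr (\<gamma> + 1) * W" by (simp add: powr_divide)
      finally show ?thesis .
    qed
    also have "\<dots> \<le> (2 powr (\<gamma> + 1) * (cap_const * cap \<delta>)) powr s"
      using W s by (intro powr_mono2 mult_left_mono) auto
    also have "\<dots> = 2 powr ((\<gamma> + 1) * s) * cap_const powr s * cap \<delta> powr s"
      by (simp only: powr_mult powr_powr mult.assoc)
    finally have "l * (1 / m) \<le> l * (2 powr ((\<gamma> + 1) * s) * cap_const powr s * cap \<delta> powr s)"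
      using l by (rule mult_left_mono)
    then show "l * (1 / m) \<le> l * (2 powr ((\<gamma> + 1) * s) * cap_const powr s) * cap \<delta> powr s"
      by (simp only: mult.assoc)
  qed
  finally show ?thesis by (simp only: s_def)
qed

text \<open>The truncation at \<open>r = 1 - \<delta>\<^sub>0 / 5\<close>, with \<open>\<delta>\<^sub>0\<close> so small that the assumed bound holds for \<open>\<bar>a\<bar> \<ge> 1 - \<delta>\<^sub>0\<close>, leaves
  the embedding into \<open>L\<^sup>q\<close> of a measure to which \<open>carleson_small_to_all\<close> applies. The constant of the
  embedding theorem enters as the assumption on \<open>A\<close>, so that it visibly does not depend on \<open>u\<close>, \<open>\<phi>\<close> and \<open>\<mu>\<close>.\<close>

lemma ess_norm_upper_bound:
  assumes A: "0 < A" and emb: "\<And>\<nu> \<kappa> f I. finite_measure \<nu> \<and> sets \<nu> = sets M \<and> 0 \<le> \<kappa> \<and>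
     carleson_bound \<nu> \<kappa> (q / p) \<and>
     f holomorphic_on unit_disk \<and> 0 < I \<and> (\<integral>\<^sup>+ z. ennreal (cmod (f z) powr p) \<partial>M) \<le> ennreal I \<Longrightarrow>
     (\<integral>\<^sup>+ z. ennreal (cmod (f z) powr q) \<partial>\<nu>) \<le> ennreal (A * \<kappa> * I powr (q / p))"
    and \<gamma>: "0 < \<gamma>" and l: "0 \<le> l" and r0: "r0 < 1"
    and ev: "\<And>a. r0 < cmod a \<Longrightarrow> cmod a < 1 \<Longrightarrow> test_integral \<gamma> a \<le> ennreal l"
  shows "ess_norm Y nY Z nZ T powr q
     \<le> A * (2 powr ((\<gamma> + 1) * (q / p)) * cap_const powr (q / p)) * (cap_const ^ 4) powr (q / p) * l"
proof -
  define s where "s = q / p"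
  have s: "1 \<le> s" using s1 by (simp add: s_def)
  define \<delta>0 where "\<delta>0 = min (3 / 4) ((1 - r0) / 2)"
  have \<delta>0: "0 < \<delta>0" "\<delta>0 \<le> 3 / 4" "\<delta>0 \<le> 1" "\<delta>0 < 1 - r0" using r0 by (auto simp: \<delta>0_def min_def)
  \<comment> \<open>Disks of radius \<open>\<delta>\<^sub>0 / 5\<close> about boundary points cover \<open>\<bar>w\<bar> > r\<close>, and their five times enlargements are still small.\<close>
  define r where "r = 1 - \<delta>0 / 5"
  have r: "0 \<le> r" "r < 1" using \<delta>0 by (auto simp: r_def)
  define \<nu> where "\<nu> = density pushed (indicator {w\<in>unit_disk. r < cmod w})"
  have sP: "{w\<in>unit_disk. r < cmod w} \<in> sets pushed"
  proof -
    have "{w. r < cmod w} \<inter> unit_disk \<in> sets pushed" unfolding sets_pushed by (intro borel_Int_disk) measurable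
    moreover have "{w. r < cmod w} \<inter> unit_disk = {w\<in>unit_disk. r < cmod w}" by auto
    ultimately show ?thesis by simp
  qed
  have sets\<nu>: "sets \<nu> = sets M" by (simp add: \<nu>_def sets_pushed)
  have em\<nu>: "emeasure \<nu> X = emeasure pushed (X \<inter> {w\<in>unit_disk. r < cmod w})" if X: "X \<in> sets M" for X
  proof -
    have "emeasure \<nu> X = (\<integral>\<^sup>+ w. indicator {w\<in>unit_disk. r < cmod w} w * indicator X w \<partial>pushed)"
      unfolding \<nu>_def by (rule emeasure_density[OF borel_measurable_indicator[OF sP]]) (simp add: X sets_pushed)
    also have "\<dots> = (\<integral>\<^sup>+ w. indicator (X \<inter> {w\<in>unit_disk. r < cmod w}) w \<partial>pushed)"
      by (intro nn_integral_cong) (auto simp: indicator_def)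
    also have "\<dots> = emeasure pushed (X \<inter> {w\<in>unit_disk. r < cmod w})"
      using X sP by (intro nn_integral_indicator sets.Int) (auto simp: sets_pushed)
    finally show ?thesis .
  qed
  interpret P: finite_measure pushed by (rule finite_pushed)
  have fin\<nu>: "finite_measure \<nu>"
  proof (rule finite_measureI)
    have "space \<nu> = space M" by (rule sets_eq_imp_space_eq[OF sets\<nu>])
    then have "emeasure \<nu> (space \<nu>) = emeasure pushed (space M \<inter> {w\<in>unit_disk. r < cmod w})" by (simp add: em\<nu>)
    then show "emeasure \<nu> (space \<nu>) \<noteq> \<infinity>" using P.emeasure_finite by simp
  qed
  define \<kappa> where "\<kappa> = l * (2 powr ((\<gamma> + 1) * s) * cap_const powr s)"
  have \<kappa>: "0 \<le> \<kappa>" using l by (simp add: \<kappa>_def)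
  have small: "emeasure \<nu> (ball \<zeta> \<delta> \<inter> unit_disk) \<le> ennreal (\<kappa> * cap \<delta> powr s)"
    if "cmod \<zeta> = 1" "0 < \<delta>" "\<delta> \<le> \<delta>0" for \<zeta> \<delta>
  proof -
    have BM: "ball \<zeta> \<delta> \<inter> unit_disk \<in> sets M" by (intro borel_Int_disk) simp
    have n: "cmod (of_real (1 - \<delta>) * \<zeta>) = 1 - \<delta>" using that \<delta>0 unfolding norm_mult norm_of_real by simp
    have "emeasure \<nu> (ball \<zeta> \<delta> \<inter> unit_disk) \<le> emeasure pushed (ball \<zeta> \<delta> \<inter> unit_disk)"
      unfolding em\<nu>[OF BM] using BM by (intro emeasure_mono) (auto simp: sets_pushed)
    also have "\<dots> \<le> ennreal (l * (2 powr ((\<gamma> + 1) * (q / p)) * cap_const powr (q / p)) * cap \<delta> powr (q / p))"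
    proof (rule pushed_ball_le[OF \<gamma> l that(1,2)])
      show "\<delta> \<le> 3 / 4" using that \<delta>0 by simp
      show "test_integral \<gamma> (of_real (1 - \<delta>) * \<zeta>) \<le> ennreal l"
        by (rule ev) (unfold n, use that \<delta>0 in auto)
    qed
    finally show ?thesis by (simp only: \<kappa>_def s_def)
  qed
  have conc: "emeasure \<nu> {w\<in>unit_disk. cmod w \<le> 1 - \<delta>0 / 5} = 0"
  proof -
    have "{w. cmod w \<le> r} \<inter> unit_disk \<in> sets M" by (intro borel_Int_disk) measurable
    moreover have "{w. cmod w \<le> r} \<inter> unit_disk = {w\<in>unit_disk. cmod w \<le> 1 - \<delta>0 / 5}" by (auto simp: r_def)
    ultimately have "{w\<in>unit_disk. cmod w \<le> 1 - \<delta>0 / 5} \<in> sets M" by simp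
    from em\<nu>[OF this] have "emeasure \<nu> {w\<in>unit_disk. cmod w \<le> 1 - \<delta>0 / 5} = emeasure pushed ({w\<in>unit_disk. cmod w \<le> 1 - \<delta>0 / 5} \<inter> {w\<in>unit_disk. r < cmod w})" .
    also have "{w\<in>unit_disk. cmod w \<le> 1 - \<delta>0 / 5} \<inter> {w\<in>unit_disk. r < cmod w} = {}" by (auto simp: r_def)
    finally show ?thesis by simp
  qed
  define \<kappa>' where "\<kappa>' = \<kappa> * (cap_const ^ 4) powr s"
  have \<kappa>': "0 \<le> \<kappa>'" using \<kappa> by (simp add: \<kappa>'_def)
  have all: "emeasure \<nu> (ball \<zeta> \<delta> \<inter> unit_disk) \<le> ennreal (\<kappa>' * cap \<delta> powr s)" if "cmod \<zeta> = 1" "0 < \<delta>" for \<zeta> \<delta>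
    unfolding \<kappa>'_def by (rule carleson_small_to_all[OF sets\<nu> s \<kappa> \<delta>0(1,3) small conc that])
  have K: "compact_op Y nY Z nZ (cutoff r)" by (rule cutoff_compact[OF r])
  have bd: "nZ (\<lambda>x. T f x - cutoff r f x) \<le> (A * \<kappa>') powr (1 / q)" if f: "f \<in> Y" "nY f \<le> 1" for f
  proof -
    have hol: "f holomorphic_on unit_disk" using f by (simp add: bergman_space_iff)
    have cZ: "cutoff r f \<in> Z" using K f(1) by (simp add: compact_op_def linear_op_def)
    have dZ: "(\<lambda>x. T f x - cutoff r f x) \<in> Z" by (rule Lq_diff(1)[OF T_in[OF f(1)] cZ q1])
    have "(\<integral>\<^sup>+ z. ennreal (cmod (f z) powr p) \<partial>M) = ennreal (nY f powr p)" by (rule bergman_norm_powr[OF f(1), symmetric])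
    also have "\<dots> \<le> ennreal (1 powr p)" using f(2) p_pos by (intro ennreal_leI powr_mono2) (auto simp: bergman_norm_nonneg)
    finally have "(\<integral>\<^sup>+ z. ennreal (cmod (f z) powr p) \<partial>M) \<le> ennreal 1" by simp
    then have e: "(\<integral>\<^sup>+ z. ennreal (cmod (f z) powr q) \<partial>\<nu>) \<le> ennreal (A * \<kappa>' * 1 powr (q / p))"
      using fin\<nu> sets\<nu> \<kappa>' all hol by (intro emb) (simp add: s_def carleson_bound_def)
    have gm: "(\<lambda>w. indicator {w\<in>unit_disk. r < cmod w} w * ennreal (cmod (f w) powr q)) \<in> borel_measurable disk_borel"
    proof -
      have "{w\<in>unit_disk. r < cmod w} \<in> sets disk_borel" using sP by (simp add: sets_pushed sets_M)
      then show ?thesis using hol_powr_measurable[OF hol] by (intro borel_measurable_times_ennreal borel_measurable_indicator)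
    qed
    have "(\<integral>\<^sup>+ z. ennreal (cmod (T f z - cutoff r f z) powr q) \<partial>\<mu>)
       = (\<integral>\<^sup>+ z. ennreal (cmod (u z) powr q) * (indicator {w\<in>unit_disk. r < cmod w} (\<phi> z) * ennreal (cmod (f (\<phi> z)) powr q)) \<partial>\<mu>)"
    proof (intro nn_integral_cong)
      fix z assume "z \<in> space \<mu>"
      then have pz: "\<phi> z \<in> unit_disk" using phi_in_disk by (simp add: space_mu)
      show "ennreal (cmod (T f z - cutoff r f z) powr q) = ennreal (cmod (u z) powr q) * (indicator {w\<in>unit_disk. r < cmod w} (\<phi> z) * ennreal (cmod (f (\<phi> z)) powr q))"
      proof (cases "cmod (\<phi> z) \<le> r")
        case True
        then show ?thesis by (simp add: T_apply cutoff_def)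
      next
        case False
        then show ?thesis using pz by (simp add: T_apply cutoff_def norm_mult powr_mult ennreal_mult)
      qed
    qed
    also have "\<dots> = (\<integral>\<^sup>+ w. indicator {w\<in>unit_disk. r < cmod w} w * ennreal (cmod (f w) powr q) \<partial>pushed)"
      by (rule nn_integral_pushed[OF gm, symmetric])
    also have "\<dots> = (\<integral>\<^sup>+ w. ennreal (cmod (f w) powr q) \<partial>\<nu>)"
    proof -
      have "(\<lambda>w. ennreal (cmod (f w) powr q)) \<in> borel_measurable pushed"
        using hol_powr_measurable[OF hol] by (simp add: pushed_def)
      then show ?thesis unfolding \<nu>_def using sP by (intro nn_integral_density[symmetric]) auto
    qed
    also note e
    finally have "(\<integral>\<^sup>+ z. ennreal (cmod (T f z - cutoff r f z) powr q) \<partial>\<mu>) \<le> ennreal (((A * \<kappa>') powr (1 / q)) powr q)"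
      using A \<kappa>' q_pos by (simp add: powr_powr)
    then show ?thesis by (intro Lq_norm_le[OF dZ q_pos]) simp_all
  qed
  have "ess_norm Y nY Z nZ T \<le> op_norm Y nY nZ (\<lambda>f x. T f x - cutoff r f x)" by (rule ess_norm_le[OF K])
  also have "\<dots> \<le> (A * \<kappa>') powr (1 / q)"
    unfolding op_norm_def by (rule cSUP_least) (use zero_unit_ball bd in blast)+
  finally have "ess_norm Y nY Z nZ T powr q \<le> ((A * \<kappa>') powr (1 / q)) powr q"
    using q_pos ess_norm_nonneg by (intro powr_mono2) auto
  also have "\<dots> = A * \<kappa>'" using A \<kappa>' q_pos by (simp add: powr_powr)
  also have "\<dots> = A * (2 powr ((\<gamma> + 1) * (q / p)) * cap_const powr (q / p)) * (cap_const ^ 4) powr (q / p) * l"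
    by (simp add: \<kappa>'_def \<kappa>_def s_def mult_ac)
  finally show ?thesis .
qed

text \<open>The sequence \<open>T F\<^sub>n\<close> tends to \<open>0\<close> pointwise and \<open>K F\<^sub>n\<close> converges in norm after passing to a subsequence. So
  \<open>T F\<^sub>n - T F\<^sub>m\<close> differs from \<open>(T - K) (F\<^sub>n - F\<^sub>m)\<close> by little, and as \<open>m \<rightarrow> \<infinity>\<close> Fatou's lemma recovers the norm of \<open>T F\<^sub>n\<close>.
  Norm convergence of \<open>K F\<^sub>n\<close> to \<open>0\<close>, false in general for \<open>p = 1\<close>, is avoided in this way.\<close>

lemma compact_difference_lower_bound:
  assumes \<gamma>: "log 2 cap_const < \<gamma>" and b: "0 < b"
    and tb: "\<And>a. 1 / 4 \<le> cmod a \<and> cmod a < 1 \<Longrightarrow> test_fun \<omega> a p \<gamma> \<in> Y \<and> nY (test_fun \<omega> a p \<gamma>) \<le> b"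
    and l: "0 \<le> l" and freq: "\<And>r. r < 1 \<Longrightarrow> \<exists>a. r < cmod a \<and> cmod a < 1 \<and> ennreal l < test_integral \<gamma> a"
    and K: "compact_op Y nY Z nZ K"
  shows "l powr (1 / q) \<le> 32 * b * op_norm Y nY nZ (\<lambda>f x. T f x - K f x)"
proof -
  define x where "x = op_norm Y nY nZ (\<lambda>f x. T f x - K f x)"
  have x0: "0 \<le> x" unfolding x_def by (rule op_norm_nonneg[OF K])
  have KZ: "K h \<in> Z" if "h \<in> Y" for h using K that by (simp add: compact_op_def linear_op_def)
  have Kadd: "nZ (\<lambda>x. K (\<lambda>y. f y + g y) x - (K f x + K g x)) = 0" if "f \<in> Y" "g \<in> Y" for f g
    using K that unfolding compact_op_def linear_op_def by blast
  have Kscale: "nZ (\<lambda>x. K (\<lambda>y. c * f y) x - c * K f x) = 0" if "f \<in> Y" for f c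
    using K that unfolding compact_op_def linear_op_def by blast
  have "\<exists>a. max (1 / 4) (1 - inverse (real (Suc n))) < cmod a \<and> cmod a < 1 \<and> ennreal l < test_integral \<gamma> a" for n
    by (rule freq) simp
  then obtain a0 where a0: "\<And>n. max (1 / 4) (1 - inverse (real (Suc n))) < cmod (a0 n)" "\<And>n. cmod (a0 n) < 1"
    "\<And>n. ennreal l < test_integral \<gamma> (a0 n)" by metis
  have a0lim: "(\<lambda>n. cmod (a0 n)) \<longlonglongrightarrow> 1"
  proof (rule tendsto_sandwich[OF _ _ _ tendsto_const])
    show "(\<lambda>n. 1 - inverse (real (Suc n))) \<longlonglongrightarrow> 1"
      using tendsto_diff[OF tendsto_const[of 1] LIMSEQ_inverse_real_of_nat] by simp
    show "\<forall>\<^sub>F n in sequentially. 1 - inverse (real (Suc n)) \<le> cmod (a0 n)"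
    proof (intro always_eventually allI)
      fix n
      have "1 - inverse (real (Suc n)) \<le> max (1 / 4) (1 - inverse (real (Suc n)))" by (rule max.cobounded2)
      then show "1 - inverse (real (Suc n)) \<le> cmod (a0 n)" using a0(1)[of n] by (rule order.trans[OF _ less_imp_le])
    qed
    show "\<forall>\<^sub>F n in sequentially. cmod (a0 n) \<le> 1" using a0(2) by (intro always_eventually allI less_imp_le)
  qed
  have F0: "test_fun \<omega> (a0 n) p \<gamma> \<in> Y \<and> nY (test_fun \<omega> (a0 n) p \<gamma>) \<le> b" for n
    using a0(1)[of n] a0(2)[of n] by (intro tb) simp
  have Kc: "\<exists>s g. strict_mono (s :: nat \<Rightarrow> nat) \<and> g \<in> Z \<and> (\<lambda>n. nZ (\<lambda>x. K (f (s n)) x - g x)) \<longlonglongrightarrow> 0"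
    if "\<forall>n::nat. f n \<in> Y \<and> nY (f n) \<le> B" for f B
    using K that unfolding compact_op_def by blast
  have "\<exists>s g. strict_mono (s :: nat \<Rightarrow> nat) \<and> g \<in> Z \<and> (\<lambda>n. nZ (\<lambda>x. K (test_fun \<omega> (a0 (s n)) p \<gamma>) x - g x)) \<longlonglongrightarrow> 0"
    by (rule Kc[of "\<lambda>n. test_fun \<omega> (a0 n) p \<gamma>" b]) (use F0 in blast)
  then obtain \<sigma> g where \<sigma>: "strict_mono (\<sigma> :: nat \<Rightarrow> nat)" and g: "g \<in> Z"
    and glim: "(\<lambda>n. nZ (\<lambda>x. K (test_fun \<omega> (a0 (\<sigma> n)) p \<gamma>) x - g x)) \<longlonglongrightarrow> 0"
    by blast
  define a where "a = (\<lambda>n. a0 (\<sigma> n))"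
  define F where "F = (\<lambda>n. test_fun \<omega> (a n) p \<gamma>)"
  have FY: "F n \<in> Y" "nY (F n) \<le> b" for n using F0[of "\<sigma> n"] by (auto simp: F_def a_def)
  have big: "ennreal l < (\<integral>\<^sup>+ z. ennreal (cmod (T (F n) z) powr q) \<partial>\<mu>)" for n
    using a0(3)[of "\<sigma> n"] test_integral_norm[of \<gamma> "a n"] by (simp add: F_def a_def)
  have alim: "(\<lambda>n. cmod (a n)) \<longlonglongrightarrow> 1"
    using LIMSEQ_subseq_LIMSEQ[OF a0lim \<sigma>] by (simp add: a_def comp_def)
  have a14: "1 / 4 \<le> cmod (a n)" "cmod (a n) < 1" for n using a0(1)[of "\<sigma> n"] a0(2)[of "\<sigma> n"] by (auto simp: a_def)
  have Flim: "(\<lambda>n. F n z) \<longlonglongrightarrow> 0" if "cmod z < 1" for z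
    unfolding F_def by (rule test_fun_tendsto_0[OF \<gamma> a14 alim that])
  define e where "e = (\<lambda>n. nZ (\<lambda>x. K (F n) x - g x))"
  have elim: "e \<longlonglongrightarrow> 0" using glim by (simp add: e_def F_def a_def)
  have e0: "0 \<le> e n" for n by (simp add: e_def Lq_norm_nonneg)
  \<comment> \<open>The scaled differences \<open>c (F\<^sub>n - F\<^sub>m)\<close> lie in the unit ball: the quasi-triangle inequality contributes \<open>4\<close>, the two terms \<open>2\<close>.\<close>
  define c where "c = 1 / (8 * b)"
  have c: "0 < c" using b by (simp add: c_def)
  have diff: "nZ (\<lambda>z. of_real c * T (F n) z - of_real c * T (F m) z) \<le> 4 * x + 64 * c * (e n + e m)" for n m
  proof -
    define h where "h = (\<lambda>z. of_real c * F n z + of_real (- c) * F m z)"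
    have hY: "h \<in> Y" unfolding h_def by (rule bergman_lincomb(1)[OF FY(1) FY(1)])
    have "nY h \<le> 4 * (cmod (of_real c) * nY (F n) + cmod (of_real (- c)) * nY (F m))"
      unfolding h_def by (rule bergman_lincomb(2)[OF FY(1) FY(1)])
    also have "\<dots> \<le> 4 * (c * b + c * b)"
      using c FY(2)[of n] FY(2)[of m] by (intro mult_left_mono add_mono mult_mono) (auto simp: bergman_norm_nonneg)
    also have "\<dots> = 1" using b by (simp add: c_def)
    finally have hn: "nY h \<le> 1" .
    have Th: "nZ (\<lambda>z. T h z - K h z) \<le> x" unfolding x_def by (rule op_norm_upper[OF K hY hn])
    have cF: "(\<lambda>z. d * F k z) \<in> Y" for d k using bergman_lincomb(1)[OF FY(1)[of k] FY(1)[of k], of d 0] by simp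
    have ThZ: "(\<lambda>z. T h z - K h z) \<in> Z" by (rule Lq_diff(1)[OF T_in[OF hY] KZ[OF hY] q1])
    \<comment> \<open>The operator \<open>K\<close> is linear only up to functions of seminorm zero; \<open>r1\<close>, \<open>r2\<close>, \<open>r3\<close> are these defects.\<close>
    define r1 where "r1 = (\<lambda>z. K h z - (K (\<lambda>y. of_real c * F n y) z + K (\<lambda>y. of_real (- c) * F m y) z))"
    define r2 where "r2 = (\<lambda>z. K (\<lambda>y. of_real c * F n y) z - of_real c * K (F n) z)"
    define r3 where "r3 = (\<lambda>z. K (\<lambda>y. of_real (- c) * F m y) z - of_real (- c) * K (F m) z)"
    have rn: "nZ r1 = 0" "nZ r2 = 0" "nZ r3 = 0"
      using Kadd[OF cF cF, of "of_real c" n "of_real (- c)" m] Kscale[OF FY(1), of "of_real c" n] Kscale[OF FY(1), of "of_real (- c)" m]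
      unfolding r1_def r2_def r3_def h_def by blast+
    have rZ: "r1 \<in> Z" "r2 \<in> Z" "r3 \<in> Z"
      unfolding r1_def r2_def r3_def
      by (intro Lq_diff(1) Lq_add(1) Lq_scale(1) KZ hY cF FY(1) q1)+
    define k1 where "k1 = (\<lambda>z. of_real c * (K (F n) z - g z))"
    define k2 where "k2 = (\<lambda>z. of_real (- c) * (K (F m) z - g z))"
    have dZ: "(\<lambda>z. K (F k) z - g z) \<in> Z" for k by (rule Lq_diff(1)[OF KZ[OF FY(1)] g q1])
    have kZ: "k1 \<in> Z" "k2 \<in> Z" unfolding k1_def k2_def by (intro Lq_scale(1) dZ q1)+
    have kn: "nZ k1 \<le> c * e n" "nZ k2 \<le> c * e m"
      using Lq_scale(2)[OF dZ q1, of "of_real c" n] Lq_scale(2)[OF dZ q1, of "of_real (- c)" m] c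
      by (auto simp: k1_def k2_def e_def)
    define R where "R = (\<lambda>z. r1 z + (r2 z + r3 z))"
    have RZ: "(\<lambda>z. r2 z + r3 z) \<in> Z" "R \<in> Z" unfolding R_def by (intro Lq_add(1) rZ q1)+
    have "nZ R \<le> 4 * (nZ r1 + nZ (\<lambda>z. r2 z + r3 z))" unfolding R_def by (rule Lq_add(2)[OF rZ(1) RZ(1) q1])
    moreover have "nZ (\<lambda>z. r2 z + r3 z) \<le> 4 * (nZ r2 + nZ r3)" by (rule Lq_add(2)[OF rZ(2,3) q1])
    ultimately have R0: "nZ R \<le> 0" using rn by simp
    define k where "k = (\<lambda>z. k1 z + k2 z)"
    have kZ': "k \<in> Z" unfolding k_def by (rule Lq_add(1)[OF kZ q1])
    have kn': "nZ k \<le> 4 * (c * e n + c * e m)"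
      unfolding k_def by (rule order_trans[OF Lq_add(2)[OF kZ q1]]) (use kn in simp)
    define S where "S = (\<lambda>z. R z + k z)"
    have SZ: "S \<in> Z" unfolding S_def by (rule Lq_add(1)[OF RZ(2) kZ' q1])
    have "nZ S \<le> 4 * (nZ R + nZ k)" unfolding S_def by (rule Lq_add(2)[OF RZ(2) kZ' q1])
    also have "\<dots> \<le> 4 * (0 + 4 * (c * e n + c * e m))" using R0 kn' by (intro mult_left_mono add_mono) auto
    finally have Sn: "nZ S \<le> 16 * c * (e n + e m)" by (simp add: algebra_simps)
    have "(\<lambda>z. of_real c * T (F n) z - of_real c * T (F m) z) = (\<lambda>z. (T h z - K h z) + S z)"
      by (simp add: S_def R_def k_def k1_def k2_def r1_def r2_def r3_def T_apply h_def fun_eq_iff algebra_simps)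
    then have "nZ (\<lambda>z. of_real c * T (F n) z - of_real c * T (F m) z) = nZ (\<lambda>z. (T h z - K h z) + S z)" by (rule arg_cong)
    also have "\<dots> \<le> 4 * (nZ (\<lambda>z. T h z - K h z) + nZ S)" by (rule Lq_add(2)[OF ThZ SZ q1])
    also have "\<dots> \<le> 4 * (x + 16 * c * (e n + e m))" using Th Sn by (intro mult_left_mono add_mono) auto
    finally show ?thesis by (simp add: algebra_simps)
  qed
  have main: "c * l powr (1 / q) \<le> 4 * x + t" if t: "0 < t" for t
  proof -
    define t' where "t' = t / (128 * c)"
    have t': "0 < t'" using t c by (simp add: t'_def)
    have "\<forall>\<^sub>F n in sequentially. e n < t'" using order_tendstoD(2)[OF elim t'] .
    then obtain N where N: "\<And>n. N \<le> n \<Longrightarrow> e n < t'" unfolding eventually_sequentially by blast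
    define D where "D = (\<lambda>m z. of_real c * T (F N) z - of_real c * T (F m) z)"
    have TZ: "T (F n) \<in> Z" for n by (rule T_in[OF FY(1)])
    have DZ: "D m \<in> Z" for m unfolding D_def by (intro Lq_diff(1) Lq_scale(1) TZ q1)
    have Dm [measurable]: "D m \<in> borel_measurable \<mu>" for m using DZ[of m] by (simp add: Lq_space_def)
    have Dn: "(\<integral>\<^sup>+ z. ennreal (cmod (D m z) powr q) \<partial>\<mu>) \<le> ennreal ((4 * x + t) powr q)" if m: "N \<le> m" for m
    proof -
      have "nZ (D m) \<le> 4 * x + 64 * c * (e N + e m)" unfolding D_def by (rule diff)
      also have "\<dots> \<le> 4 * x + 64 * c * (t' + t')"
        using N[of N] N[OF m] c by (intro add_left_mono mult_left_mono add_mono) auto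
      also have "\<dots> = 4 * x + t" using c by (simp add: t'_def)
      finally have "nZ (D m) powr q \<le> (4 * x + t) powr q" using q_pos by (intro powr_mono2) (auto simp: Lq_norm_nonneg)
      then show ?thesis unfolding Lq_norm_powr[OF DZ q_pos, symmetric] by (rule ennreal_leI)
    qed
    have "ennreal (c powr q) * ennreal l \<le> ennreal (c powr q) * (\<integral>\<^sup>+ z. ennreal (cmod (T (F N) z) powr q) \<partial>\<mu>)"
      by (rule mult_left_mono[OF less_imp_le[OF big]]) simp
    also have "\<dots> = (\<integral>\<^sup>+ z. ennreal (c powr q) * ennreal (cmod (T (F N) z) powr q) \<partial>\<mu>)"
    proof (rule nn_integral_cmult[symmetric])
      have [measurable]: "T (F N) \<in> borel_measurable \<mu>" using TZ by (simp add: Lq_space_def)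
      show "(\<lambda>z. ennreal (cmod (T (F N) z) powr q)) \<in> borel_measurable \<mu>" by measurable
    qed
    also have "\<dots> = (\<integral>\<^sup>+ z. liminf (\<lambda>m. ennreal (cmod (D m z) powr q)) \<partial>\<mu>)"
    proof (rule nn_integral_cong)
      fix z assume "z \<in> space \<mu>"
      then have "cmod (\<phi> z) < 1" using phi_in_disk by (simp add: space_mu)
      from Flim[OF this] have "(\<lambda>m. of_real c * T (F N) z - of_real c * T (F m) z) \<longlonglongrightarrow> of_real c * T (F N) z - of_real c * (u z * 0)"
        unfolding T_apply by (intro tendsto_intros)
      then have "(\<lambda>m. D m z) \<longlonglongrightarrow> of_real c * T (F N) z" by (simp add: D_def)
      then have "(\<lambda>m. ennreal (cmod (D m z) powr q)) \<longlonglongrightarrow> ennreal (cmod (of_real c * T (F N) z) powr q)"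
        using q_pos by (intro tendsto_ennrealI tendsto_powr2 tendsto_norm tendsto_const always_eventually) auto
      from lim_imp_Liminf[OF sequentially_bot this]
      have "liminf (\<lambda>m. ennreal (cmod (D m z) powr q)) = ennreal (cmod (of_real c * T (F N) z) powr q)" .
      also have "\<dots> = ennreal (c powr q) * ennreal (cmod (T (F N) z) powr q)"
        using c unfolding norm_mult by (simp add: powr_mult ennreal_mult)
      finally show "ennreal (c powr q) * ennreal (cmod (T (F N) z) powr q) = liminf (\<lambda>m. ennreal (cmod (D m z) powr q))" by simp
    qed
    also have "\<dots> \<le> liminf (\<lambda>m. \<integral>\<^sup>+ z. ennreal (cmod (D m z) powr q) \<partial>\<mu>)"
      by (rule nn_integral_liminf) measurable
    also have "\<dots> \<le> limsup (\<lambda>m. \<integral>\<^sup>+ z. ennreal (cmod (D m z) powr q) \<partial>\<mu>)"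
      by (rule Liminf_le_Limsup) simp
    also have "\<dots> \<le> ennreal ((4 * x + t) powr q)"
      by (rule Limsup_bounded) (use Dn in \<open>auto simp: eventually_sequentially\<close>)
    finally have "ennreal (c powr q * l) \<le> ennreal ((4 * x + t) powr q)" using l by (simp add: ennreal_mult)
    then have "c powr q * l \<le> (4 * x + t) powr q" by (simp add: ennreal_le_iff)
    then have "(c powr q * l) powr (1 / q) \<le> ((4 * x + t) powr q) powr (1 / q)"
      using q_pos l by (intro powr_mono2) auto
    then show ?thesis using q_pos c x0 t by (simp add: powr_mult powr_powr)
  qed
  have "c * l powr (1 / q) \<le> 4 * x" by (rule field_le_epsilon) (rule main)
  then show ?thesis using b unfolding x_def[symmetric] c_def by (simp add: field_simps)
qed

lemma ess_norm_lower_bound: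
  assumes "log 2 cap_const < \<gamma>" and b: "0 < b"
    and "\<And>a. 1 / 4 \<le> cmod a \<and> cmod a < 1 \<Longrightarrow> test_fun \<omega> a p \<gamma> \<in> Y \<and> nY (test_fun \<omega> a p \<gamma>) \<le> b"
    and l: "0 \<le> l" and "\<And>r. r < 1 \<Longrightarrow> \<exists>a. r < cmod a \<and> cmod a < 1 \<and> ennreal l < test_integral \<gamma> a"
  shows "l \<le> (32 * b) powr q * ess_norm Y nY Z nZ T powr q"
proof -
  have "l powr (1 / q) / (32 * b) \<le> ess_norm Y nY Z nZ T"
    unfolding ess_norm_def
  proof (rule cINF_greatest)
    show "{K. compact_op Y nY Z nZ K} \<noteq> {}" using cutoff_compact[of 0] by auto
    fix K assume "K \<in> {K. compact_op Y nY Z nZ K}"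
    then have "l powr (1 / q) \<le> 32 * b * op_norm Y nY nZ (\<lambda>f x. T f x - K f x)"
      by (intro compact_difference_lower_bound[OF assms]) auto
    then show "l powr (1 / q) / (32 * b) \<le> op_norm Y nY nZ (\<lambda>f x. T f x - K f x)"
      using b by (simp add: pos_divide_le_eq mult.commute)
  qed
  then have "l powr (1 / q) \<le> 32 * b * ess_norm Y nY Z nZ T" using b by (simp add: pos_divide_le_eq mult.commute)
  then have "(l powr (1 / q)) powr q \<le> (32 * b * ess_norm Y nY Z nZ T) powr q" using q_pos by (intro powr_mono2) auto
  then show ?thesis using q_pos l by (simp add: powr_powr powr_mult)
qed

end

lemma eventually_cmod_at_left:
  "eventually P (filtercomap cmod (at_left 1)) \<longleftrightarrow> (\<exists>r<1. \<forall>a. r < cmod a \<and> cmod a < 1 \<longrightarrow> P a)"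
proof -
  have "eventually P (filtercomap cmod (at_left 1)) \<longleftrightarrow> (\<exists>Q. (\<exists>r<1. \<forall>y>r. y < 1 \<longrightarrow> Q y) \<and> (\<forall>a. Q (cmod a) \<longrightarrow> P a))"
    unfolding eventually_filtercomap by (subst eventually_at_left[of 0 1]) auto
  also have "\<dots> \<longleftrightarrow> (\<exists>r<1. \<forall>a. r < cmod a \<and> cmod a < 1 \<longrightarrow> P a)"
  proof
    assume "\<exists>Q. (\<exists>r<1. \<forall>y>r. y < 1 \<longrightarrow> Q y) \<and> (\<forall>a. Q (cmod a) \<longrightarrow> P a)"
    then show "\<exists>r<1. \<forall>a. r < cmod a \<and> cmod a < 1 \<longrightarrow> P a" by blast
  next
    assume "\<exists>r<1. \<forall>a. r < cmod a \<and> cmod a < 1 \<longrightarrow> P a"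
    then obtain r where "r < 1" "\<forall>a. r < cmod a \<and> cmod a < 1 \<longrightarrow> P a" by blast
    then show "\<exists>Q. (\<exists>r<1. \<forall>y>r. y < 1 \<longrightarrow> Q y) \<and> (\<forall>a. Q (cmod a) \<longrightarrow> P a)"
      by (intro exI[of _ "\<lambda>y. r < y \<and> y < 1"]) auto
  qed
  finally show ?thesis .
qed

theorem theorem2:
  fixes \<omega> :: "complex \<Rightarrow> real" and p q :: real
  assumes "\<omega> \<in> D_hat" and "1 \<le> p" and "p \<le> q"
  shows "\<exists>\<gamma>0>0. \<forall>\<gamma>>\<gamma>0. \<exists>C>0.
    \<forall>(u :: complex \<Rightarrow> complex) (\<phi> :: complex \<Rightarrow> complex) (\<mu> :: complex measure).
      sets \<mu> = sets (restrict_space borel unit_disk) \<and>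
      u \<in> borel_measurable (restrict_space borel unit_disk) \<and>
      \<phi> holomorphic_on unit_disk \<and> \<phi> ` unit_disk \<subseteq> unit_disk \<and>
      bounded_op (bergman_space \<omega> p) (bergman_norm \<omega> p) (Lq_space \<mu> q) (Lq_norm \<mu> q)
        (weighted_comp u \<phi>) \<longrightarrow>
      (let E = ennreal (ess_norm (bergman_space \<omega> p) (bergman_norm \<omega> p)
                 (Lq_space \<mu> q) (Lq_norm \<mu> q) (weighted_comp u \<phi>) powr q);
           L = Limsup (filtercomap cmod (at_left 1))
                 (\<lambda>a. \<integral>\<^sup>+z. ennreal (cmod (test_fun \<omega> a p \<gamma> (\<phi> z)) powr q
                                  * cmod (u z) powr q) \<partial>\<mu>)
       in ennreal (1 / C) * L \<le> E \<and> E \<le> ennreal C * L)"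
proof -
  obtain M Cw where RD: "radial_doubling M Cw"
    and tr: "\<And>\<Phi>. \<Phi> \<in> borel_measurable disk_borel \<Longrightarrow> (\<integral>\<^sup>+ z. \<Phi> z * ennreal (\<omega> z) \<partial>disk_area) = (\<integral>\<^sup>+ z. \<Phi> z \<partial>M)"
    and wm: "\<omega> \<in> borel_measurable disk_area"
    using weight_measure_exists[OF assms(1)] by blast
  interpret radial_doubling M Cw by (rule RD)
  have wpos: "0 < \<omega> z" if "z \<in> unit_disk" for z
    using assms(1) that unfolding D_hat_def radial_weight_def by blast
  interpret weighted_bergman M Cw \<omega> p q
    by unfold_locales (use tr wm wpos assms in auto)
  obtain A where A: "0 < A" and emb: "\<And>\<nu> \<kappa> f I. finite_measure \<nu> \<and> sets \<nu> = sets M \<and> 0 \<le> \<kappa> \<and>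
     carleson_bound \<nu> \<kappa> (q / p) \<and>
     f holomorphic_on unit_disk \<and> 0 < I \<and> (\<integral>\<^sup>+ z. ennreal (cmod (f z) powr p) \<partial>M) \<le> ennreal I \<Longrightarrow>
     (\<integral>\<^sup>+ z. ennreal (cmod (f z) powr q) \<partial>\<nu>) \<le> ennreal (A * \<kappa> * I powr (q / p))"
    using carleson_embedding[OF p_pos assms(3)] by blast
  define \<gamma>0 where "\<gamma>0 = log 2 cap_const"
  have \<gamma>0: "0 < \<gamma>0" using cap_const_ge by (simp add: \<gamma>0_def)
  show ?thesis
  proof (rule exI[of _ \<gamma>0], intro conjI \<gamma>0 allI impI)
    fix \<gamma> assume \<gamma>: "\<gamma>0 < \<gamma>"
    then have \<gamma>l: "log 2 cap_const < \<gamma>" and \<gamma>pos: "0 < \<gamma>" using \<gamma>0 by (auto simp: \<gamma>0_def)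
    obtain b where b: "0 < b" and tb: "\<And>a. 1 / 4 \<le> cmod a \<and> cmod a < 1 \<Longrightarrow> test_fun \<omega> a p \<gamma> \<in> Y \<and> nY (test_fun \<omega> a p \<gamma>) \<le> b"
      using test_fun_bounded[OF \<gamma>l] by blast
    define C1 where "C1 = (32 * b) powr q"
    define C2 where "C2 = A * (2 powr ((\<gamma> + 1) * (q / p)) * cap_const powr (q / p)) * (cap_const ^ 4) powr (q / p)"
    have C1: "0 < C1" using b by (simp add: C1_def)
    have C2: "0 < C2" using A cap_const_ge by (simp add: C2_def)
    define C where "C = max C1 C2"
    have C: "0 < C" "C1 \<le> C" "C2 \<le> C" using C1 by (auto simp: C_def)
    have "ennreal (1 / C) * L \<le> E \<and> E \<le> ennreal C * L"
      if hyp: "sets \<mu> = sets disk_borel \<and> u \<in> borel_measurable disk_borel \<and>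
          \<phi> holomorphic_on unit_disk \<and> \<phi> ` unit_disk \<subseteq> unit_disk \<and>
          bounded_op (bergman_space \<omega> p) (bergman_norm \<omega> p) (Lq_space \<mu> q) (Lq_norm \<mu> q) (weighted_comp u \<phi>)"
        and E: "E = ennreal (ess_norm (bergman_space \<omega> p) (bergman_norm \<omega> p) (Lq_space \<mu> q) (Lq_norm \<mu> q) (weighted_comp u \<phi>) powr q)"
        and L: "L = Limsup (filtercomap cmod (at_left 1)) (\<lambda>a. \<integral>\<^sup>+z. ennreal (cmod (test_fun \<omega> a p \<gamma> (\<phi> z)) powr q * cmod (u z) powr q) \<partial>\<mu>)"
      for u \<phi> :: "complex \<Rightarrow> complex" and \<mu> :: "complex measure" and E L :: ennreal
    proof -
      interpret bounded_weighted_comp M Cw \<omega> p q u \<phi> \<mu>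
        by unfold_locales (use hyp in auto)
      define ess where "ess = ess_norm Y nY Z nZ T powr q"
      have ess0: "0 \<le> ess" by (simp add: ess_def)
      have Et: "E = ennreal ess" by (simp add: E ess_def)
      have Lt: "L = Limsup (filtercomap cmod (at_left 1)) (test_integral \<gamma>)"
        unfolding L by (rule arg_cong[where f = "Limsup _"]) (simp add: test_integral_def fun_eq_iff)
      have low: "L \<le> ennreal (C1 * ess)"
      proof (rule ennreal_le_epsilon)
        fix e :: real assume e: "0 < e"
        define l where "l = C1 * ess + e"
        have l0: "0 \<le> l" using C1 ess0 e by (simp add: l_def)
        have "L \<le> ennreal l"
        proof (rule ccontr)
          assume nL: "\<not> L \<le> ennreal l"
          have freq: "\<exists>a. r < cmod a \<and> cmod a < 1 \<and> ennreal l < test_integral \<gamma> a" if r: "r < 1" for r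
          proof (rule ccontr)
            assume "\<not> ?thesis"
            then have "\<forall>a. r < cmod a \<and> cmod a < 1 \<longrightarrow> test_integral \<gamma> a \<le> ennreal l" by (meson not_le)
            then have "eventually (\<lambda>a. test_integral \<gamma> a \<le> ennreal l) (filtercomap cmod (at_left 1))"
              unfolding eventually_cmod_at_left using r by blast
            then have "L \<le> ennreal l" unfolding Lt by (rule Limsup_bounded)
            then show False using nL by simp
          qed
          have "l \<le> C1 * ess"
            unfolding C1_def ess_def by (rule ess_norm_lower_bound[OF \<gamma>l b tb l0 freq])
          then show False using e by (simp add: l_def)
        qed
        then show "L \<le> ennreal (C1 * ess) + ennreal e"
          unfolding l_def using C1 ess0 e by (simp add: ennreal_plus)
      qed
      have up: "E \<le> ennreal C2 * L"
      proof (cases "L = \<infinity>")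
        case True
        then show ?thesis using C2 by (simp add: ennreal_mult_top)
      next
        case False
        then obtain l where l: "L = ennreal l" "0 \<le> l" by (cases L) auto
        have "ess \<le> C2 * l + e" if e: "0 < e" for e
        proof -
          define e' where "e' = e / C2"
          have e': "0 < e'" using e C2 by (simp add: e'_def)
          have "L < ennreal (l + e')" unfolding l(1) using l(2) e' by (simp add: ennreal_less_iff)
          then have "eventually (\<lambda>a. test_integral \<gamma> a < ennreal (l + e')) (filtercomap cmod (at_left 1))"
            unfolding Lt by (rule Limsup_lessD)
          then obtain r0 where r0: "r0 < 1" "\<And>a. r0 < cmod a \<Longrightarrow> cmod a < 1 \<Longrightarrow> test_integral \<gamma> a \<le> ennreal (l + e')"
            unfolding eventually_cmod_at_left by (meson less_imp_le)
          have "ess \<le> C2 * (l + e')"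
            unfolding ess_def C2_def by (rule ess_norm_upper_bound[OF A emb \<gamma>pos _ r0]) (use l(2) e' in auto)
          also have "\<dots> = C2 * l + e" using C2 by (simp add: e'_def distrib_left)
          finally show ?thesis .
        qed
        then have "ess \<le> C2 * l" by (rule field_le_epsilon)
        then show ?thesis unfolding Et l(1) using C2 l(2) by (simp add: ennreal_mult[symmetric] ennreal_leI)
      qed
      have "ennreal (1 / C) * L \<le> ennreal (1 / C) * ennreal (C1 * ess)" by (rule mult_left_mono[OF low]) simp
      also have "\<dots> = ennreal (1 / C * (C1 * ess))" using C C1 ess0 by (simp add: ennreal_mult[symmetric])
      also have "\<dots> \<le> ennreal ess"
      proof (rule ennreal_leI)
        have "C1 * ess \<le> C * ess" using C ess0 by (intro mult_right_mono) auto
        then show "1 / C * (C1 * ess) \<le> ess" using C(1) by (simp add: pos_divide_le_eq mult.commute)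
      qed
      finally have "ennreal (1 / C) * L \<le> E" by (simp add: Et)
      moreover have "E \<le> ennreal C * L"
        by (rule order_trans[OF up]) (intro mult_right_mono ennreal_leI C, simp)
      ultimately show ?thesis by simp
    qed
    then show "\<exists>C>0. \<forall>(u :: complex \<Rightarrow> complex) (\<phi> :: complex \<Rightarrow> complex) (\<mu> :: complex measure).
      sets \<mu> = sets (restrict_space borel unit_disk) \<and>
      u \<in> borel_measurable (restrict_space borel unit_disk) \<and>
      \<phi> holomorphic_on unit_disk \<and> \<phi> ` unit_disk \<subseteq> unit_disk \<and>
      bounded_op (bergman_space \<omega> p) (bergman_norm \<omega> p) (Lq_space \<mu> q) (Lq_norm \<mu> q)
        (weighted_comp u \<phi>) \<longrightarrow>
      (let E = ennreal (ess_norm (bergman_space \<omega> p) (bergman_norm \<omega> p)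
                 (Lq_space \<mu> q) (Lq_norm \<mu> q) (weighted_comp u \<phi>) powr q);
           L = Limsup (filtercomap cmod (at_left 1))
                 (\<lambda>a. \<integral>\<^sup>+z. ennreal (cmod (test_fun \<omega> a p \<gamma> (\<phi> z)) powr q
                                  * cmod (u z) powr q) \<partial>\<mu>)
       in ennreal (1 / C) * L \<le> E \<and> E \<le> ennreal C * L)"
      unfolding Let_def using C(1) by blast
  qed
qed

end
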